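(* For each $n\ge 1$ let $x_1,\dots,x_n$ be the random points in $\frac1n\mathbb Z$ with joint probability mass function proportional to $$\prod_{1\le i<j\le n}\big(\mu_n(x_i)-\mu_n(x_j)\big)^2\prod_{j=1}^n w_n(nx_j),$$ with associated recurrence coefficients $a_{j,n},b_{j,n}$. Suppose there exist real-valued continuous functions $a,b$ on $[0,1]$, with $a\ge0$ and $a\not\equiv0$, such that $\lim_{j/n\to\xi}a_{j,n}=a(\xi)$ and $\lim_{j/n\to\xi}b_{j,n}=b(\xi)$ for every $\xi\in[0,1]$. Assume there exist a function $\mu$ on $\mathbb R$, a bounded set $K\subset\mathbb R$ with $\mu(K)$ compact, and $\epsilon>0$ such that: (1) for all $k\in\mathbb N$, $\mathbb E\big[X_n(|\mu_n|^k\chi_{K^c})\big]=O(n^{-\epsilon})$ as $n\to\infty$; (2) $\mu_n$ has the uniform limit $\mu$, i.e. $\lim_{n\to\infty}\sup_{x\in\frac1n\mathbb Z\cap K}|\mu_n(x)-\mu(x)|=0$, and $\mu$ is strictly monotone on $K$. Additionally, assume that there exists $\gamma>2$ such that $$\int_0^1|a(\xi)|^{-1/\gamma}\,d\xi<\infty .$$ Consider $f$ such that $f$ and $f\circ\mu^{-1}$ are Riemann integrable on $K$ and $\mu(K)$ respectively, and such that $f\circ\mu^{-1}$ has at most polynomial growth at infinity. Then $$\frac1nX_n(f)\to\frac1\pi\int_0^1\int_{\mu^{-1}(b(\xi)-2a(\xi))}^{\mu^{-1}(b(\xi)+2a(\xi))}f(x)\frac{d\mu(x)\,d\xi}{\sqrt{4a(\xi)^2-(\mu(x)-b(\xi))^2}}$$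 as $n\to\infty$ almost surely.
   Context: For each $n$, $\nu_n:\mathbb Z\to\mathbb R$ is strictly monotone and $w_n:\mathbb Z\to[0,\infty)$ satisfies $\sum_{y\in\mathbb Z}|\nu_n(y)|^kw_n(y)<\infty$ for all $k\in\mathbb N$ and has at least $n$ points in its support. Put $\mu_n(x)=\nu_n(nx)$ for $x\in\frac1n\mathbb Z$. For a function $f:\mathbb R\to\mathbb R$, $X_n(f)=\sum_{j=1}^nf(x_j)$. $\chi_{K^c}$ is the indicator function of the complement of $K$. The point processes for different $n$ are regarded as defined on a common probability space. Recurrence coefficients: $p_{k,n}$ is the polynomial of degree $k$ with positive leading coefficient such that $\sum_{y\in\mathbb Z}p_{k,n}(\nu_n(y))p_{l,n}(\nu_n(y))w_n(y)=\delta_{k,l}$, and $r_{k,n}(y)=p_{k,n}(\nu_n(y))$. They satisfy $\nu_n(y)r_{j,n}(y)=a_{j,n}r_{j+1,n}(y)+b_{j,n}r_{j,n}(y)+a_{j-1,n}r_{j-1,n}(y)$ for $j\ge0$, with $a_{j,n}>0$, $b_{j,n}\in\mathbb R$, $a_{-1,n}=0$. The limit $\lim_{j/n\to\xi}$ means that $n\to\infty$ with $j/n\to\xi$ simultaneously. $\mu^{-1}$ is the inverse function of $\mu$. The inner integral against $d\mu(x)$ is understood via the substitution $u=\mu(x)$, i.e. as $\int_{b(\xi)-2a(\xi)}^{b(\xi)+2a(\xi)}f(\mu^{-1}(u))\,(4a(\xi)^2-(u-b(\xi))^2)^{-1/2}du$.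
   Formalization: The growth condition on f∘μ^{-1} at infinity is replaced by: |f(x)| ≤ C(1+|μ_n(x)|^k) for x in (1/n)Z outside K and all large n. As written it is vacuous on compact μ(K), or, with μ unrelated to μ_n off K, the claim is false. *)

theory Defs
  imports "HOL-Probability.Probability" "HOL-Computational_Algebra.Polynomial"
begin

definition weight_support :: "(int \<Rightarrow> real) \<Rightarrow> int set" where
  "weight_support w = {y. w y \<noteq> 0}"

text \<open>The orders for which orthonormal polynomials exist: all of them if the weight has infinite
  support, and those below the number \<open>N\<close> of support points otherwise.\<close>

definition ortho_orders :: "(int \<Rightarrow> real) \<Rightarrow> nat set" where
  "ortho_orders w = {k. infinite (weight_support w) \<or> k < card (weight_support w)}"

definition orthonormal_polynomials ::
    "(int \<Rightarrow> real) \<Rightarrow> (int \<Rightarrow> real) \<Rightarrow> (nat \<Rightarrow> real poly) \<Rightarrow> bool" where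
  "orthonormal_polynomials v w p \<longleftrightarrow>
     (\<forall>k \<in> ortho_orders w. degree (p k) = k \<and> lead_coeff (p k) > 0 \<and>
        (\<forall>l \<in> ortho_orders w.
           ((\<lambda>y. poly (p k) (v y) * poly (p l) (v y) * w y) has_sum (if k = l then 1 else 0)) UNIV))"

text \<open>The three-term recurrence. If the support has \<open>N < \<infinity>\<close> points, \<open>p N\<close> and hence the
  coefficient \<open>A (N - 1)\<close> do not exist; the recurrence for \<open>j = N - 1\<close> then holds on the support
  without its first term, which still determines \<open>B (N - 1)\<close>. Values of \<open>A\<close> and \<open>B\<close> outside
  \<open>a_indices w\<close> and \<open>ortho_orders w\<close> are never used.\<close>

definition a_indices :: "(int \<Rightarrow> real) \<Rightarrow> nat set" where
  "a_indices w = {j. Suc j \<in> ortho_orders w}"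

definition recurrence_coefficients ::
    "(int \<Rightarrow> real) \<Rightarrow> (int \<Rightarrow> real) \<Rightarrow> (nat \<Rightarrow> real poly) \<Rightarrow> (nat \<Rightarrow> real) \<Rightarrow> (nat \<Rightarrow> real) \<Rightarrow> bool" where
  "recurrence_coefficients v w p A B \<longleftrightarrow>
     (\<forall>j \<in> a_indices w. A j > 0 \<and>
        (\<forall>y. v y * poly (p j) (v y) =
               A j * poly (p (Suc j)) (v y) + B j * poly (p j) (v y)
               + (if j = 0 then 0 else A (j - 1) * poly (p (j - 1)) (v y)))) \<and>
     (\<forall>j \<in> ortho_orders w - a_indices w. \<forall>y \<in> weight_support w.
        v y * poly (p j) (v y) =
          B j * poly (p j) (v y) + (if j = 0 then 0 else A (j - 1) * poly (p (j - 1)) (v y)))"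

text \<open>The filter of pairs \<open>(n, j)\<close> along which \<open>n \<rightarrow> \<infinity>\<close> and simultaneously \<open>j / n \<rightarrow> \<xi>\<close>, with \<open>j\<close>
  running over those indices in \<open>I n\<close> only.\<close>

definition ratio_filter :: "(nat \<Rightarrow> nat set) \<Rightarrow> real \<Rightarrow> (nat \<times> nat) filter" where
  "ratio_filter I \<xi> =
     inf (inf (filtercomap fst sequentially)
              (filtercomap (\<lambda>(n, j). real j / real n) (nhds \<xi>)))
         (principal {(n, j). j \<in> I n})"

definition lattice :: "nat \<Rightarrow> real set" where
  "lattice n = range (\<lambda>y :: int. of_int y / real n)"

text \<open>\<open>rescale n v\<close> is \<open>x \<mapsto> v (n x)\<close> on \<open>lattice n\<close>; the floor only inverts the embedding of the
  integers into the reals.\<close>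

definition rescale :: "nat \<Rightarrow> (int \<Rightarrow> real) \<Rightarrow> real \<Rightarrow> real" where
  "rescale n v x = v \<lfloor>real n * x\<rfloor>"

definition ensemble_density :: "nat \<Rightarrow> (int \<Rightarrow> real) \<Rightarrow> (int \<Rightarrow> real) \<Rightarrow> (nat \<Rightarrow> real) \<Rightarrow> real" where
  "ensemble_density n v w t =
     (\<Prod>(i, j) \<in> {(i, j). 1 \<le> i \<and> i < j \<and> j \<le> n}. (rescale n v (t i) - rescale n v (t j))\<^sup>2)
     * (\<Prod>j = 1..n. rescale n w (t j))"

text \<open>The points \<open>X 1, \<dots>, X n\<close> are random variables with values in \<open>lattice n\<close> whose joint
  probability mass function is proportional to \<open>D\<close>. The constant is forced to be the normalising
  one, since the probabilities add up to \<open>1\<close>.\<close>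

definition has_joint_pmf_proportional_to ::
    "'w measure \<Rightarrow> nat \<Rightarrow> (nat \<Rightarrow> 'w \<Rightarrow> real) \<Rightarrow> ((nat \<Rightarrow> real) \<Rightarrow> real) \<Rightarrow> bool" where
  "has_joint_pmf_proportional_to M n X D \<longleftrightarrow>
     (\<forall>j \<in> {1..n}. X j \<in> borel_measurable M \<and> (\<forall>\<omega> \<in> space M. X j \<omega> \<in> lattice n)) \<and>
     (\<exists>c. \<forall>t \<in> {1..n} \<rightarrow>\<^sub>E lattice n.
        measure M {\<omega> \<in> space M. \<forall>j \<in> {1..n}. X j \<omega> = t j} = c * D t)"

definition linear_statistic :: "nat \<Rightarrow> (nat \<Rightarrow> 'w \<Rightarrow> real) \<Rightarrow> (real \<Rightarrow> real) \<Rightarrow> 'w \<Rightarrow> real" where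
  "linear_statistic n X f \<omega> = (\<Sum>j = 1..n. f (X j \<omega>))"

text \<open>Classical Riemann integrability over a compact interval, with a constant gauge bounding the
  mesh of the tagged division, and over a bounded set via extension by zero.\<close>

definition riemann_integrable_on_interval :: "(real \<Rightarrow> real) \<Rightarrow> real \<Rightarrow> real \<Rightarrow> bool" where
  "riemann_integrable_on_interval f c d \<longleftrightarrow>
     (\<exists>I. \<forall>e > 0. \<exists>\<delta> > 0. \<forall>P.
        P tagged_division_of {c..d} \<and> (\<lambda>x. ball x \<delta>) fine P \<longrightarrow>
        \<bar>(\<Sum>(x, J) \<in> P. measure lborel J * f x) - I\<bar> < e)"

definition riemann_integrable_on :: "(real \<Rightarrow> real) \<Rightarrow> real set \<Rightarrow> bool"
    (infix "riemann'_integrable'_on" 50) where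
  "f riemann_integrable_on S \<longleftrightarrow>
     (\<exists>c d. S \<subseteq> {c..d} \<and> riemann_integrable_on_interval (\<lambda>x. indicator S x * f x) c d)"

text \<open>At most polynomial growth at infinity of \<open>f\<close> as a function of the coordinate.
  The inverse of \<open>\<mu>\<close> exists a priori only on the compact set \<open>\<mu> ` K\<close>, where growth at infinity says
  nothing, so this is a condition on \<open>f\<close> off \<open>K\<close>, read in the coordinate \<open>\<mu>\<^sub>n\<close> of the \<open>n\<close>-th
  process: since \<open>\<mu>\<^sub>n\<close> is injective on \<open>lattice n\<close>, it says
  \<open>\<bar>f (\<mu>\<^sub>n\<^sup>-\<^sup>1 u)\<bar> \<le> C (1 + \<bar>u\<bar>\<^sup>k)\<close> for \<open>u \<in> \<mu>\<^sub>n ` (lattice n - K)\<close>, with \<open>C\<close> and \<open>k\<close> independent of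
  \<open>n\<close>. If \<open>\<mu>\<^sub>n = \<mu>\<close> off \<open>K\<close> this is the growth of \<open>f \<circ> \<mu>\<^sup>-\<^sup>1\<close> literally. In general it
  cannot be replaced by \<open>\<bar>f x\<bar> \<le> C (1 + \<bar>\<mu> x\<bar>\<^sup>k)\<close>: \<open>\<mu>\<^sub>n\<close> is close to \<open>\<mu>\<close> on \<open>K\<close> only, so the values
  of \<open>\<mu>\<close> off \<open>K\<close> are not related to the process.\<close>

definition polynomial_growth_off ::
    "real set \<Rightarrow> (nat \<Rightarrow> real \<Rightarrow> real) \<Rightarrow> (real \<Rightarrow> real) \<Rightarrow> bool" where
  "polynomial_growth_off K \<mu>s f \<longleftrightarrow>
     (\<exists>C k. \<forall>\<^sub>F n in sequentially. \<forall>x \<in> lattice n - K. \<bar>f x\<bar> \<le> C * (1 + \<bar>\<mu>s n x\<bar> ^ k))"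

end

theory Submission
  imports Defs
begin

text \<open>
  The joint density is the square of a Slater determinant of the orthonormal polynomials, so a
  statistic \<open>\<Sum>\<^sub>j g (y\<^sub>j)\<close> has mean \<open>\<Sum>\<^sub>j G\<^sub>j\<^sub>j\<close> and variance
  \<open>\<Sum>\<^sub>j (\<parallel>g r\<^sub>j\<parallel>\<^sup>2 - \<Sum>\<^sub>i G\<^sub>i\<^sub>j\<^sup>2)\<close>, where \<open>G\<^sub>i\<^sub>j = \<langle>r\<^sub>i, g r\<^sub>j\<rangle>\<close> and the indices run below \<open>n\<close>. For the
  \<open>k\<close>-th power of \<open>\<nu>\<^sub>n\<close> multiplication is the \<open>k\<close>-th power of a tridiagonal matrix, so by Parseval only the
  last \<open>k\<close> terms of the variance survive: it is bounded, and the variances of the averages are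
  summable. Hence all empirical moments converge almost surely. The limits are the averages over \<open>\<xi>\<close> of the diagonal entries of
  powers of the Laurent operator with symbol \<open>b(\<xi>) + 2 a(\<xi>) cos \<theta>\<close>, i.e. moments of a mixture of
  arcsine laws.

  The tail condition confines the empirical measures, in the coordinate \<open>\<mu>\<close>, to the compact set
  \<open>\<mu> ` K\<close>, so convergence of moments gives weak convergence and the limit lives on \<open>\<mu> ` K\<close>.
  The integrability of \<open>a\<close> to a negative power enters only through \<open>a > 0\<close> almost everywhere: the
  limit is then absolutely continuous, which makes a Riemann integrable test function, continuous
  off a Lebesgue null set, admissible.
\<close>

text \<open>The processes for different \<open>n\<close> may be coupled in any way on the common
  probability space, so almost sure convergence has to come from summable expectations alone. The
  variance of an average is of order \<open>1 / n^2\<close>, and the expected contribution from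
  outside \<open>K\<close>, divided by \<open>n\<close>, is of order
  \<open>n powr (- 1 - \<epsilon>)\<close>. The map \<mu> is inverted on the image of
  \<open>K\<close> only, so the limit formula is meaningful only if every interval [b - 2a, b + 2a]
  lies in that image. This is not a hypothesis; it follows by testing the limit against the distance
  to the image. A weight with N < \<infinity> support points has no orthonormal polynomial of order
  N, and the recurrence breaks off there. Since N \<ge> n, extension by zero disturbs only indices
  from n - 1 on. They enter the variance through boundedly many terms, and the diagonal entries near
  \<xi> n with \<xi> < 1 not at all in the limit.\<close>

no_notation Infinite_Sum.abs_summable_on (infixr "abs'_summable'_on" 46)

section \<open>Slater determinants and second moments\<close>

text \<open>The Leibniz expansion of the determinant of the matrix \<open>q k (x i)\<close>. It is
  kept as a sum over permutations because the second moment expands the product of two such sums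
  term by term.\<close>

definition slater :: "nat \<Rightarrow> (nat \<Rightarrow> 'a \<Rightarrow> real) \<Rightarrow> (nat \<Rightarrow> 'a) \<Rightarrow> real" where
  "slater n q x = (\<Sum>\<sigma> | \<sigma> permutes {..<n}. of_int (sign \<sigma>) * (\<Prod>i<n. q (\<sigma> i) (x i)))"

text \<open>Composing with the transposition of \<open>i\<close> and \<open>j\<close> flips every
  sign and preserves every product, so the determinant equals its own negative.\<close>

lemma slater_eq_0:
  assumes "i < n" "j < n" "i \<noteq> j" "x i = x j"
  shows "slater n q x = 0"
proof -
  let ?t = "Transposition.transpose i j"
  have t: "?t permutes {..<n}" using assms by (intro permutes_swap_id) auto
  have xt: "x (?t k) = x k" for k
    using assms(4) by (auto simp: Transposition.transpose_def)
  have "slater n q x = (\<Sum>\<sigma> | \<sigma> permutes {..<n}. of_int (sign (\<sigma> \<circ> ?t)) * (\<Prod>k<n. q ((\<sigma> \<circ> ?t) k) (x k)))"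
    unfolding slater_def by (rule sum_permutations_compose_right[OF t])
  also have "\<dots> = (\<Sum>\<sigma> | \<sigma> permutes {..<n}. - (of_int (sign \<sigma>) * (\<Prod>k<n. q (\<sigma> k) (x k))))"
  proof (intro sum.cong refl)
    fix \<sigma> assume "\<sigma> \<in> {\<sigma>. \<sigma> permutes {..<n}}"
    then have s: "permutation \<sigma>" using permutes_imp_permutation by blast
    have "permutation ?t" using t permutes_imp_permutation by blast
    then have sg: "sign (\<sigma> \<circ> ?t) = - sign \<sigma>"
      using s assms(3) by (simp add: sign_compose sign_swap_id)
    have "(\<Prod>k<n. q ((\<sigma> \<circ> ?t) k) (x k)) = (\<Prod>k<n. q (\<sigma> (?t k)) (x (?t k)))"
      by (simp add: xt)
    also have "\<dots> = (\<Prod>k<n. q (\<sigma> k) (x k))"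
      using prod.permute[OF t, of "\<lambda>k. q (\<sigma> k) (x k)"] by (simp add: o_def)
    finally show "of_int (sign (\<sigma> \<circ> ?t)) * (\<Prod>k<n. q ((\<sigma> \<circ> ?t) k) (x k))
        = - (of_int (sign \<sigma>) * (\<Prod>k<n. q (\<sigma> k) (x k)))"
      by (simp add: sg)
  qed
  also have "\<dots> = - slater n q x" by (simp add: slater_def sum_negf)
  finally show ?thesis by simp
qed

lemma permutes_fixing_last:
  "{\<sigma>. \<sigma> permutes {..<Suc n} \<and> \<sigma> n = n} = {\<sigma>. \<sigma> permutes {..<n}}"
proof (intro Collect_cong iffI conjI)
  fix \<sigma> :: "nat \<Rightarrow> nat" assume s: "\<sigma> permutes {..<Suc n} \<and> \<sigma> n = n"
  show "\<sigma> permutes {..<n}"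
    by (rule permutes_superset[of _ "{..<Suc n}"]) (use s in \<open>auto simp: less_Suc_eq\<close>)
next
  fix \<sigma> :: "nat \<Rightarrow> nat" assume s: "\<sigma> permutes {..<n}"
  show "\<sigma> permutes {..<Suc n}" by (rule permutes_subset[OF s]) auto
  show "\<sigma> n = n" using s by (auto simp: permutes_def)
qed

text \<open>As a function of the last argument the determinant is a polynomial of degree at most \<open>n\<close> that
  vanishes at the other arguments.\<close>

lemma slater_Suc:
  fixes p :: "nat \<Rightarrow> real poly"
  assumes deg: "\<And>k. k \<le> n \<Longrightarrow> degree (p k) = k"
    and inj: "inj_on x {..<n}"
  shows "slater (Suc n) (\<lambda>k. poly (p k)) x =
           slater n (\<lambda>k. poly (p k)) x * lead_coeff (p n) * (\<Prod>i<n. x n - x i)"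
proof -
  define c where "c = slater n (\<lambda>k. poly (p k)) x * lead_coeff (p n)"
  define P where "P = (\<Sum>\<sigma> | \<sigma> permutes {..<Suc n}.
     smult (of_int (sign \<sigma>) * (\<Prod>i<n. poly (p (\<sigma> i)) (x i))) (p (\<sigma> n)))"
  have fin: "finite {\<sigma>. \<sigma> permutes {..<Suc n}}" by (simp add: finite_permutations)
  have rng: "\<sigma> n \<le> n" if "\<sigma> permutes {..<Suc n}" for \<sigma>
    using permutes_in_image[OF that, of n] by auto
  have polyP: "poly P t = slater (Suc n) (\<lambda>k. poly (p k)) (x(n := t))" for t
    unfolding P_def slater_def by (simp add: poly_sum mult.assoc)
  have degP: "degree P \<le> n"
    unfolding P_def by (rule degree_sum_le[OF fin]) (auto intro: order.trans[OF degree_smult_le] simp: deg rng)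
  have "coeff P n = (\<Sum>\<sigma> | \<sigma> permutes {..<Suc n}.
     of_int (sign \<sigma>) * (\<Prod>i<n. poly (p (\<sigma> i)) (x i)) * coeff (p (\<sigma> n)) n)"
    unfolding P_def by (simp add: coeff_sum)
  \<comment> \<open>Only a permutation fixing \<open>n\<close> puts the polynomial of degree
    \<open>n\<close> in the last place; all others contribute a smaller degree.\<close>
  also have "\<dots> = (\<Sum>\<sigma> | \<sigma> permutes {..<Suc n} \<and> \<sigma> n = n.
     of_int (sign \<sigma>) * (\<Prod>i<n. poly (p (\<sigma> i)) (x i)) * coeff (p (\<sigma> n)) n)"
  proof (intro sum.mono_neutral_right fin ballI)
    fix \<sigma> assume "\<sigma> \<in> {\<sigma>. \<sigma> permutes {..<Suc n}} - {\<sigma>. \<sigma> permutes {..<Suc n} \<and> \<sigma> n = n}"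
    then have "\<sigma> n < n" using rng[of \<sigma>] by auto
    then have "coeff (p (\<sigma> n)) n = 0" by (intro coeff_eq_0) (simp add: deg)
    then show "of_int (sign \<sigma>) * (\<Prod>i<n. poly (p (\<sigma> i)) (x i)) * coeff (p (\<sigma> n)) n = 0" by simp
  qed auto
  also have "\<dots> = (\<Sum>\<sigma> | \<sigma> permutes {..<n}.
     of_int (sign \<sigma>) * (\<Prod>i<n. poly (p (\<sigma> i)) (x i)) * lead_coeff (p n))"
    unfolding permutes_fixing_last by (intro sum.cong refl) (auto simp: deg permutes_def)
  also have "\<dots> = c" unfolding c_def slater_def by (simp add: sum_distrib_right)
  finally have coefP: "coeff P n = c" .
  define R where "R = (\<Prod>i<n. [:- x i, 1:])"
  have monR: "lead_coeff R = 1" unfolding R_def by (simp add: lead_coeff_prod)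
  have degR: "degree R = n" unfolding R_def by (subst degree_prod_eq_sum_degree) auto
  \<comment> \<open>The coefficients of order \<open>n\<close> agree, so the difference has degree
    below \<open>n\<close>, yet it has \<open>n\<close> distinct roots. For \<open>n = 0\<close>,
    where no smaller degree exists, the vanishing constant coefficient settles the matter.\<close>
  have "P - smult c R = 0"
  proof (rule ccontr)
    assume nz: "P - smult c R \<noteq> 0"
    have dle: "degree (P - smult c R) \<le> n"
      using degP degR by (meson degree_diff_le degree_smult_le le_trans order_refl)
    have "coeff (P - smult c R) n = 0" using coefP monR degR by simp
    then have dl: "degree (P - smult c R) < n \<or> n = 0"
      using dle nz by (metis leading_coeff_0_iff le_neq_implies_less)
    have roots: "x ` {..<n} \<subseteq> {t. poly (P - smult c R) t = 0}"
    proof clarsimp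
      fix i assume i: "i < n"
      have "poly P (x i) = 0"
        unfolding polyP by (rule slater_eq_0[of i _ n]) (use i in auto)
      moreover have "poly R (x i) = 0" unfolding R_def using i by (auto simp: poly_prod)
      ultimately show "poly P (x i) = c * poly R (x i)" by simp
    qed
    have "n = card (x ` {..<n})" using inj by (simp add: card_image)
    also have "\<dots> \<le> card {t. poly (P - smult c R) t = 0}"
      by (rule card_mono[OF poly_roots_finite[OF nz] roots])
    also have "\<dots> \<le> degree (P - smult c R)" by (rule card_poly_roots_bound[OF nz])
    finally have n0: "n = 0" using dl by auto
    then have "degree (P - smult c R) = 0" "coeff (P - smult c R) 0 = 0"
      using dle coefP monR degR by auto
    then show False using nz by (metis leading_coeff_0_iff)
  qed
  then have "poly P (x n) = c * poly R (x n)" by simp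
  then show ?thesis by (simp add: polyP c_def R_def poly_prod)
qed

text \<open>Vandermonde's formula, one argument at a time. Coinciding arguments are treated apart,
  since the root count behind \<open>slater_Suc\<close> requires distinct ones; both sides then
  vanish.\<close>

lemma slater_poly:
  fixes p :: "nat \<Rightarrow> real poly"
  assumes "\<And>k. k < n \<Longrightarrow> degree (p k) = k"
  shows "slater n (\<lambda>k. poly (p k)) x =
           (\<Prod>k<n. lead_coeff (p k)) * (\<Prod>j<n. \<Prod>i<j. x j - x i)"
  using assms
proof (induction n)
  case 0
  then show ?case by (simp add: slater_def sign_id)
next
  case (Suc n)
  show ?case
  proof (cases "inj_on x {..<n}")
    case True
    have "slater (Suc n) (\<lambda>k. poly (p k)) x =
           slater n (\<lambda>k. poly (p k)) x * lead_coeff (p n) * (\<Prod>i<n. x n - x i)"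
      by (rule slater_Suc) (use Suc.prems True in auto)
    then show ?thesis using Suc by (simp add: mult_ac)
  next
    case False
    then obtain i j where ij: "i < j" "j < n" "x i = x j"
      unfolding inj_on_def by (metis lessThan_iff linorder_neqE_nat)
    have "slater (Suc n) (\<lambda>k. poly (p k)) x = 0"
      by (rule slater_eq_0[of i _ j]) (use ij in auto)
    moreover have "(\<Prod>i<j. x j - x i) = 0" using ij by (auto intro!: bexI[of _ i])
    then have "(\<Prod>j<n. \<Prod>i<j. x j - x i) = 0" using ij by (metis finite_lessThan lessThan_iff prod_zero)
    ultimately show ?thesis by simp
  qed
qed

lemma permutes_fixing_all_but_two:
  assumes "\<tau> permutes S" and "\<And>i. i \<in> S \<Longrightarrow> i \<noteq> j \<Longrightarrow> i \<noteq> k \<Longrightarrow> \<tau> i = i"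
  shows "\<tau> = id \<or> \<tau> = Transposition.transpose j k"
proof -
  have fix': "\<tau> i = i" if "i \<noteq> j" "i \<noteq> k" for i
    using assms that by (cases "i \<in> S") (auto simp: permutes_def)
  have inj: "inj \<tau>" using assms(1) by (rule permutes_inj)
  have "\<tau> j \<in> {j, k}" "\<tau> k \<in> {j, k}"
    using fix' inj by (metis injD insertCI)+
  moreover have "\<tau> j = \<tau> k \<longleftrightarrow> j = k" using inj by (auto dest: injD)
  ultimately have "(\<tau> j = j \<and> \<tau> k = k) \<or> (\<tau> j = k \<and> \<tau> k = j)" by auto
  then show ?thesis
  proof
    assume "\<tau> j = j \<and> \<tau> k = k"
    then have "\<tau> = id" using fix' by (metis eq_id_iff)
    then show ?thesis ..
  next
    assume "\<tau> j = k \<and> \<tau> k = j"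
    then have "\<tau> = Transposition.transpose j k" using fix' by (auto simp: fun_eq_iff Transposition.transpose_def)
    then show ?thesis ..
  qed
qed

text \<open>All rows but \<open>j\<close> and \<open>k\<close> are those of the identity matrix, so only the identity and the
  transposition of \<open>j\<close> and \<open>k\<close> contribute.\<close>

lemma signed_sum_near_identity:
  fixes G :: "nat \<Rightarrow> nat \<Rightarrow> nat \<Rightarrow> real"
  assumes G0: "\<And>p q. p < n \<Longrightarrow> q < n \<Longrightarrow> G 0 p q = (if p = q then 1 else 0)"
    and jk: "j < n" "k < n"
  shows "(\<Sum>\<tau> | \<tau> permutes {..<n}. of_int (sign \<tau>) *
            (\<Prod>i<n. G (of_bool (i = j) + of_bool (i = k)) i (\<tau> i)))
         = (if j = k then G 2 j j else G 1 j j * G 1 k k - G 1 j k * G 1 k j)"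
proof -
  let ?F = "\<lambda>\<tau>. of_int (sign \<tau>) * (\<Prod>i<n. G (of_bool (i = j) + of_bool (i = k)) i (\<tau> i))"
  have fin: "finite {\<tau>. \<tau> permutes {..<n}}" by (simp add: finite_permutations)
  have "Transposition.transpose j k permutes {..<n}" using jk by (intro permutes_swap_id) auto
  then have sub: "{id, Transposition.transpose j k} \<subseteq> {\<tau>. \<tau> permutes {..<n}}" by (simp add: permutes_id)
  have "(\<Sum>\<tau> | \<tau> permutes {..<n}. ?F \<tau>) = sum ?F {id, Transposition.transpose j k}"
  proof (intro sum.mono_neutral_right fin sub ballI)
    fix \<tau> assume t: "\<tau> \<in> {\<tau>. \<tau> permutes {..<n}} - {id, Transposition.transpose j k}"
    then obtain i where i: "i < n" "i \<noteq> j" "i \<noteq> k" "\<tau> i \<noteq> i"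
      using permutes_fixing_all_but_two[of \<tau> "{..<n}" j k] by auto
    have "\<tau> i < n" using t i permutes_in_image[of \<tau> "{..<n}" i] by auto
    then have "G (of_bool (i = j) + of_bool (i = k)) i (\<tau> i) = 0" using i by (simp add: G0)
    then have "(\<Prod>i<n. G (of_bool (i = j) + of_bool (i = k)) i (\<tau> i)) = 0" using i by (intro prod_zero) auto
    then show "?F \<tau> = 0" by simp
  qed
  moreover have "sum ?F {id, Transposition.transpose j k}
     = (if j = k then G 2 j j else G 1 j j * G 1 k k - G 1 j k * G 1 k j)"
  proof (cases "j = k")
    case True
    have "(\<Prod>i<n. G (of_bool (i = j) + of_bool (i = k)) i (id i)) = (\<Prod>i\<in>{j}. G 2 j j)"
      by (rule prod.mono_neutral_cong_right) (use jk True in \<open>auto simp: G0 simp flip: numeral_2_eq_2\<close>)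
    then show ?thesis using True by (simp add: sign_id transpose_same)
  next
    case False
    then have ne: "id \<noteq> Transposition.transpose j k" by (metis id_apply transpose_apply_first)
    have "(\<Prod>i<n. G (of_bool (i = j) + of_bool (i = k)) i (id i)) = (\<Prod>i\<in>{j,k}. G 1 i i)"
      by (rule prod.mono_neutral_cong_right) (use jk False in \<open>auto simp: G0\<close>)
    moreover have "(\<Prod>i<n. G (of_bool (i = j) + of_bool (i = k)) i (Transposition.transpose j k i)) = (\<Prod>i\<in>{j,k}. G 1 i (Transposition.transpose j k i))"
      by (rule prod.mono_neutral_cong_right) (use jk False in \<open>auto simp: G0 Transposition.transpose_def\<close>)
    ultimately show ?thesis using False ne by (simp add: sign_id sign_swap_id)
  qed
  ultimately show ?thesis by simp
qed

text \<open>The inner sum does not depend on \<sigma>: substituting \<tau> \<circ> \<sigma> for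
  \<tau> and reindexing the rows and both marked indices by \<sigma> reduces it to the case of the
  identity. The permutations \<sigma> then contribute the factor \<open>fact n\<close>.\<close>

lemma double_permutation_sum:
  fixes G :: "nat \<Rightarrow> nat \<Rightarrow> nat \<Rightarrow> real"
  assumes G0: "\<And>p q. p < n \<Longrightarrow> q < n \<Longrightarrow> G 0 p q = (if p = q then 1 else 0)"
  shows "(\<Sum>\<sigma> | \<sigma> permutes {..<n}. \<Sum>\<tau> | \<tau> permutes {..<n}. of_int (sign \<sigma>) * of_int (sign \<tau>) *
            (\<Sum>j<n. \<Sum>k<n. \<Prod>i<n. G (of_bool (i = j) + of_bool (i = k)) (\<sigma> i) (\<tau> i)))
         = fact n * ((\<Sum>j<n. G 2 j j) + (\<Sum>j<n. G 1 j j)\<^sup>2 - (\<Sum>j<n. \<Sum>k<n. G 1 j k * G 1 k j))"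
proof -
  let ?e = "\<lambda>i j k. of_bool (i = j) + of_bool (i = k) :: nat"
  define T where "T = (\<Sum>j<n. \<Sum>k<n. \<Sum>\<tau> | \<tau> permutes {..<n}. of_int (sign \<tau>) * (\<Prod>i<n. G (?e i j k) i (\<tau> i)))"
  have inner: "(\<Sum>\<tau> | \<tau> permutes {..<n}. of_int (sign \<sigma>) * of_int (sign \<tau>) *
            (\<Sum>j<n. \<Sum>k<n. \<Prod>i<n. G (?e i j k) (\<sigma> i) (\<tau> i))) = T"
    if s: "\<sigma> permutes {..<n}" for \<sigma>
  proof -
    have "(\<Sum>\<tau> | \<tau> permutes {..<n}. of_int (sign \<sigma>) * of_int (sign \<tau>) *
            (\<Sum>j<n. \<Sum>k<n. \<Prod>i<n. G (?e i j k) (\<sigma> i) (\<tau> i)))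
       = (\<Sum>\<tau> | \<tau> permutes {..<n}. of_int (sign \<sigma>) * of_int (sign (\<tau> \<circ> \<sigma>)) *
            (\<Sum>j<n. \<Sum>k<n. \<Prod>i<n. G (?e i j k) (\<sigma> i) ((\<tau> \<circ> \<sigma>) i)))"
      by (rule sum_permutations_compose_right[OF s])
    also have "\<dots> = (\<Sum>\<tau> | \<tau> permutes {..<n}. of_int (sign \<tau>) * (\<Sum>j<n. \<Sum>k<n. \<Prod>i<n. G (?e i j k) i (\<tau> i)))"
    proof (intro sum.cong refl)
      fix \<tau> assume "\<tau> \<in> {\<tau>. \<tau> permutes {..<n}}"
      then have t: "permutation \<tau>" using permutes_imp_permutation by blast
      have s': "permutation \<sigma>" using s permutes_imp_permutation by blast
      have "sign \<sigma> * sign (\<tau> \<circ> \<sigma>) = sign \<tau> * (sign \<sigma> * sign \<sigma>)"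
        using s' t by (simp add: sign_compose)
      also have "sign \<sigma> * sign \<sigma> = 1" by (simp add: sign_def)
      finally have sg: "of_int (sign \<sigma>) * of_int (sign (\<tau> \<circ> \<sigma>)) = (of_int (sign \<tau>) :: real)"
        by (metis mult.right_neutral of_int_mult)
      have inj: "inj \<sigma>" using s by (rule permutes_inj)
      have "(\<Sum>j<n. \<Sum>k<n. \<Prod>i<n. G (?e i j k) i (\<tau> i)) = (\<Sum>j<n. \<Sum>k<n. \<Prod>i<n. G (?e i (\<sigma> j) (\<sigma> k)) i (\<tau> i))"
        using sum.permute[OF s, of "\<lambda>j. \<Sum>k<n. \<Prod>i<n. G (?e i j k) i (\<tau> i)"]
          sum.permute[OF s, of "\<lambda>k. \<Prod>i<n. G (?e i (\<sigma> j) k) i (\<tau> i)" for j]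
        by (simp add: o_def)
      also have "\<dots> = (\<Sum>j<n. \<Sum>k<n. \<Prod>i<n. G (?e (\<sigma> i) (\<sigma> j) (\<sigma> k)) (\<sigma> i) (\<tau> (\<sigma> i)))"
        using prod.permute[OF s, of "\<lambda>i. G (?e i (\<sigma> j) (\<sigma> k)) i (\<tau> i)" for j k]
        by (simp add: o_def)
      also have "\<dots> = (\<Sum>j<n. \<Sum>k<n. \<Prod>i<n. G (?e i j k) (\<sigma> i) ((\<tau> \<circ> \<sigma>) i))"
        using inj by (simp add: inj_eq)
      finally show "of_int (sign \<sigma>) * of_int (sign (\<tau> \<circ> \<sigma>)) *
            (\<Sum>j<n. \<Sum>k<n. \<Prod>i<n. G (?e i j k) (\<sigma> i) ((\<tau> \<circ> \<sigma>) i))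
          = of_int (sign \<tau>) * (\<Sum>j<n. \<Sum>k<n. \<Prod>i<n. G (?e i j k) i (\<tau> i))"
        by (simp only: sg)
    qed
    also have "\<dots> = T"
      unfolding T_def sum_distrib_left
      by (subst sum.swap, intro sum.cong refl, rule sum.swap)
    finally show ?thesis .
  qed
  have "T = (\<Sum>j<n. \<Sum>k<n. if j = k then G 2 j j else G 1 j j * G 1 k k - G 1 j k * G 1 k j)"
    unfolding T_def by (intro sum.cong refl signed_sum_near_identity G0) auto
  also have "\<dots> = (\<Sum>j<n. \<Sum>k<n. (if j = k then G 2 j j else 0) + (G 1 j j * G 1 k k - G 1 j k * G 1 k j))"
    by (intro sum.cong refl) auto
  also have "\<dots> = (\<Sum>j<n. G 2 j j) + (\<Sum>j<n. G 1 j j)\<^sup>2 - (\<Sum>j<n. \<Sum>k<n. G 1 j k * G 1 k j)"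
    by (simp add: sum.distrib sum_subtractf power2_eq_square sum_product)
  finally have T: "T = (\<Sum>j<n. G 2 j j) + (\<Sum>j<n. G 1 j j)\<^sup>2 - (\<Sum>j<n. \<Sum>k<n. G 1 j k * G 1 k j)" .
  have "(\<Sum>\<sigma> | \<sigma> permutes {..<n}. \<Sum>\<tau> | \<tau> permutes {..<n}. of_int (sign \<sigma>) * of_int (sign \<tau>) *
            (\<Sum>j<n. \<Sum>k<n. \<Prod>i<n. G (?e i j k) (\<sigma> i) (\<tau> i))) = (\<Sum>\<sigma> | \<sigma> permutes {..<n}. T)"
    by (intro sum.cong refl inner) auto
  also have "\<dots> = fact n * T" by (simp add: card_permutations)
  finally show ?thesis unfolding T .
qed

text \<open>The exponent counts how often \<open>i\<close> occurs among the marked indices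
  \<open>j\<close> and \<open>k\<close>. In this form every term is a product of functions of one
  coordinate each, so its sum over all configurations factorises.\<close>

lemma sum_squared_as_products:
  fixes g :: "nat \<Rightarrow> real"
  shows "(\<Sum>j<n. g j)\<^sup>2 = (\<Sum>j<n. \<Sum>k<n. \<Prod>i<n. g i ^ (of_bool (i = j) + of_bool (i = k)))"
proof -
  have single: "(\<Prod>i<n. g i ^ of_bool (i = j)) = g j" if "j < n" for j
  proof -
    have "(\<Prod>i<n. g i ^ of_bool (i = j)) = (\<Prod>i\<in>{j}. g i)"
      by (rule prod.mono_neutral_cong_right) (use that in auto)
    then show ?thesis by simp
  qed
  have "(\<Sum>j<n. g j)\<^sup>2 = (\<Sum>j<n. \<Sum>k<n. g j * g k)"
    by (simp add: power2_eq_square sum_product)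
  also have "\<dots> = (\<Sum>j<n. \<Sum>k<n. \<Prod>i<n. g i ^ (of_bool (i = j) + of_bool (i = k)))"
    by (intro sum.cong refl) (simp add: power_add prod.distrib single)
  finally show ?thesis .
qed

text \<open>An identity of Andreief type. After squaring the Leibniz sum every term factorises over
  the coordinates, and each coordinate contributes a matrix entry of multiplication by
  \<open>g ^ e\<close>; the exponent 2 arises when both marked indices coincide.\<close>

lemma second_moment_slater:
  fixes q :: "nat \<Rightarrow> int \<Rightarrow> real" and g w :: "int \<Rightarrow> real"
  defines "G \<equiv> \<lambda>e i j. infsetsum (\<lambda>y. g y ^ e * q i y * q j y * w y) UNIV"
  assumes sm: "\<And>e i j. e \<le> 2 \<Longrightarrow> i < n \<Longrightarrow> j < n \<Longrightarrow> (\<lambda>y. g y ^ e * q i y * q j y * w y) abs_summable_on UNIV"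
    and G0: "\<And>i j. i < n \<Longrightarrow> j < n \<Longrightarrow> G 0 i j = (if i = j then 1 else 0)"
  shows "(\<lambda>y. (slater n q y)\<^sup>2 * (\<Prod>i<n. w (y i)) * (\<Sum>j<n. g (y j))\<^sup>2) abs_summable_on PiE {..<n} (\<lambda>_. UNIV)"
    and "infsetsum (\<lambda>y. (slater n q y)\<^sup>2 * (\<Prod>i<n. w (y i)) * (\<Sum>j<n. g (y j))\<^sup>2) (PiE {..<n} (\<lambda>_. UNIV))
     = fact n * ((\<Sum>j<n. G 2 j j) + (\<Sum>j<n. G 1 j j)\<^sup>2 - (\<Sum>j<n. \<Sum>k<n. G 1 j k * G 1 k j))"
proof -
  let ?e = "\<lambda>i j k. of_bool (i = j) + of_bool (i = k) :: nat"
  let ?P = "{\<sigma>. \<sigma> permutes {..<n}}"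
  let ?O = "PiE {..<n} (\<lambda>_. UNIV :: int set)"
  let ?f = "\<lambda>\<sigma> \<tau> j k i y. g y ^ ?e i j k * q (\<sigma> i) y * q (\<tau> i) y * w y"
  have expand: "(slater n q y)\<^sup>2 * (\<Prod>i<n. w (y i)) * (\<Sum>j<n. g (y j))\<^sup>2
     = (\<Sum>\<sigma>\<in>?P. \<Sum>\<tau>\<in>?P. of_int (sign \<sigma>) * of_int (sign \<tau>) * (\<Sum>j<n. \<Sum>k<n. \<Prod>i<n. ?f \<sigma> \<tau> j k i (y i)))" for y
    unfolding slater_def sum_squared_as_products
    by (simp add: power2_eq_square sum_product sum_distrib_left sum_distrib_right prod.distrib mult_ac)
  have in_rng: "\<sigma> i < n" if "\<sigma> \<in> ?P" "i < n" for \<sigma> i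
    using permutes_in_image[of \<sigma> "{..<n}" i] that by auto
  have sf: "?f \<sigma> \<tau> j k i abs_summable_on UNIV" if "\<sigma> \<in> ?P" "\<tau> \<in> ?P" "i < n" for \<sigma> \<tau> j k i
    by (rule sm) (use that in_rng in auto)
  have sp: "(\<lambda>y. \<Prod>i<n. ?f \<sigma> \<tau> j k i (y i)) abs_summable_on ?O" if "\<sigma> \<in> ?P" "\<tau> \<in> ?P" for \<sigma> \<tau> j k
    by (rule abs_summable_on_prod_PiE) ((simp; fail) | (rule sf; use that in simp) | simp)+
  have sp': "(\<lambda>y. of_int (sign \<sigma>) * of_int (sign \<tau>) * (\<Sum>j<n. \<Sum>k<n. \<Prod>i<n. ?f \<sigma> \<tau> j k i (y i))) abs_summable_on ?O"
    if "\<sigma> \<in> ?P" "\<tau> \<in> ?P" for \<sigma> \<tau>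
    using that by (intro abs_summable_on_cmult_right abs_summable_sum sp)
  show "(\<lambda>y. (slater n q y)\<^sup>2 * (\<Prod>i<n. w (y i)) * (\<Sum>j<n. g (y j))\<^sup>2) abs_summable_on ?O"
    unfolding expand by (intro abs_summable_sum sp')
  have "infsetsum (\<lambda>y. (slater n q y)\<^sup>2 * (\<Prod>i<n. w (y i)) * (\<Sum>j<n. g (y j))\<^sup>2) ?O
    = (\<Sum>\<sigma>\<in>?P. \<Sum>\<tau>\<in>?P. infsetsum (\<lambda>y. of_int (sign \<sigma>) * of_int (sign \<tau>) * (\<Sum>j<n. \<Sum>k<n. \<Prod>i<n. ?f \<sigma> \<tau> j k i (y i))) ?O)"
    unfolding expand
    apply (subst sum_infsetsum[symmetric])
     apply (intro abs_summable_sum sp'; assumption)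
    apply (intro sum.cong refl)
    apply (subst sum_infsetsum[symmetric])
     apply (intro abs_summable_sum sp'; assumption)
    apply (rule refl)
    done
  also have "\<dots> = (\<Sum>\<sigma>\<in>?P. \<Sum>\<tau>\<in>?P. of_int (sign \<sigma>) * of_int (sign \<tau>) *
      (\<Sum>j<n. \<Sum>k<n. infsetsum (\<lambda>y. \<Prod>i<n. ?f \<sigma> \<tau> j k i (y i)) ?O))"
    by (intro sum.cong refl, subst infsetsum_cmult_right, intro abs_summable_sum sp; simp add: sum_infsetsum sp abs_summable_sum)
  also have "\<dots> = (\<Sum>\<sigma>\<in>?P. \<Sum>\<tau>\<in>?P. of_int (sign \<sigma>) * of_int (sign \<tau>) *
      (\<Sum>j<n. \<Sum>k<n. \<Prod>i<n. G (?e i j k) (\<sigma> i) (\<tau> i)))"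
    unfolding G_def
    by (intro sum.cong refl arg_cong2[of _ _ _ _ "(*)"] infsetsum_prod_PiE) ((rule sf; simp) | simp)+
  also have "\<dots> = fact n * ((\<Sum>j<n. G 2 j j) + (\<Sum>j<n. G 1 j j)\<^sup>2 - (\<Sum>j<n. \<Sum>k<n. G 1 j k * G 1 k j))"
    by (rule double_permutation_sum[where G = G]) (rule G0)
  finally show "infsetsum (\<lambda>y. (slater n q y)\<^sup>2 * (\<Prod>i<n. w (y i)) * (\<Sum>j<n. g (y j))\<^sup>2) ?O
     = fact n * ((\<Sum>j<n. G 2 j j) + (\<Sum>j<n. G 1 j j)\<^sup>2 - (\<Sum>j<n. \<Sum>k<n. G 1 j k * G 1 k j))" .
qed

section \<open>Variance of linear statistics\<close>

lemma nn_integral_countable_image: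
  assumes Y: "Y \<in> measurable M (count_space S)" and S: "countable S"
  shows "(\<integral>\<^sup>+ \<omega>. F (Y \<omega>) \<partial>M) = (\<integral>\<^sup>+ y. emeasure M (Y -` {y} \<inter> space M) * F y \<partial>count_space S)"
proof -
  have "distr M (count_space S) Y = density (count_space S) (\<lambda>y. emeasure M (Y -` {y} \<inter> space M))"
  proof (rule measure_eqI_countable[OF _ _ S])
    fix y assume "y \<in> S"
    then have "(\<integral>\<^sup>+ x. emeasure M (Y -` {x} \<inter> space M) * indicator {y} x \<partial>count_space S)
        = emeasure M (Y -` {y} \<inter> space M)"
      by (subst nn_integral_indicator_singleton) auto
    then show "emeasure (distr M (count_space S) Y) {y}
        = emeasure (density (count_space S) (\<lambda>y. emeasure M (Y -` {y} \<inter> space M))) {y}"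
      using \<open>y \<in> S\<close> Y by (simp add: emeasure_distr emeasure_density)
  qed auto
  then have "nn_integral (distr M (count_space S) Y) F
      = nn_integral (density (count_space S) (\<lambda>y. emeasure M (Y -` {y} \<inter> space M))) F" by simp
  then show ?thesis using Y by (simp add: nn_integral_distr nn_integral_density)
qed

lemma floor_lattice:
  assumes "n \<ge> 1" "x \<in> lattice n"
  shows "x = of_int \<lfloor>real n * x\<rfloor> / real n"
  using assms by (auto simp: lattice_def)

lemma countable_lattice: "countable (lattice n)"
  by (simp add: lattice_def)

text \<open>Indices are shifted to start at 0, as in the determinant. The restriction to
  \<open>{..<n}\<close> makes every value an element of the extensional function space over which
  the sums of \<open>second_moment_slater\<close> run.\<close>

definition positions :: "nat \<Rightarrow> (nat \<Rightarrow> 'w \<Rightarrow> real) \<Rightarrow> 'w \<Rightarrow> nat \<Rightarrow> int" where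
  "positions n X \<omega> = (\<lambda>i\<in>{..<n}. \<lfloor>real n * X (Suc i) \<omega>\<rfloor>)"

lemma measurable_lattice_valued:
  assumes "X \<in> borel_measurable M" "\<forall>\<omega>\<in>space M. X \<omega> \<in> lattice n"
  shows "X \<in> measurable M (count_space (lattice n))"
  using assms by (subst measurable_count_space_eq_countable[OF countable_lattice]) (auto intro: measurable_sets)

lemma positions_vimage:
  assumes n: "n \<ge> 1" and X: "\<And>j \<omega>. j \<in> {1..n} \<Longrightarrow> \<omega> \<in> space M \<Longrightarrow> X j \<omega> \<in> lattice n"
    and y: "y \<in> PiE {..<n} (\<lambda>_. UNIV)"
  shows "positions n X -` {y} \<inter> space M
     = {\<omega> \<in> space M. \<forall>j\<in>{1..n}. X j \<omega> = (\<lambda>j\<in>{1..n}. of_int (y (j - 1)) / real n) j}"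
proof (intro set_eqI iffI)
  fix \<omega> assume a: "\<omega> \<in> positions n X -` {y} \<inter> space M"
  have "X j \<omega> = of_int (y (j - 1)) / real n" if j: "j \<in> {1..n}" for j
  proof -
    have "y (j - 1) = positions n X \<omega> (j - 1)" using a by simp
    also have "\<dots> = \<lfloor>real n * X j \<omega>\<rfloor>" using j by (auto simp: positions_def)
    finally show ?thesis using floor_lattice[OF n X[OF j, of \<omega>]] a by simp
  qed
  then show "\<omega> \<in> {\<omega> \<in> space M. \<forall>j\<in>{1..n}. X j \<omega> = (\<lambda>j\<in>{1..n}. of_int (y (j - 1)) / real n) j}"
    using a by simp
next
  fix \<omega> assume a: "\<omega> \<in> {\<omega> \<in> space M. \<forall>j\<in>{1..n}. X j \<omega> = (\<lambda>j\<in>{1..n}. of_int (y (j - 1)) / real n) j}"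
  have "positions n X \<omega> i = y i" for i
  proof (cases "i < n")
    case True
    then have "X (Suc i) \<omega> = of_int (y i) / real n" using a by auto
    then show ?thesis using True n by (simp add: positions_def)
  next
    case False
    then show ?thesis using y by (auto simp: positions_def PiE_def extensional_def)
  qed
  then show "\<omega> \<in> positions n X -` {y} \<inter> space M" using a by auto
qed

text \<open>The Vandermonde product in the density is the determinant up to the leading
  coefficients, whence the squared product of these as a factor.\<close>

lemma ensemble_density_slater:
  fixes p :: "nat \<Rightarrow> real poly"
  assumes n: "n \<ge> 1" and p: "\<And>k. k < n \<Longrightarrow> degree (p k) = k"
  shows "(\<Prod>k<n. lead_coeff (p k))\<^sup>2 * ensemble_density n v w (\<lambda>j\<in>{1..n}. of_int (y (j - 1)) / real n)
     = (slater n (\<lambda>k z. poly (p k) (v z)) y)\<^sup>2 * (\<Prod>i<n. w (y i))"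
proof -
  define t where "t = (\<lambda>j\<in>{1..n}. of_int (y (j - 1)) / real n :: real)"
  have res: "rescale n h (t (Suc i)) = h (y i)" if "i < n" for h i
    using that n by (simp add: rescale_def t_def)
  have res': "rescale n h (t j) = h (y (j - 1))" if "1 \<le> j" "j \<le> n" for h j
    using that n by (simp add: rescale_def t_def)
  \<comment> \<open>The pairs are regrouped by their larger index, and both indices are lowered by
    one to match \<open>slater_poly\<close>.\<close>
  have img: "{(i, j). 1 \<le> i \<and> i < j \<and> j \<le> n} = (\<lambda>(j, i). (Suc i, Suc j)) ` (SIGMA j:{..<n}. {..<j})"
  proof (intro set_eqI iffI)
    fix z assume "z \<in> {(i, j). 1 \<le> i \<and> i < j \<and> j \<le> n}"
    then obtain i j where z: "z = (i, j)" "1 \<le> i" "i < j" "j \<le> n" by auto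
    then have "z = (\<lambda>(j, i). (Suc i, Suc j)) (j - 1, i - 1)" "(j - 1, i - 1) \<in> (SIGMA j:{..<n}. {..<j})" by auto
    then show "z \<in> (\<lambda>(j, i). (Suc i, Suc j)) ` (SIGMA j:{..<n}. {..<j})" by (rule image_eqI)
  qed auto
  have "(\<Prod>(i, j) \<in> {(i, j). 1 \<le> i \<and> i < j \<and> j \<le> n}. (rescale n v (t i) - rescale n v (t j))\<^sup>2)
      = (\<Prod>(j, i) \<in> (SIGMA j:{..<n}. {..<j}). (v (y i) - v (y j))\<^sup>2)"
    unfolding img by (subst prod.reindex) (auto simp: inj_on_def res intro!: prod.cong)
  also have "\<dots> = (\<Prod>j<n. \<Prod>i<j. (v (y i) - v (y j))\<^sup>2)"
    by (subst prod.Sigma) auto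
  also have "\<dots> = (\<Prod>j<n. \<Prod>i<j. v (y j) - v (y i))\<^sup>2"
    by (simp add: power2_commute prod_power_distrib)
  finally have 1: "(\<Prod>(i, j) \<in> {(i, j). 1 \<le> i \<and> i < j \<and> j \<le> n}. (rescale n v (t i) - rescale n v (t j))\<^sup>2)
      = (\<Prod>j<n. \<Prod>i<j. v (y j) - v (y i))\<^sup>2" .
  have 2: "(\<Prod>j = 1..n. rescale n w (t j)) = (\<Prod>i<n. w (y i))"
    by (rule prod.reindex_bij_witness[of _ Suc "\<lambda>j. j - 1"]) (auto simp: res' simp del: One_nat_def)
  have "slater n (\<lambda>k z. poly (p k) (v z)) y = slater n (\<lambda>k. poly (p k)) (\<lambda>i. v (y i))"
    by (simp add: slater_def)
  also have "\<dots> = (\<Prod>k<n. lead_coeff (p k)) * (\<Prod>j<n. \<Prod>i<j. v (y j) - v (y i))"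
    by (rule slater_poly[OF p])
  finally show ?thesis
    unfolding ensemble_density_def t_def[symmetric] 1 2 by (simp add: power_mult_distrib)
qed

text \<open>The weight summed in \<open>second_moment_slater\<close> is the joint mass function up
  to a constant that is not given explicitly. The constant is found by applying the same formula to
  the constant function 1.\<close>

lemma second_moment_linear_statistic:
  fixes p :: "nat \<Rightarrow> real poly" and g v w :: "int \<Rightarrow> real"
  defines "q \<equiv> \<lambda>k y. poly (p k) (v y)"
  defines "G \<equiv> \<lambda>e i j. infsetsum (\<lambda>y. g y ^ e * q i y * q j y * w y) UNIV"
  assumes M: "prob_space M" and n: "n \<ge> 1"
    and pmf: "has_joint_pmf_proportional_to M n X (ensemble_density n v w)"
    and w: "\<And>y. w y \<ge> 0"
    and deg: "\<And>k. k < n \<Longrightarrow> degree (p k) = k" and lead: "\<And>k. k < n \<Longrightarrow> lead_coeff (p k) > 0"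
    and sm: "\<And>e i j. e \<le> 2 \<Longrightarrow> i < n \<Longrightarrow> j < n \<Longrightarrow> (\<lambda>y. g y ^ e * q i y * q j y * w y) abs_summable_on UNIV"
    and G0: "\<And>i j. i < n \<Longrightarrow> j < n \<Longrightarrow> G 0 i j = (if i = j then 1 else 0)"
  shows "(\<integral>\<^sup>+ \<omega>. ennreal ((linear_statistic n X (rescale n g) \<omega>)\<^sup>2) \<partial>M)
     = ennreal ((\<Sum>j<n. G 2 j j) + (\<Sum>j<n. G 1 j j)\<^sup>2 - (\<Sum>j<n. \<Sum>k<n. G 1 j k * G 1 k j))"
proof -
  interpret prob_space M by fact
  let ?O = "PiE {..<n} (\<lambda>_. UNIV :: int set)"
  let ?Y = "positions n X"
  define L where "L = (\<Prod>k<n. lead_coeff (p k))"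
  have L: "L > 0" unfolding L_def by (intro prod_pos) (auto simp: lead)
  define W where "W y = (slater n q y)\<^sup>2 * (\<Prod>i<n. w (y i))" for y
  have W0: "W y \<ge> 0" for y unfolding W_def by (intro mult_nonneg_nonneg prod_nonneg) (auto simp: w)
  have Xm: "X j \<in> borel_measurable M" and Xl: "\<And>\<omega>. \<omega> \<in> space M \<Longrightarrow> X j \<omega> \<in> lattice n" if "j \<in> {1..n}" for j
    using pmf that unfolding has_joint_pmf_proportional_to_def by auto
  obtain c where c: "\<And>t. t \<in> {1..n} \<rightarrow>\<^sub>E lattice n \<Longrightarrow>
        measure M {\<omega> \<in> space M. \<forall>j \<in> {1..n}. X j \<omega> = t j} = c * ensemble_density n v w t"
    using pmf unfolding has_joint_pmf_proportional_to_def by blast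
  define c' where "c' = c / L\<^sup>2"
  have prY: "measure M (?Y -` {y} \<inter> space M) = c' * W y" if y: "y \<in> ?O" for y
  proof -
    have "(\<lambda>j\<in>{1..n}. of_int (y (j - 1)) / real n) \<in> {1..n} \<rightarrow>\<^sub>E lattice n"
      by (auto simp: lattice_def)
    from c[OF this] have "measure M (?Y -` {y} \<inter> space M)
        = c * ensemble_density n v w (\<lambda>j\<in>{1..n}. of_int (y (j - 1)) / real n)"
      by (subst positions_vimage[OF n Xl y])
    also have "\<dots> = c' * (L\<^sup>2 * ensemble_density n v w (\<lambda>j\<in>{1..n}. of_int (y (j - 1)) / real n))"
      using L by (simp add: c'_def)
    also have "L\<^sup>2 * ensemble_density n v w (\<lambda>j\<in>{1..n}. of_int (y (j - 1)) / real n) = W y"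
      unfolding L_def W_def q_def by (rule ensemble_density_slater[OF n deg])
    finally show ?thesis .
  qed
  have cO: "countable ?O" by (intro countable_PiE) auto
  have Ym: "?Y \<in> measurable M (count_space ?O)"
  proof (subst measurable_count_space_eq_countable[OF cO], intro conjI ballI)
    show "?Y \<in> space M \<rightarrow> ?O" by (auto simp: positions_def)
    fix y assume y: "y \<in> ?O"
    have m: "{\<omega> \<in> space M. X j \<omega> = t} \<in> sets M" if "j \<in> {1..n}" for j t
      using measurable_sets[OF Xm[OF that], of "{t}"] by (simp add: vimage_def Int_def conj_commute)
    show "?Y -` {y} \<inter> space M \<in> sets M"
      by (subst positions_vimage[OF n Xl y]) (auto intro!: sets.sets_Collect_finite_All m)
  qed
  have key: "(\<integral>\<^sup>+ \<omega>. ennreal (F (?Y \<omega>)) \<partial>M) = ennreal (c' * infsetsum (\<lambda>y. W y * F y) ?O)"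
    if F: "\<And>y. F y \<ge> 0" and s: "(\<lambda>y. W y * F y) abs_summable_on ?O" for F
  proof -
    \<comment> \<open>The sign comes from the product being a probability, not from a sign of the
      constant, which is still undetermined here.\<close>
    have nn: "c' * W y \<ge> 0" if "y \<in> ?O" for y using prY[OF that] by (metis measure_nonneg)
    have "(\<integral>\<^sup>+ \<omega>. ennreal (F (?Y \<omega>)) \<partial>M) = (\<integral>\<^sup>+ y. emeasure M (?Y -` {y} \<inter> space M) * ennreal (F y) \<partial>count_space ?O)"
      by (rule nn_integral_countable_image[OF Ym cO])
    also have "\<dots> = (\<integral>\<^sup>+ y. ennreal (c' * (W y * F y)) \<partial>count_space ?O)"
      by (rule nn_integral_cong) (auto simp: emeasure_eq_measure prY ennreal_mult'[symmetric] nn F mult.assoc)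
    also have "\<dots> = ennreal (infsetsum (\<lambda>y. c' * (W y * F y)) ?O)"
    proof (rule nn_integral_conv_infsetsum)
      fix y assume "y \<in> ?O"
      then show "0 \<le> c' * (W y * F y)" using nn F by (metis mult.assoc mult_nonneg_nonneg)
    qed (use s in \<open>auto intro: abs_summable_on_cmult_right\<close>)
    finally show ?thesis using s by (simp add: infsetsum_cmult_right)
  qed
  \<comment> \<open>For \<open>g = 1\<close> the statistic is constantly n and the formula yields n!
    (n + n^2 - n), so the constant must be the reciprocal of n!.\<close>
  have norm: "c' * fact n = 1"
  proof -
    have sm1: "(\<lambda>y. (1::real) ^ e * q i y * q j y * w y) abs_summable_on UNIV" if "i < n" "j < n" for e i j
      using sm[of 0 i j] that by simp
    have G1: "infsetsum (\<lambda>y. q i y * q j y * w y) UNIV = (if i = j then 1 else 0)"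
      if "i < n" "j < n" for i j
      using G0[OF that] by (simp add: G_def)
    have "(\<Sum>j<n. \<Sum>k<n. infsetsum (\<lambda>y. q j y * q k y * w y) UNIV * infsetsum (\<lambda>y. q k y * q j y * w y) UNIV)
       = (\<Sum>j<n. \<Sum>k<n. if j = k then 1 else 0)"
      by (intro sum.cong refl) (simp add: G1)
    then have Gs: "(\<Sum>j<n. \<Sum>k<n. infsetsum (\<lambda>y. q j y * q k y * w y) UNIV * infsetsum (\<lambda>y. q k y * q j y * w y) UNIV)
       = real n" by simp
    have i: "infsetsum (\<lambda>y. W y * (\<Sum>j<n. 1::real)\<^sup>2) ?O = fact n * (real n)\<^sup>2"
      unfolding W_def
      by (subst second_moment_slater(2)[of n "\<lambda>_. 1"]) (use sm1 Gs in \<open>simp_all add: G1 cong: sum.cong_simp\<close>)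
    have s: "(\<lambda>y. W y * (\<Sum>j<n. 1::real)\<^sup>2) abs_summable_on ?O"
      unfolding W_def
      by (rule second_moment_slater(1)[of n "\<lambda>_. 1"]) (use sm1 Gs in \<open>simp_all add: G1 cong: sum.cong_simp\<close>)
    have "ennreal ((real n)\<^sup>2) = ennreal (c' * (fact n * (real n)\<^sup>2))"
      using key[of "\<lambda>_. (\<Sum>j<n. 1::real)\<^sup>2", OF _ s] unfolding i by (simp add: emeasure_space_1)
    \<comment> \<open>Since \<open>ennreal\<close> sends negative numbers to 0, positivity of one
      side is what allows it to be cancelled.\<close>
    moreover have "(real n)\<^sup>2 > 0" using n by simp
    ultimately have "(real n)\<^sup>2 = c' * (fact n * (real n)\<^sup>2)"
      by (metis ennreal_eq_0_iff ennreal_inj less_eq_real_def linorder_not_le)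
    then show ?thesis using n by (simp add: field_simps)
  qed
  have stat: "linear_statistic n X (rescale n g) \<omega> = (\<Sum>j<n. g (?Y \<omega> j))" for \<omega>
    unfolding linear_statistic_def
    by (rule sum.reindex_bij_witness[of _ Suc "\<lambda>j. j - 1"]) (auto simp: positions_def rescale_def)
  have s: "(\<lambda>y. W y * (\<Sum>j<n. g (y j))\<^sup>2) abs_summable_on ?O"
    unfolding W_def by (rule second_moment_slater(1)) (use sm G0 in \<open>auto simp: G_def\<close>)
  have i: "infsetsum (\<lambda>y. W y * (\<Sum>j<n. g (y j))\<^sup>2) ?O =
     fact n * ((\<Sum>j<n. G 2 j j) + (\<Sum>j<n. G 1 j j)\<^sup>2 - (\<Sum>j<n. \<Sum>k<n. G 1 j k * G 1 k j))"
    unfolding W_def G_def by (rule second_moment_slater(2)) (use sm G0 in \<open>auto simp: G_def\<close>)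
  have "(\<integral>\<^sup>+ \<omega>. ennreal ((linear_statistic n X (rescale n g) \<omega>)\<^sup>2) \<partial>M)
      = ennreal (c' * (fact n * ((\<Sum>j<n. G 2 j j) + (\<Sum>j<n. G 1 j j)\<^sup>2 - (\<Sum>j<n. \<Sum>k<n. G 1 j k * G 1 k j))))"
    unfolding stat using key[OF _ s] unfolding i by simp
  then show ?thesis using norm by (simp add: mult.assoc[symmetric])
qed

text \<open>Subtracting \<open>m / n\<close> from \<open>g\<close>, where \<open>m\<close> is the mean, reduces the variance to a second moment.\<close>

lemma variance_linear_statistic:
  fixes p :: "nat \<Rightarrow> real poly" and g v w :: "int \<Rightarrow> real"
  defines "q \<equiv> \<lambda>k y. poly (p k) (v y)"
  defines "G \<equiv> \<lambda>e i j. infsetsum (\<lambda>y. g y ^ e * q i y * q j y * w y) UNIV"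
  assumes M: "prob_space M" and n: "n \<ge> 1"
    and pmf: "has_joint_pmf_proportional_to M n X (ensemble_density n v w)"
    and w: "\<And>y. w y \<ge> 0"
    and deg: "\<And>k. k < n \<Longrightarrow> degree (p k) = k" and lead: "\<And>k. k < n \<Longrightarrow> lead_coeff (p k) > 0"
    and sm: "\<And>e i j. e \<le> 2 \<Longrightarrow> i < n \<Longrightarrow> j < n \<Longrightarrow> (\<lambda>y. g y ^ e * q i y * q j y * w y) abs_summable_on UNIV"
    and G0: "\<And>i j. i < n \<Longrightarrow> j < n \<Longrightarrow> G 0 i j = (if i = j then 1 else 0)"
  shows "(\<integral>\<^sup>+ \<omega>. ennreal ((linear_statistic n X (rescale n g) \<omega> - (\<Sum>j<n. G 1 j j))\<^sup>2) \<partial>M)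
     = ennreal (\<Sum>j<n. G 2 j j - (\<Sum>k<n. (G 1 k j)\<^sup>2))"
proof -
  define m where "m = (\<Sum>j<n. G 1 j j)"
  define c where "c = m / real n"
  define h where "h y = g y - c" for y
  let ?H = "\<lambda>e i j. infsetsum (\<lambda>y. h y ^ e * q i y * q j y * w y) UNIV"
  have s0: "(\<lambda>y. q i y * q j y * w y) abs_summable_on UNIV" if "i < n" "j < n" for i j
    using sm[of 0 i j] that by simp
  have s1: "(\<lambda>y. g y * q i y * q j y * w y) abs_summable_on UNIV" if "i < n" "j < n" for i j
    using sm[of 1 i j] that by simp
  have s2: "(\<lambda>y. (g y)\<^sup>2 * q i y * q j y * w y) abs_summable_on UNIV" if "i < n" "j < n" for i j
    using sm[of 2 i j] that by simp
  have e1: "h y * q i y * q j y * w y = g y * q i y * q j y * w y - c * (q i y * q j y * w y)" for y i j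
    by (simp add: h_def algebra_simps)
  have e2: "(h y)\<^sup>2 * q i y * q j y * w y = ((g y)\<^sup>2 * q i y * q j y * w y - (2 * c) * (g y * q i y * q j y * w y))
      + c\<^sup>2 * (q i y * q j y * w y)" for y i j
    by (simp add: h_def algebra_simps power2_eq_square)
  have H0: "?H 0 i j = (if i = j then 1 else 0)" if "i < n" "j < n" for i j
    using G0[OF that] by (simp add: G_def)
  have H1: "?H 1 i j = G 1 i j - (if i = j then c else 0)" if "i < n" "j < n" for i j
    using G0[OF that] s0[OF that] s1[OF that]
    by (simp add: e1 G_def infsetsum_diff infsetsum_cmult_right abs_summable_on_cmult_right)
  have H2: "?H 2 j j = G 2 j j - 2 * c * G 1 j j + c\<^sup>2" if "j < n" for j
    using G0[OF that that] s0[OF that that] s1[OF that that] s2[OF that that]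
    by (simp add: e2 G_def infsetsum_diff infsetsum_add infsetsum_cmult_right abs_summable_on_cmult_right
        abs_summable_on_diff)
  have Gs: "G 1 i j = G 1 j i" for i j unfolding G_def by (simp add: mult_ac)
  have nc: "real n * c = m" using n by (simp add: c_def)
  have z: "(\<Sum>j<n. ?H 1 j j) = 0"
    using nc by (simp add: H1 sum_subtractf m_def del: power_one_right One_nat_def cong: sum.cong_simp)
  \<comment> \<open>The shift by \<open>c\<close> changes this sum and the sum of the
    \<open>?H 2 j j\<close> by the same amount, so \<open>c\<close> drops out of their
    difference.\<close>
  have sq: "(\<Sum>j<n. \<Sum>k<n. ?H 1 j k * ?H 1 k j) = (\<Sum>j<n. \<Sum>k<n. (G 1 k j)\<^sup>2) - 2 * c * m + real n * c\<^sup>2"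
  proof -
    have "(\<Sum>j<n. \<Sum>k<n. ?H 1 j k * ?H 1 k j)
        = (\<Sum>j<n. \<Sum>k<n. (G 1 k j)\<^sup>2 + (if j = k then c\<^sup>2 - 2 * c * G 1 k k else 0))"
    proof (intro sum.cong refl)
      fix j k assume "j \<in> {..<n}" "k \<in> {..<n}"
      then have eq: "?H 1 j k * ?H 1 k j = (G 1 k j - (if j = k then c else 0))\<^sup>2"
        using H1[of j k] H1[of k j] Gs[of j k] by (auto simp: power2_eq_square)
      show "?H 1 j k * ?H 1 k j = (G 1 k j)\<^sup>2 + (if j = k then c\<^sup>2 - 2 * c * G 1 k k else 0)"
        unfolding eq by (auto simp: power2_diff algebra_simps)
    qed
    also have "\<dots> = (\<Sum>j<n. \<Sum>k<n. (G 1 k j)\<^sup>2) + (\<Sum>j<n. c\<^sup>2 - 2 * c * G 1 j j)"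
      by (simp add: sum.distrib)
    finally show ?thesis by (simp add: sum_subtractf m_def sum_distrib_left)
  qed
  have d: "(\<Sum>j<n. ?H 2 j j) = (\<Sum>j<n. G 2 j j) - 2 * c * m + real n * c\<^sup>2"
  proof -
    have "(\<Sum>j<n. ?H 2 j j) = (\<Sum>j<n. G 2 j j - 2 * c * G 1 j j + c\<^sup>2)"
      by (intro sum.cong refl H2) auto
    then show ?thesis by (simp add: sum.distrib sum_subtractf m_def sum_distrib_left)
  qed
  have smh: "(\<lambda>y. h y ^ e * q i y * q j y * w y) abs_summable_on UNIV" if e: "e \<le> 2" and ij: "i < n" "j < n" for e i j
  proof -
    consider "e = 0" | "e = 1" | "e = 2" using e by linarith
    then show ?thesis
      using s0[OF ij] s1[OF ij] s2[OF ij]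
      by cases (auto simp: e1 e2 intro!: abs_summable_on_diff abs_summable_on_add abs_summable_on_cmult_right)
  qed
  have ls: "linear_statistic n X (rescale n h) \<omega> = linear_statistic n X (rescale n g) \<omega> - m" for \<omega>
    using nc by (simp add: linear_statistic_def rescale_def h_def sum_subtractf)
  have "(\<integral>\<^sup>+ \<omega>. ennreal ((linear_statistic n X (rescale n h) \<omega>)\<^sup>2) \<partial>M)
     = ennreal ((\<Sum>j<n. ?H 2 j j) + (\<Sum>j<n. ?H 1 j j)\<^sup>2 - (\<Sum>j<n. \<Sum>k<n. ?H 1 j k * ?H 1 k j))"
    unfolding q_def
    by (rule second_moment_linear_statistic[OF M n pmf w deg lead]) (use smh H0 in \<open>auto simp: q_def\<close>)
  also have "(\<Sum>j<n. ?H 2 j j) + (\<Sum>j<n. ?H 1 j j)\<^sup>2 - (\<Sum>j<n. \<Sum>k<n. ?H 1 j k * ?H 1 k j)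
     = (\<Sum>j<n. G 2 j j - (\<Sum>k<n. (G 1 k j)\<^sup>2))"
    unfolding z sq d by (simp add: sum_subtractf)
  finally show ?thesis unfolding ls m_def .
qed

section \<open>The truncated Jacobi matrix\<close>

lemma eventually_ratio_filter:
  "eventually P (ratio_filter I \<xi>) \<longleftrightarrow>
     (\<exists>N. \<exists>r>0. \<forall>n\<ge>N. \<forall>j\<in>I n. \<bar>real j / real n - \<xi>\<bar> < r \<longrightarrow> P (n, j))" (is "?L = ?R")
proof
  assume ?L
  then obtain Q R where Q: "eventually Q (filtercomap fst sequentially)"
    and R: "eventually R (filtercomap (\<lambda>(n, j). real j / real n) (nhds \<xi>))"
    and QR: "\<And>z. Q z \<Longrightarrow> R z \<Longrightarrow> z \<in> {(n, j). j \<in> I n} \<Longrightarrow> P z"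
    unfolding ratio_filter_def eventually_inf_principal by (auto simp: eventually_inf)
  from Q obtain N where N: "\<And>n j. n \<ge> N \<Longrightarrow> Q (n, j)"
    unfolding eventually_filtercomap eventually_sequentially by force
  from R obtain r where "r > 0" and r: "\<And>n j. \<bar>real j / real n - \<xi>\<bar> < r \<Longrightarrow> R (n, j)"
    unfolding eventually_filtercomap eventually_nhds_metric dist_real_def by force
  show ?R by (intro exI[of _ N] exI[of _ r]) (use N r QR \<open>r > 0\<close> in auto)
next
  assume ?R
  then obtain N r where "r > 0" and NR: "\<And>n j. n \<ge> N \<Longrightarrow> j \<in> I n \<Longrightarrow> \<bar>real j / real n - \<xi>\<bar> < r \<Longrightarrow> P (n, j)" by auto
  have Q: "eventually (\<lambda>z. fst z \<ge> N) (filtercomap fst sequentially)"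
    by (rule eventually_filtercomapI) (rule eventually_ge_at_top)
  have "eventually (\<lambda>x. \<bar>x - \<xi>\<bar> < r) (nhds \<xi>)"
    unfolding eventually_nhds_metric dist_real_def using \<open>r > 0\<close> by auto
  then have R: "eventually (\<lambda>z. \<bar>(\<lambda>(n, j). real j / real n) z - \<xi>\<bar> < r) (filtercomap (\<lambda>(n, j). real j / real n) (nhds \<xi>))"
    by (rule eventually_filtercomapI)
  have "eventually (\<lambda>z. fst z \<ge> N \<and> \<bar>(\<lambda>(n, j). real j / real n) z - \<xi>\<bar> < r)
      (inf (filtercomap fst sequentially) (filtercomap (\<lambda>(n, j). real j / real n) (nhds \<xi>)))"
    by (intro eventually_conj filter_leD[OF inf_le1 Q] filter_leD[OF inf_le2 R])
  then show ?L unfolding ratio_filter_def eventually_inf_principal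
    by eventually_elim (use NR in auto)
qed

lemma ratio_filter_tendsto_sequence:
  assumes "((\<lambda>(n, j). F n j) \<longlongrightarrow> l) (ratio_filter I \<xi>)"
    and "(\<lambda>n. real (j n) / real n) \<longlonglongrightarrow> \<xi>" and "\<forall>\<^sub>F n in sequentially. j n \<in> I n"
  shows "(\<lambda>n. F n (j n)) \<longlonglongrightarrow> l"
proof -
  have "filterlim (\<lambda>n. (n, j n)) (ratio_filter I \<xi>) sequentially"
    unfolding filterlim_iff eventually_ratio_filter
  proof clarify
    fix P N r assume r: "(0::real) < r"
      and P: "\<forall>n\<ge>N. \<forall>j\<in>I n. \<bar>real j / real n - \<xi>\<bar> < r \<longrightarrow> P (n, j)"
    have "\<forall>\<^sub>F n in sequentially. \<bar>real (j n) / real n - \<xi>\<bar> < r"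
      using assms(2) r by (simp add: tendsto_iff dist_real_def)
    then show "\<forall>\<^sub>F n in sequentially. P (n, j n)"
      using assms(3) eventually_ge_at_top[of N] by eventually_elim (use P in auto)
  qed
  from filterlim_compose[OF assms(1) this] show ?thesis by simp
qed

text \<open>Compactness of [0, 1] upgrades convergence at each \<xi> to a single bound, the sum of
  the local bounds over a finite cover. Indices up to \<open>n + k\<close> are included because
  entries of matrix powers look beyond \<open>n\<close>.\<close>

lemma ratio_filter_uniform_bound:
  fixes F :: "nat \<Rightarrow> nat \<Rightarrow> real"
  assumes "\<And>\<xi>. \<xi> \<in> {0..1} \<Longrightarrow> ((\<lambda>(n, j). F n j) \<longlongrightarrow> l \<xi>) (ratio_filter I \<xi>)"
  shows "\<exists>C. \<forall>\<^sub>F n in sequentially. \<forall>j\<in>I n. j \<le> n + k \<longrightarrow> \<bar>F n j\<bar> \<le> C"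
proof -
  have "\<forall>\<xi>\<in>{0..1}. \<exists>N. \<exists>r>0. \<forall>n\<ge>N. \<forall>j\<in>I n. \<bar>real j / real n - \<xi>\<bar> < r \<longrightarrow> \<bar>F n j\<bar> \<le> \<bar>l \<xi>\<bar> + 1"
  proof
    fix \<xi> :: real assume "\<xi> \<in> {0..1}"
    from tendstoD[OF assms[OF this], of 1]
    have "eventually (\<lambda>(n, j). \<bar>F n j - l \<xi>\<bar> < 1) (ratio_filter I \<xi>)"
      by (simp add: dist_real_def case_prod_unfold)
    then have "eventually (\<lambda>(n, j). \<bar>F n j\<bar> \<le> \<bar>l \<xi>\<bar> + 1) (ratio_filter I \<xi>)"
      by eventually_elim auto
    then show "\<exists>N. \<exists>r>0. \<forall>n\<ge>N. \<forall>j\<in>I n. \<bar>real j / real n - \<xi>\<bar> < r \<longrightarrow> \<bar>F n j\<bar> \<le> \<bar>l \<xi>\<bar> + 1"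
      unfolding eventually_ratio_filter by simp
  qed
  then obtain N r where r: "\<And>\<xi>. \<xi> \<in> {0..1} \<Longrightarrow> r \<xi> > 0"
    and N: "\<And>\<xi> n j. \<xi> \<in> {0..1} \<Longrightarrow> n \<ge> N \<xi> \<Longrightarrow> j \<in> I n \<Longrightarrow> \<bar>real j / real n - \<xi>\<bar> < r \<xi> \<Longrightarrow> \<bar>F n j\<bar> \<le> \<bar>l \<xi>\<bar> + 1"
    by metis
  have "{0..1} \<subseteq> (\<Union>\<xi>\<in>{0..1}. ball \<xi> (r \<xi> / 2))" using r by force
  then obtain D where D: "D \<subseteq> {0..1}" "finite D" "{0..1} \<subseteq> (\<Union>\<xi>\<in>D. ball \<xi> (r \<xi> / 2))"
    by (rule compactE_image[OF compact_Icc, rotated]) auto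
  have "\<forall>\<xi>\<in>D. \<forall>\<^sub>F n in sequentially. N \<xi> \<le> n \<and> real k / real n < r \<xi> / 2"
  proof
    fix \<xi> assume "\<xi> \<in> D"
    then have "r \<xi> / 2 > 0" using D r by auto
    moreover have "(\<lambda>n. real k / real n) \<longlonglongrightarrow> 0" by (rule lim_const_over_n)
    ultimately have "\<forall>\<^sub>F n in sequentially. real k / real n < r \<xi> / 2" by (rule order_tendstoD(2)[rotated])
    then show "\<forall>\<^sub>F n in sequentially. N \<xi> \<le> n \<and> real k / real n < r \<xi> / 2"
      using eventually_ge_at_top[of "N \<xi>"] by eventually_elim auto
  qed
  then have "\<forall>\<^sub>F n in sequentially. \<forall>\<xi>\<in>D. N \<xi> \<le> n \<and> real k / real n < r \<xi> / 2"
    by (rule eventually_ball_finite[OF D(2)])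
  then have "\<forall>\<^sub>F n in sequentially. \<forall>j\<in>I n. j \<le> n + k \<longrightarrow> \<bar>F n j\<bar> \<le> (\<Sum>\<xi>\<in>D. \<bar>l \<xi>\<bar> + 1)"
    using eventually_ge_at_top[of 1]
  proof eventually_elim
    case (elim n)
    show ?case
    proof (intro ballI impI)
      fix j assume j: "j \<in> I n" "j \<le> n + k"
      \<comment> \<open>Ratios above 1 are projected to 1. They exceed it by at most k/n, which the
        halved radii of the cover absorb.\<close>
      define z where "z = min 1 (real j / real n)"
      have "z \<in> {0..1}" by (auto simp: z_def)
      then obtain \<xi> where \<xi>: "\<xi> \<in> D" "\<bar>\<xi> - z\<bar> < r \<xi> / 2"
        using D(3) by (force simp: dist_real_def)
      have "real j / real n \<le> 1 + real k / real n"
        using j elim(2) by (simp add: field_simps flip: of_nat_add)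
      then have "\<bar>real j / real n - z\<bar> \<le> real k / real n"
        by (auto simp: z_def min_def)
      then have "\<bar>real j / real n - \<xi>\<bar> < r \<xi>"
        using \<xi> bspec[OF elim(1) \<xi>(1)] by linarith
      then have "\<bar>F n j\<bar> \<le> \<bar>l \<xi>\<bar> + 1" using N[of \<xi> n j] \<xi> D j elim by auto
      also have "\<dots> \<le> (\<Sum>\<xi>\<in>D. \<bar>l \<xi>\<bar> + 1)"
        by (rule member_le_sum) (use \<xi> D in auto)
      finally show "\<bar>F n j\<bar> \<le> (\<Sum>\<xi>\<in>D. \<bar>l \<xi>\<bar> + 1)" .
    qed
  qed
  then show ?thesis ..
qed

section \<open>The Jacobi recurrence extended by zero\<close>

lemma ortho_orders_le: "j \<in> ortho_orders w \<Longrightarrow> i \<le> j \<Longrightarrow> i \<in> ortho_orders w"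
  by (auto simp: ortho_orders_def)

text \<open>Extending the coefficients and the polynomials by zero makes the three-term recurrence hold on
  the support for every \<open>j\<close>, also when the support is finite.\<close>

definition trunc_a :: "(int \<Rightarrow> real) \<Rightarrow> (nat \<Rightarrow> real) \<Rightarrow> nat \<Rightarrow> real" where
  "trunc_a w A j = (if j \<in> a_indices w then A j else 0)"

definition trunc_b :: "(int \<Rightarrow> real) \<Rightarrow> (nat \<Rightarrow> real) \<Rightarrow> nat \<Rightarrow> real" where
  "trunc_b w B j = (if j \<in> ortho_orders w then B j else 0)"

definition trunc_poly :: "(int \<Rightarrow> real) \<Rightarrow> (nat \<Rightarrow> real poly) \<Rightarrow> nat \<Rightarrow> real poly" where
  "trunc_poly w p j = (if j \<in> ortho_orders w then p j else 0)"

text \<open>The inner product of \<open>r\<^sub>i\<close> with the k-th power of \<nu> times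
  \<open>r\<^sub>j\<close>, hence an entry of the k-th power of the Jacobi matrix. Written as a sum
  over the weight it is visibly symmetric in \<open>i\<close> and \<open>j\<close>.\<close>

definition jacobi_power :: "(int \<Rightarrow> real) \<Rightarrow> (int \<Rightarrow> real) \<Rightarrow> (nat \<Rightarrow> real poly) \<Rightarrow> nat \<Rightarrow> nat \<Rightarrow> nat \<Rightarrow> real" where
  "jacobi_power v w p k i j =
     infsetsum (\<lambda>y. v y ^ k * poly (trunc_poly w p i) (v y) * poly (trunc_poly w p j) (v y) * w y) UNIV"

lemma poly_weight_summable:
  fixes v w :: "int \<Rightarrow> real"
  assumes "\<And>k. (\<lambda>y. \<bar>v y\<bar> ^ k * w y) summable_on UNIV" and "\<And>y. w y \<ge> 0"
  shows "(\<lambda>y. poly q (v y) * w y) abs_summable_on (UNIV :: int set)"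
proof -
  have "(\<lambda>y. v y ^ k * w y) abs_summable_on (UNIV :: int set)" for k
  proof (subst abs_summable_equivalent[symmetric])
    have "norm (v y ^ k * w y) = \<bar>v y\<bar> ^ k * w y" for y
      using assms(2)[of y] by (simp add: abs_mult power_abs)
    then show "Infinite_Sum.abs_summable_on (\<lambda>y. v y ^ k * w y) UNIV" using assms(1)[of k] by presburger
  qed
  then have "(\<lambda>y. \<Sum>k\<le>degree q. coeff q k * (v y ^ k * w y)) abs_summable_on (UNIV :: int set)"
    by (intro abs_summable_sum abs_summable_on_cmult_right)
  then show ?thesis by (simp add: poly_altdef sum_distrib_right mult.assoc)
qed

lemma jacobi_summable:
  fixes v w :: "int \<Rightarrow> real"
  assumes "\<And>k. (\<lambda>y. \<bar>v y\<bar> ^ k * w y) summable_on UNIV" and "\<And>y. w y \<ge> 0"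
  shows "(\<lambda>y. v y ^ k * poly q (v y) * poly q' (v y) * w y) abs_summable_on (UNIV :: int set)"
  using poly_weight_summable[OF assms, of "monom 1 k * q * q'"] by (simp add: Polynomial.poly_monom)

text \<open>The cases are an order with a successor, the last order of a finite support, and an
  order beyond it. In the second case the recurrence is available on the support only, hence the
  restriction on \<open>y\<close>.\<close>

lemma trunc_recurrence:
  assumes "recurrence_coefficients v w p A B" and "w y \<noteq> 0"
  shows "v y * poly (trunc_poly w p j) (v y) =
     trunc_a w A j * poly (trunc_poly w p (Suc j)) (v y) + trunc_b w B j * poly (trunc_poly w p j) (v y)
     + (if j = 0 then 0 else trunc_a w A (j - 1) * poly (trunc_poly w p (j - 1)) (v y))"
proof -
  consider "j \<in> a_indices w" | "j \<in> ortho_orders w - a_indices w" | "j \<notin> ortho_orders w" by blast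
  then show ?thesis
  proof cases
    case 1
    then have "Suc j \<in> ortho_orders w" "j \<in> ortho_orders w" "j - 1 \<in> ortho_orders w" "j - 1 \<in> a_indices w"
      by (auto simp: a_indices_def intro: ortho_orders_le)
    then show ?thesis using assms(1) 1
      unfolding recurrence_coefficients_def trunc_poly_def trunc_a_def trunc_b_def by auto
  next
    case 2
    then have "Suc j \<notin> ortho_orders w" "j \<in> ortho_orders w" "j - 1 \<in> ortho_orders w"
      by (auto simp: a_indices_def intro: ortho_orders_le)
    moreover have "j \<noteq> 0 \<Longrightarrow> j - 1 \<in> a_indices w" using 2 by (simp add: a_indices_def)
    moreover have "y \<in> weight_support w" using assms(2) by (simp add: weight_support_def)
    ultimately show ?thesis using assms(1) 2
      unfolding recurrence_coefficients_def trunc_poly_def trunc_a_def trunc_b_def by auto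
  next
    case 3
    \<comment> \<open>Beyond the last order every term vanishes, even the one containing
      \<open>p (j - 1)\<close>: its coefficient survives only if the order \<open>j\<close>
      exists.\<close>
    then have "Suc j \<notin> ortho_orders w" by (auto intro: ortho_orders_le)
    moreover have "j \<noteq> 0 \<Longrightarrow> j - 1 \<notin> a_indices w" using 3 by (simp add: a_indices_def)
    ultimately show ?thesis using 3 unfolding trunc_poly_def trunc_a_def trunc_b_def by auto
  qed
qed

text \<open>The factor \<open>w y\<close> kills the points off the support, so the recurrence may be
  inserted at every \<open>y\<close> under the sum. It acts on the column \<open>j\<close> while the
  row \<open>i\<close> stays fixed.\<close>

lemma jacobi_power_Suc:
  assumes mom: "\<And>k. (\<lambda>y. \<bar>v y\<bar> ^ k * w y) summable_on UNIV" and w: "\<And>y. w y \<ge> 0"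
    and rc: "recurrence_coefficients v w p A B"
  shows "jacobi_power v w p (Suc k) i j =
     trunc_a w A j * jacobi_power v w p k i (Suc j) + trunc_b w B j * jacobi_power v w p k i j
     + (if j = 0 then 0 else trunc_a w A (j - 1) * jacobi_power v w p k i (j - 1))"
proof -
  let ?f = "\<lambda>j y. v y ^ k * poly (trunc_poly w p i) (v y) * poly (trunc_poly w p j) (v y) * w y"
  let ?c = "if j = 0 then 0 else trunc_a w A (j - 1)"
  have s: "?f j abs_summable_on UNIV" for j by (rule jacobi_summable[OF mom w])
  have "jacobi_power v w p (Suc k) i j
      = infsetsum (\<lambda>y. trunc_a w A j * ?f (Suc j) y + trunc_b w B j * ?f j y + ?c * ?f (j - 1) y) UNIV"
    unfolding jacobi_power_def
  proof (rule infsetsum_cong[OF _ refl])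
    fix y
    show "v y ^ Suc k * poly (trunc_poly w p i) (v y) * poly (trunc_poly w p j) (v y) * w y
      = trunc_a w A j * ?f (Suc j) y + trunc_b w B j * ?f j y + ?c * ?f (j - 1) y"
    proof (cases "w y = 0")
      case False
      have "v y ^ Suc k * poly (trunc_poly w p i) (v y) * poly (trunc_poly w p j) (v y) * w y
         = v y ^ k * poly (trunc_poly w p i) (v y) * (v y * poly (trunc_poly w p j) (v y)) * w y"
        by simp
      also have "\<dots> = trunc_a w A j * ?f (Suc j) y + trunc_b w B j * ?f j y + ?c * ?f (j - 1) y"
        unfolding trunc_recurrence[OF rc False] by (simp add: algebra_simps)
      finally show ?thesis .
    qed simp
  qed
  also have "\<dots> = trunc_a w A j * infsetsum (?f (Suc j)) UNIV + trunc_b w B j * infsetsum (?f j) UNIV + ?c * infsetsum (?f (j - 1)) UNIV"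
    using s by (simp add: infsetsum_add infsetsum_cmult_right abs_summable_on_add abs_summable_on_cmult_right)
  finally show ?thesis by (simp add: jacobi_power_def)
qed

lemma jacobi_power_0:
  assumes mom: "\<And>k. (\<lambda>y. \<bar>v y\<bar> ^ k * w y) summable_on UNIV" and w: "\<And>y. w y \<ge> 0"
    and on: "orthonormal_polynomials v w p"
  shows "jacobi_power v w p 0 i j = (if i = j \<and> j \<in> ortho_orders w then 1 else 0)"
proof (cases "i \<in> ortho_orders w \<and> j \<in> ortho_orders w")
  case True
  then have hs: "((\<lambda>y. poly (p i) (v y) * poly (p j) (v y) * w y) has_sum (if i = j then 1 else 0)) UNIV"
    using on unfolding orthonormal_polynomials_def by auto
  have "(\<lambda>y. poly (p i) (v y) * poly (p j) (v y) * w y) abs_summable_on UNIV"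
    using jacobi_summable[OF mom w, of 0 "p i" "p j"] by simp
  then have "infsetsum (\<lambda>y. poly (p i) (v y) * poly (p j) (v y) * w y) UNIV = (if i = j then 1 else 0)"
    using infsumI[OF hs] by (simp add: infsetsum_infsum)
  then show ?thesis using True by (simp add: jacobi_power_def trunc_poly_def)
qed (auto simp: jacobi_power_def trunc_poly_def)

lemma jacobi_power_sym: "jacobi_power v w p k i j = jacobi_power v w p k j i"
  unfolding jacobi_power_def by (simp add: mult_ac)

text \<open>One step produces three terms, each at most \<open>C\<close> times the previous bound.
  The column rises by at most one per step, so \<open>k\<close> steps starting from \<open>j\<close>
  use coefficients up to \<open>N\<close> only.\<close>

lemma tridiagonal_power_bound:
  fixes c :: "nat \<Rightarrow> nat \<Rightarrow> nat \<Rightarrow> real"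
  assumes c0: "\<And>i j. \<bar>c 0 i j\<bar> \<le> 1"
    and c1: "\<And>k i j. c (Suc k) i j = al j * c k i (Suc j) + be j * c k i j + (if j = 0 then 0 else al (j - 1) * c k i (j - 1))"
    and C: "\<And>j. j \<le> N \<Longrightarrow> \<bar>al j\<bar> \<le> C" "\<And>j. j \<le> N \<Longrightarrow> \<bar>be j\<bar> \<le> C"
  shows "j + k \<le> N \<Longrightarrow> \<bar>c k i j\<bar> \<le> (3 * C) ^ k"
proof (induction k arbitrary: j)
  case 0
  then show ?case using c0 by simp
next
  case (Suc k)
  have C0: "C \<ge> 0" using C(1)[of 0] by simp
  have I: "\<bar>c k i j'\<bar> \<le> (3 * C) ^ k" if "j' \<le> Suc j" for j'
    by (rule Suc.IH) (use that Suc.prems in simp)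
  have P: "\<bar>x * c k i j'\<bar> \<le> C * (3 * C) ^ k" if "\<bar>x\<bar> \<le> C" "j' \<le> Suc j" for x j'
    unfolding abs_mult using that C0 by (intro mult_mono I) auto
  have 1: "\<bar>al j * c k i (Suc j)\<bar> \<le> C * (3 * C) ^ k" by (rule P[OF C(1)]) (use Suc.prems in auto)
  have 2: "\<bar>be j * c k i j\<bar> \<le> C * (3 * C) ^ k" by (rule P[OF C(2)]) (use Suc.prems in auto)
  have 3: "\<bar>if j = 0 then 0 else al (j - 1) * c k i (j - 1)\<bar> \<le> C * (3 * C) ^ k"
  proof (cases "j = 0")
    case False
    have "\<bar>al (j - 1) * c k i (j - 1)\<bar> \<le> C * (3 * C) ^ k" by (rule P[OF C(1)]) (use Suc.prems in auto)
    then show ?thesis using False by simp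
  next
    case True
    then show ?thesis using C0 by (simp only: if_True abs_zero) simp
  qed
  have "\<bar>c (Suc k) i j\<bar> \<le> 3 * (C * (3 * C) ^ k)" unfolding c1 using 1 2 3 by linarith
  then show ?case by (simp only: power_Suc mult.assoc)
qed

text \<open>Matrix multiplication cut off at \<open>n\<close> stays exact as long as the column
  cannot leave the range: \<open>l\<close> steps from \<open>j\<close> reach at most
  \<open>j + l\<close>. This is Parseval's identity in finite form.\<close>

lemma tridiagonal_power_mult:
  fixes c :: "nat \<Rightarrow> nat \<Rightarrow> nat \<Rightarrow> real"
  assumes c0: "\<And>i j. j < n \<Longrightarrow> c 0 i j = (if i = j then 1 else 0)"
    and c1: "\<And>k i j. c (Suc k) i j = al j * c k i (Suc j) + be j * c k i j + (if j = 0 then 0 else al (j - 1) * c k i (j - 1))"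
  shows "j + l < n \<Longrightarrow> c (k + l) i j = (\<Sum>q<n. c k i q * c l q j)"
proof (induction l arbitrary: j)
  case 0
  then have "(\<Sum>q<n. c k i q * c 0 q j) = (\<Sum>q<n. if q = j then c k i q else 0)"
    by (intro sum.cong refl) (simp add: c0)
  then show ?case using 0 by simp
next
  case (Suc l)
  have 1: "c (k + l) i (Suc j) = (\<Sum>q<n. c k i q * c l q (Suc j))"
    and 2: "c (k + l) i j = (\<Sum>q<n. c k i q * c l q j)"
    and 3: "c (k + l) i (j - 1) = (\<Sum>q<n. c k i q * c l q (j - 1))"
    using Suc.prems by (auto intro!: Suc.IH)
  have "(\<Sum>q<n. c k i q * c (Suc l) q j) = (\<Sum>q<n. al j * (c k i q * c l q (Suc j)) + be j * (c k i q * c l q j)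
      + (if j = 0 then 0 else al (j - 1)) * (c k i q * c l q (j - 1)))"
    by (intro sum.cong refl) (simp add: c1 algebra_simps)
  also have "\<dots> = al j * c (k + l) i (Suc j) + be j * c (k + l) i j + (if j = 0 then 0 else al (j - 1)) * c (k + l) i (j - 1)"
    unfolding 1 2 3 by (simp add: sum.distrib sum_distrib_left)
  also have "\<dots> = c (k + Suc l) i j" by (simp add: c1)
  finally show ?case ..
qed

text \<open>For \<open>j + k < n\<close> the product formula and symmetry make the
  \<open>j\<close>-th term zero. At most \<open>k\<close> columns remain; there the subtracted
  squares are dropped, leaving an entry of the 2k-th power, whose recurrence reaches indices up to
  \<open>n + 2 * k\<close>.\<close>

lemma tridiagonal_variance_bound:
  fixes c :: "nat \<Rightarrow> nat \<Rightarrow> nat \<Rightarrow> real"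
  assumes c0: "\<And>i j. \<bar>c 0 i j\<bar> \<le> 1" "\<And>i j. j < n \<Longrightarrow> c 0 i j = (if i = j then 1 else 0)"
    and c1: "\<And>k i j. c (Suc k) i j = al j * c k i (Suc j) + be j * c k i j + (if j = 0 then 0 else al (j - 1) * c k i (j - 1))"
    and sym: "\<And>k i j. c k i j = c k j i"
    and C: "\<And>j. j \<le> n + 2 * k \<Longrightarrow> \<bar>al j\<bar> \<le> C" "\<And>j. j \<le> n + 2 * k \<Longrightarrow> \<bar>be j\<bar> \<le> C"
  shows "(\<Sum>j<n. c (2 * k) j j - (\<Sum>i<n. (c k i j)\<^sup>2)) \<le> real k * (3 * C) ^ (2 * k)"
proof -
  have "(\<Sum>j<n. c (2 * k) j j - (\<Sum>i<n. (c k i j)\<^sup>2)) \<le> (\<Sum>j<n. if j + k < n then 0 else (3 * C) ^ (2 * k))"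
  proof (rule sum_mono)
    fix j assume "j \<in> {..<n}"
    then have j: "j < n" by simp
    show "c (2 * k) j j - (\<Sum>i<n. (c k i j)\<^sup>2) \<le> (if j + k < n then 0 else (3 * C) ^ (2 * k))"
    proof (cases "j + k < n")
      case True
      have "c (k + k) j j = (\<Sum>q<n. c k j q * c k q j)"
        by (rule tridiagonal_power_mult[where al = al and be = be]) (use c0 c1 True in auto)
      also have "\<dots> = (\<Sum>q<n. (c k q j)\<^sup>2)"
        by (intro sum.cong refl) (simp add: sym[of k j] power2_eq_square)
      finally show ?thesis using True by (simp add: mult_2)
    next
      case False
      have "\<bar>c (2 * k) j j\<bar> \<le> (3 * C) ^ (2 * k)"
        by (rule tridiagonal_power_bound[where N = "n + 2 * k" and al = al and be = be]) (use c0 c1 C j in auto)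
      moreover have "(\<Sum>i<n. (c k i j)\<^sup>2) \<ge> 0" by (intro sum_nonneg) auto
      ultimately show ?thesis using False by simp
    qed
  qed
  also have "\<dots> = (\<Sum>j\<in>{n - k..<n}. (3 * C) ^ (2 * k))"
    by (rule sum.mono_neutral_cong_right) auto
  also have "\<dots> \<le> real k * (3 * C) ^ (2 * k)"
    by (simp, rule mult_right_mono) auto
  finally show ?thesis .
qed

section \<open>Arcsine averages\<close>

text \<open>The exceptional sets to which this is applied are the endpoints of [0, 1], the zeros of
  \<open>a\<close>, and the discontinuities of a test function. Deleting a negligible set changes
  neither integrability nor the integral.\<close>

lemma dominated_convergence_negligible:
  fixes f :: "nat \<Rightarrow> 'n::euclidean_space \<Rightarrow> real"
  assumes N: "negligible N" and f: "\<And>k. f k integrable_on S" and h: "h integrable_on S"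
    and le: "\<And>k x. x \<in> S - N \<Longrightarrow> \<bar>f k x\<bar> \<le> h x"
    and conv: "\<And>x. x \<in> S - N \<Longrightarrow> (\<lambda>k. f k x) \<longlonglongrightarrow> g x"
  shows "g integrable_on S" "(\<lambda>k. integral S (f k)) \<longlonglongrightarrow> integral S g"
proof -
  have spike: "(F has_integral y) S \<longleftrightarrow> (F has_integral y) (S - N)" for F :: "'n \<Rightarrow> real" and y
  proof (rule has_integral_spike_set_eq)
    show "negligible {x \<in> S - (S - N). F x \<noteq> 0}" by (rule negligible_subset[OF N]) blast
    show "negligible {x \<in> S - N - S. F x \<noteq> 0}" by (rule negligible_subset[OF N]) blast
  qed
  have io: "F integrable_on S \<longleftrightarrow> F integrable_on (S - N)" for F :: "'n \<Rightarrow> real"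
    unfolding integrable_on_def spike ..
  have i: "integral S F = integral (S - N) F" for F :: "'n \<Rightarrow> real"
    unfolding integral_def io spike ..
  have f': "f k integrable_on (S - N)" for k using f[of k] unfolding io .
  have h': "h integrable_on (S - N)" using h unfolding io .
  have le': "norm (f k x) \<le> h x" if "x \<in> S - N" for k x using le[OF that] by simp
  show "g integrable_on S" unfolding io
    by (rule dominated_convergence(1)[OF f' h' le' conv])
  show "(\<lambda>k. integral S (f k)) \<longlonglongrightarrow> integral S g" unfolding i
    by (rule dominated_convergence(2)[OF f' h' le' conv])
qed

text \<open>The mean of \<open>g\<close> under the arcsine law on [b - 2a, b + 2a], which for
  \<open>a = 0\<close> is the point mass at \<open>b\<close>. For \<open>a > 0\<close> the argument
  of \<open>g\<close> increases over [-pi, 0] and runs through the support exactly once.\<close>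

definition arcsine_mean :: "(real \<Rightarrow> real) \<Rightarrow> real \<Rightarrow> real \<Rightarrow> real" where
  "arcsine_mean g a b = 1 / pi * integral {- pi..0} (\<lambda>\<theta>. g (b + 2 * a * cos \<theta>))"

text \<open>A Fourier coefficient of the k-th power of the symbol b + 2a cos \<theta>, that is, the
  entry at distance \<open>l\<close> from the diagonal of the k-th power of the Laurent operator.
  Half a period suffices because the integrand is even.\<close>

definition arcsine_fourier :: "nat \<Rightarrow> real \<Rightarrow> real \<Rightarrow> int \<Rightarrow> real" where
  "arcsine_fourier k a b l = 1 / pi * integral {- pi..0} (\<lambda>\<theta>. (b + 2 * a * cos \<theta>) ^ k * cos (of_int l * \<theta>))"

lemma arcsine_fourier_0: "arcsine_fourier 0 a b l = (if l = 0 then 1 else 0)"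
proof (cases "l = 0")
  case False
  have "((\<lambda>\<theta>. cos (of_int l * \<theta>)) has_integral
      (sin (of_int l * 0) / of_int l - sin (of_int l * (- pi)) / of_int l)) {- pi..0}"
    by (rule fundamental_theorem_of_calculus)
      (use False in \<open>auto intro!: derivative_eq_intros simp flip: has_real_derivative_iff_has_vector_derivative\<close>)
  moreover have "sin (of_int l * pi) = 0" by (simp add: sin_zero_iff_int2)
  ultimately have "integral {- pi..0} (\<lambda>\<theta>. cos (of_int l * \<theta>)) = 0"
    by (simp add: integral_unique)
  then show ?thesis using False by (simp add: arcsine_fourier_def)
qed (simp add: arcsine_fourier_def)

text \<open>The identity 2 cos \<theta> cos(l\<theta>) = cos((l+1)\<theta>) + cos((l-1)\<theta>)
  turns multiplication by the symbol into the recurrence of \<open>jacobi_power_Suc\<close> with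
  constant coefficients.\<close>

lemma arcsine_fourier_Suc:
  "arcsine_fourier (Suc k) a b l =
     a * arcsine_fourier k a b (l + 1) + b * arcsine_fourier k a b l + a * arcsine_fourier k a b (l - 1)"
proof -
  let ?f = "\<lambda>l \<theta>. (b + 2 * a * cos \<theta>) ^ k * cos (of_int l * \<theta>)"
  have i: "?f l integrable_on {- pi..0}" for l
    by (intro integrable_continuous_real continuous_intros)
  have eq: "(b + 2 * a * cos \<theta>) ^ Suc k * cos (of_int l * \<theta>) = a * ?f (l + 1) \<theta> + b * ?f l \<theta> + a * ?f (l - 1) \<theta>" for \<theta>
  proof -
    have "cos (of_int (l + 1) * \<theta>) + cos (of_int (l - 1) * \<theta>) = 2 * cos \<theta> * cos (of_int l * \<theta>)"
      by (simp add: ring_distribs cos_add cos_diff)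
    moreover have "P * (b + 2 * a * t) * c = a * (P * c1) + b * (P * c) + a * (P * c2)"
      if "c1 + c2 = 2 * t * c" for P t c c1 c2 :: real
    proof -
      have "a * (P * c1) + b * (P * c) + a * (P * c2) = P * a * (c1 + c2) + b * (P * c)"
        by (simp add: algebra_simps)
      then show ?thesis unfolding that by (simp add: algebra_simps)
    qed
    ultimately show ?thesis by (simp only: power_Suc2)
  qed
  have hi: "(?f l has_integral integral {- pi..0} (?f l)) {- pi..0}" for l
    using i by (rule integrable_integral)
  have "integral {- pi..0} (\<lambda>\<theta>. (b + 2 * a * cos \<theta>) ^ Suc k * cos (of_int l * \<theta>))
      = a * integral {- pi..0} (?f (l + 1)) + b * integral {- pi..0} (?f l) + a * integral {- pi..0} (?f (l - 1))"
    unfolding eq by (intro integral_unique has_integral_add has_integral_mult_right hi)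
  then show ?thesis by (simp add: arcsine_fourier_def algebra_simps)
qed

lemma arcsine_mean_power: "arcsine_mean (\<lambda>u. u ^ k) a b = arcsine_fourier k a b 0"
  by (simp add: arcsine_mean_def arcsine_fourier_def)

text \<open>Near an index of size about \<xi> n the coefficients are asymptotically constant, so
  both recurrences agree in the limit and induction on \<open>k\<close>, for all offsets
  \<open>l\<close> at once, transfers the initial values. Since 0 < \<xi> < 1, the boundary at 0 and
  the cutoff at \<open>n\<close> are eventually out of reach.\<close>

lemma tridiagonal_power_limit:
  fixes c :: "nat \<Rightarrow> nat \<Rightarrow> nat \<Rightarrow> nat \<Rightarrow> real"
  assumes \<xi>: "0 < \<xi>" "\<xi> < 1"
    and c0: "\<And>n i j. n \<ge> 1 \<Longrightarrow> j < n \<Longrightarrow> c n 0 i j = (if i = j then 1 else 0)"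
    and c1: "\<And>n k i j. n \<ge> 1 \<Longrightarrow> c n (Suc k) i j = al n j * c n k i (Suc j) + be n j * c n k i j
        + (if j = 0 then 0 else al n (j - 1) * c n k i (j - 1))"
    and al: "\<And>j. (\<lambda>n. real (j n) / real n) \<longlonglongrightarrow> \<xi> \<Longrightarrow> (\<lambda>n. al n (j n)) \<longlonglongrightarrow> a"
    and be: "\<And>j. (\<lambda>n. real (j n) / real n) \<longlonglongrightarrow> \<xi> \<Longrightarrow> (\<lambda>n. be n (j n)) \<longlonglongrightarrow> b"
    and i: "(\<lambda>n. real (i n) / real n) \<longlonglongrightarrow> \<xi>"
  shows "(\<lambda>n. c n k (i n) (nat (int (i n) + l))) \<longlonglongrightarrow> arcsine_fourier k a b l"
proof -
  have ratio: "(\<lambda>n. (real (i n) + of_int l) / real n) \<longlonglongrightarrow> \<xi>" for l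
  proof -
    have "(\<lambda>n. real (i n) / real n + of_int l / real n) \<longlonglongrightarrow> \<xi> + 0"
      by (intro tendsto_add i lim_const_over_n)
    then show ?thesis by (simp add: add_divide_distrib)
  qed
  \<comment> \<open>The lower bound 1 rather than 0 keeps the column away from 0, where the
    recurrence loses a term; the upper bound makes the initial values available.\<close>
  have ev: "\<forall>\<^sub>F n in sequentially. n \<ge> 1 \<and> int (i n) + l \<ge> 1 \<and> int (i n) + l < int n" for l
  proof -
    have "\<forall>\<^sub>F n in sequentially. (real (i n) + of_int (l - 1)) / real n > 0"
      by (rule order_tendstoD(1)[OF ratio \<xi>(1)])
    moreover have "\<forall>\<^sub>F n in sequentially. (real (i n) + of_int l) / real n < 1"
      by (rule order_tendstoD(2)[OF ratio \<xi>(2)])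
    ultimately show ?thesis using eventually_gt_at_top[of 0]
    proof eventually_elim
      case (elim n)
      then have "real_of_int (int (i n) + (l - 1)) > 0" "real_of_int (int (i n) + l) < real_of_int (int n)"
        by (auto simp: field_simps zero_less_divide_iff)
      then show ?case using elim by linarith
    qed
  qed
  have natratio: "(\<lambda>n. real (nat (int (i n) + l)) / real n) \<longlonglongrightarrow> \<xi>" for l
    by (rule Lim_transform_eventually[OF ratio[of l]], use ev[of l] in eventually_elim) simp
  show ?thesis
  proof (induction k arbitrary: l)
    case 0
    show ?case
    proof (rule Lim_transform_eventually[OF tendsto_const], use ev[of l] in eventually_elim)
      case (elim n)
      then show ?case by (subst c0) (auto simp: arcsine_fourier_0)
    qed
  next
    case (Suc k)
    have "(\<lambda>n. al n (nat (int (i n) + l)) * c n k (i n) (nat (int (i n) + (l + 1)))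
        + be n (nat (int (i n) + l)) * c n k (i n) (nat (int (i n) + l))
        + al n (nat (int (i n) + (l - 1))) * c n k (i n) (nat (int (i n) + (l - 1))))
      \<longlonglongrightarrow> arcsine_fourier (Suc k) a b l"
      unfolding arcsine_fourier_Suc by (intro tendsto_intros Suc al be natratio)
    then show ?case
    proof (rule Lim_transform_eventually, use ev[of l] in eventually_elim)
      case (elim n)
      then have "Suc (nat (int (i n) + l)) = nat (int (i n) + (l + 1))"
        "nat (int (i n) + l) - 1 = nat (int (i n) + (l - 1))" "nat (int (i n) + l) \<noteq> 0" by auto
      then show ?case using elim by (simp add: c1)
    qed
  qed
qed

section \<open>Averages over j < n as integrals over [0, 1]\<close>

lemma has_integral_step_function:
  fixes \<phi> :: "nat \<Rightarrow> real"
  assumes n: "n \<ge> 1"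
  shows "((\<lambda>\<xi>. \<phi> (nat \<lfloor>real n * \<xi>\<rfloor>)) has_integral ((\<Sum>j<m. \<phi> j) / real n)) {0..real m / real n}"
proof (induction m)
  case (Suc m)
  let ?I = "{real m / real n..real (Suc m) / real n}"
  have le: "real m / real n \<le> real (Suc m) / real n" by (simp add: divide_right_mono)
  have "((\<lambda>\<xi>. \<phi> m) has_integral (\<phi> m / real n)) ?I"
    using has_integral_const_real[of "\<phi> m" "real m / real n" "real (Suc m) / real n"] n
    by (simp add: field_simps)
  then have "((\<lambda>\<xi>. \<phi> (nat \<lfloor>real n * \<xi>\<rfloor>)) has_integral (\<phi> m / real n)) ?I"
  proof (rule has_integral_spike_finite[of "{real (Suc m) / real n}", rotated 2])
    fix \<xi> assume "\<xi> \<in> ?I - {real (Suc m) / real n}"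
    then have "real m \<le> real n * \<xi>" "real n * \<xi> < real m + 1"
      using n by (auto simp: field_simps order_less_le)
    then have "\<lfloor>real n * \<xi>\<rfloor> = int m" by (intro floor_unique) auto
    then show "\<phi> (nat \<lfloor>real n * \<xi>\<rfloor>) = \<phi> m" by simp
  qed auto
  from has_integral_combine[OF _ le Suc this]
  show ?case by (simp add: add_divide_distrib)
qed (use has_integral_refl(2)[of _ "0::real"] in simp)

text \<open>The average is the integral of a step function, so a pointwise limit together with a
  uniform bound is enough by dominated convergence; no uniformity in \<xi> is involved.\<close>

lemma step_sum_limit:
  fixes \<phi> :: "nat \<Rightarrow> nat \<Rightarrow> real"
  assumes lim: "\<And>\<xi>. 0 < \<xi> \<Longrightarrow> \<xi> < 1 \<Longrightarrow> (\<lambda>n. \<phi> n (nat \<lfloor>real n * \<xi>\<rfloor>)) \<longlonglongrightarrow> g \<xi>"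
    and bd: "\<forall>\<^sub>F n in sequentially. \<forall>j<n. \<bar>\<phi> n j\<bar> \<le> D"
  shows "(\<lambda>n. (\<Sum>j<n. \<phi> n j) / real n) \<longlonglongrightarrow> integral {0..1} g"
proof -
  from bd eventually_ge_at_top[of 1] have "\<forall>\<^sub>F n in sequentially. n \<ge> 1 \<and> (\<forall>j<n. \<bar>\<phi> n j\<bar> \<le> D)"
    by eventually_elim auto
  then obtain N where N: "\<And>n. n \<ge> N \<Longrightarrow> n \<ge> 1 \<and> (\<forall>j<n. \<bar>\<phi> n j\<bar> \<le> D)"
    unfolding eventually_sequentially by auto
  \<comment> \<open>The sequence is started at \<open>N\<close>, where the bound begins to hold, so
    that the domination covers every member.\<close>
  let ?f = "\<lambda>n \<xi>. \<phi> (n + N) (nat \<lfloor>real (n + N) * \<xi>\<rfloor>)"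
  have hi: "(?f n has_integral ((\<Sum>j<n+N. \<phi> (n + N) j) / real (n + N))) {0..1}" for n
    using has_integral_step_function[of "n + N" "\<phi> (n + N)" "n + N"] N[of "n + N"] by simp
  have "(\<lambda>n. integral {0..1} (?f n)) \<longlonglongrightarrow> integral {0..1} g"
  proof (rule dominated_convergence_negligible(2)[where N = "{0,1}" and h = "\<lambda>_. D"])
    show "?f n integrable_on {0..1}" for n using hi by blast
    fix \<xi> :: real assume "\<xi> \<in> {0..1} - {0,1}"
    then have x: "0 < \<xi>" "\<xi> < 1" by auto
    show "(\<lambda>n. ?f n \<xi>) \<longlonglongrightarrow> g \<xi>" using LIMSEQ_ignore_initial_segment[OF lim[OF x], of N] by simp
    fix n
    have "real (n + N) * \<xi> < real (n + N)" using x N[of "n + N"] by (simp only: mult_less_cancel_left2) simp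
    then have "nat \<lfloor>real (n + N) * \<xi>\<rfloor> < n + N" using x by (simp add: nat_less_iff floor_less_iff)
    then show "\<bar>?f n \<xi>\<bar> \<le> D" using N[of "n + N"] by auto
  qed (auto intro: integrable_const_ivl)
  then have "(\<lambda>n. (\<Sum>j<n+N. \<phi> (n + N) j) / real (n + N)) \<longlonglongrightarrow> integral {0..1} g"
    using integral_unique[OF hi] by simp
  then show ?thesis by (rule LIMSEQ_offset)
qed

lemma floor_ratio_tendsto:
  assumes "\<xi> \<ge> 0"
  shows "(\<lambda>n. real (nat \<lfloor>real n * \<xi>\<rfloor>) / real n) \<longlonglongrightarrow> \<xi>"
proof (rule tendsto_sandwich)
  show "(\<lambda>n. \<xi> - 1 / real n) \<longlonglongrightarrow> \<xi>" using tendsto_diff[OF tendsto_const[of \<xi>] lim_const_over_n[of 1]] by simp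
  show "(\<lambda>n. \<xi>) \<longlonglongrightarrow> \<xi>" by simp
  show "\<forall>\<^sub>F n in sequentially. \<xi> - 1 / real n \<le> real (nat \<lfloor>real n * \<xi>\<rfloor>) / real n"
    using eventually_gt_at_top[of 0]
  proof eventually_elim
    case (elim n)
    have "real n * \<xi> - 1 \<le> of_int \<lfloor>real n * \<xi>\<rfloor>" by linarith
    then have "(real n * \<xi> - 1) / real n \<le> of_int \<lfloor>real n * \<xi>\<rfloor> / real n" by (rule divide_right_mono) simp
    then show ?case using elim assms by (simp add: diff_divide_distrib)
  qed
  show "\<forall>\<^sub>F n in sequentially. real (nat \<lfloor>real n * \<xi>\<rfloor>) / real n \<le> \<xi>"
    using eventually_gt_at_top[of 0]
  proof eventually_elim
    case (elim n)
    have "of_int \<lfloor>real n * \<xi>\<rfloor> \<le> real n * \<xi>" by linarith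
    then show ?case using elim assms by (simp add: field_simps)
  qed
qed

text \<open>Under u = b + 2a cos \<theta> the square root equals the modulus of the derivative -2a
  sin \<theta>, and the singularities cancel. The change of variables is made on the open interval,
  where the sine does not vanish, and integrability near the endpoints is inherited from the
  continuous integrand in \<theta>.\<close>

lemma arcsine_substitution:
  fixes g :: "real \<Rightarrow> real"
  assumes a: "a > 0" and g: "continuous_on UNIV g"
  shows "((\<lambda>u. g u / sqrt (4 * a\<^sup>2 - (u - b)\<^sup>2)) has_integral (pi * arcsine_mean g a b)) {b - 2 * a..b + 2 * a}"
proof -
  define S where "S = {- pi<..<0}"
  define G where "G \<theta> = b + 2 * a * cos \<theta>" for \<theta>
  define F where "F u = g u / sqrt (4 * a\<^sup>2 - (u - b)\<^sup>2)" for u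
  have sin_neg: "sin \<theta> < 0" if "\<theta> \<in> S" for \<theta>
    using sin_gt_zero[of "- \<theta>"] that by (auto simp: S_def)
  have inj: "inj_on G S"
  proof (rule inj_onI)
    fix x y assume xy: "x \<in> S" "y \<in> S" "G x = G y"
    then have "cos (- x) = cos (- y)" using a by (simp add: G_def)
    then have "- x = - y" by (rule cos_inj_pi[rotated 4]) (use xy in \<open>auto simp: S_def\<close>)
    then show "x = y" by simp
  qed
  have img: "G ` S = {b - 2 * a<..<b + 2 * a}"
  proof (intro set_eqI iffI)
    fix u assume "u \<in> G ` S"
    then obtain \<theta> where t: "\<theta> \<in> S" "u = G \<theta>" by auto
    have "cos \<theta> < 1" "cos \<theta> > - 1"
    proof -
      have "(cos \<theta>)\<^sup>2 < 1" using sin_neg[OF t(1)] sin_cos_squared_add[of \<theta>] by (smt (verit) zero_less_power2)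
      then show "cos \<theta> < 1" "cos \<theta> > - 1" using abs_square_less_1[of "cos \<theta>"] by auto
    qed
    then have "2 * a * cos \<theta> < 2 * a * 1" "2 * a * (- 1) < 2 * a * cos \<theta>"
      using a by (intro mult_strict_left_mono; simp)+
    then show "u \<in> {b - 2 * a<..<b + 2 * a}" by (simp add: t G_def)
  next
    fix u assume u: "u \<in> {b - 2 * a<..<b + 2 * a}"
    define z where "z = (u - b) / (2 * a)"
    have z: "- 1 < z" "z < 1" using u a by (auto simp: z_def field_simps)
    have "- arccos z \<in> S" using arccos_lt_bounded[OF z] by (simp add: S_def)
    moreover have "G (- arccos z) = u" using z a by (simp add: G_def cos_arccos z_def)
    ultimately show "u \<in> G ` S" by blast
  qed
  have Gd: "(G has_field_derivative (- 2 * a * sin \<theta>)) (at \<theta> within S)" for \<theta>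
    unfolding G_def by (auto intro!: derivative_eq_intros)
  have pt: "\<bar>- 2 * a * sin \<theta>\<bar> * F (G \<theta>) = g (G \<theta>)" if "\<theta> \<in> S" for \<theta>
  proof -
    have "4 * a\<^sup>2 - (G \<theta> - b)\<^sup>2 = (- 2 * a * sin \<theta>)\<^sup>2"
      unfolding G_def by (simp add: power_mult_distrib cos_squared_eq algebra_simps)
    then have "sqrt (4 * a\<^sup>2 - (G \<theta> - b)\<^sup>2) = \<bar>- 2 * a * sin \<theta>\<bar>" by simp
    then show ?thesis using sin_neg[OF that] a by (simp add: F_def)
  qed
  have cont: "continuous_on {- pi..0} (\<lambda>\<theta>. g (G \<theta>))"
    by (rule continuous_on_compose2[OF g]) (auto simp: G_def intro!: continuous_intros)
  have "(\<lambda>\<theta>. g (G \<theta>)) absolutely_integrable_on {- pi..0}"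
    by (rule absolutely_integrable_continuous_real[OF cont])
  then have "(\<lambda>\<theta>. g (G \<theta>)) absolutely_integrable_on S"
    by (rule set_integrable_subset) (auto simp: S_def)
  then have "(\<lambda>\<theta>. \<bar>- 2 * a * sin \<theta>\<bar> * F (G \<theta>)) absolutely_integrable_on S"
    by (rule absolutely_integrable_spike[of _ _ "{}"]) (auto simp: pt[simplified])
  moreover have "integral S (\<lambda>\<theta>. \<bar>- 2 * a * sin \<theta>\<bar> * F (G \<theta>)) = integral S (\<lambda>\<theta>. g (G \<theta>))"
    by (rule Henstock_Kurzweil_Integration.integral_cong) (rule pt)
  moreover have "integral S (\<lambda>\<theta>. g (G \<theta>)) = pi * arcsine_mean g a b"
    unfolding S_def integral_open_interval_real[symmetric] by (simp add: arcsine_mean_def G_def)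
  ultimately have "F absolutely_integrable_on (G ` S) \<and> integral (G ` S) F = pi * arcsine_mean g a b"
    using has_absolute_integral_change_of_variables_1'[OF _ Gd inj, of F "pi * arcsine_mean g a b"]
    by (simp add: S_def)
  then have "(F has_integral (pi * arcsine_mean g a b)) {b - 2 * a<..<b + 2 * a}"
    unfolding img using set_lebesgue_integral_eq_integral(1) by (metis integrable_integral)
  then show ?thesis unfolding has_integral_Icc_iff_Ioo F_def .
qed

text \<open>For \<open>a > 0\<close> the law has a density, so a null set in \<open>u\<close> is
  harmless. The dominating function is \<open>C\<close> times that density up to a constant,
  integrable by the substitution applied to a constant function.\<close>

lemma arcsine_mean_limit:
  fixes g :: "nat \<Rightarrow> real \<Rightarrow> real"
  assumes a: "a > 0" and g: "\<And>m. continuous_on UNIV (g m)" and bd: "\<And>m u. \<bar>g m u\<bar> \<le> C"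
    and N: "negligible N" and lim: "\<And>u. u \<notin> N \<Longrightarrow> (\<lambda>m. g m u) \<longlonglongrightarrow> h u"
  shows "(\<lambda>m. arcsine_mean (g m) a b) \<longlonglongrightarrow>
     1 / pi * integral {b - 2 * a..b + 2 * a} (\<lambda>u. h u / sqrt (4 * a\<^sup>2 - (u - b)\<^sup>2))"
proof -
  let ?I = "{b - 2 * a..b + 2 * a}"
  let ?s = "\<lambda>u. sqrt (4 * a\<^sup>2 - (u - b)\<^sup>2)"
  have "(\<lambda>m. integral ?I (\<lambda>u. g m u / ?s u)) \<longlonglongrightarrow> integral ?I (\<lambda>u. h u / ?s u)"
  proof (rule dominated_convergence_negligible(2)[OF N, where h = "\<lambda>u. C / ?s u"])
    show "(\<lambda>u. g m u / ?s u) integrable_on ?I" for m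
      using arcsine_substitution[OF a g] by blast
    show "(\<lambda>u. C / ?s u) integrable_on ?I"
      using arcsine_substitution[OF a continuous_on_const, of C b] by blast
    fix m u assume u: "u \<in> ?I - N"
    then have "\<bar>u - b\<bar> \<le> 2 * a" by auto
    then have "(u - b)\<^sup>2 \<le> (2 * a)\<^sup>2" by (metis abs_ge_zero power2_abs power_mono)
    then have "?s u \<ge> 0" by (simp add: power_mult_distrib)
    then show "\<bar>g m u / ?s u\<bar> \<le> C / ?s u" by (simp add: abs_divide divide_right_mono bd)
    \<comment> \<open>At the endpoints the denominator is 0; as a product with the fixed value
      \<open>inverse (?s u)\<close> the quotient converges there as well.\<close>
    show "(\<lambda>m. g m u / ?s u) \<longlonglongrightarrow> h u / ?s u"
      unfolding divide_inverse using u by (intro tendsto_mult lim tendsto_const) auto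
  qed
  moreover have "integral ?I (\<lambda>u. g m u / ?s u) = pi * arcsine_mean (g m) a b" for m
    by (rule integral_unique[OF arcsine_substitution[OF a g]])
  ultimately have "(\<lambda>m. 1 / pi * (pi * arcsine_mean (g m) a b)) \<longlonglongrightarrow> 1 / pi * integral ?I (\<lambda>u. h u / ?s u)"
    by (intro tendsto_mult tendsto_const) simp
  then show ?thesis by simp
qed

section \<open>Continuous envelopes of Riemann integrable functions\<close>

text \<open>Each majorant is the supremum of downward cones of slope \<open>m\<close> with apex on
  the graph of \<open>H\<close>, i.e. the least \<open>m\<close>-Lipschitz function above
  \<open>H\<close>. Cones with a distant apex become irrelevant as \<open>m\<close> grows, which
  gives convergence wherever \<open>H\<close> is continuous.\<close>

lemma lipschitz_majorants:
  fixes H :: "real \<Rightarrow> real"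
  assumes bd: "\<And>x. \<bar>H x\<bar> \<le> C"
  obtains u :: "nat \<Rightarrow> real \<Rightarrow> real" where
    "\<And>m. continuous_on UNIV (u m)" "\<And>m x. H x \<le> u m x" "\<And>m x. \<bar>u m x\<bar> \<le> C"
    "\<And>x. isCont H x \<Longrightarrow> (\<lambda>m. u m x) \<longlonglongrightarrow> H x"
proof -
  define u where "u m x = (SUP y. H y - real m * \<bar>x - y\<bar>)" for m x
  have le_C: "H y - real m * \<bar>x - y\<bar> \<le> C" for m x y
    using bd[of y] mult_nonneg_nonneg[of "real m" "\<bar>x - y\<bar>"] by linarith
  then have bdd: "bdd_above (range (\<lambda>y. H y - real m * \<bar>x - y\<bar>))" for m x
    by (auto simp: bdd_above_def)
  have ge: "H y - real m * \<bar>x - y\<bar> \<le> u m x" for m x y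
    unfolding u_def by (rule cSUP_upper[OF _ bdd]) simp
  have Hle: "H x \<le> u m x" for m x using ge[of x m x] by simp
  have ule: "u m x \<le> s" if "\<And>y. H y - real m * \<bar>x - y\<bar> \<le> s" for m x s
    unfolding u_def by (rule cSUP_least) (use that in auto)
  have step: "u m x \<le> u m x' + real m * \<bar>x - x'\<bar>" for m x x'
  proof (rule ule)
    fix y
    have "real m * \<bar>x' - y\<bar> \<le> real m * (\<bar>x - y\<bar> + \<bar>x - x'\<bar>)"
      by (rule mult_left_mono) auto
    then show "H y - real m * \<bar>x - y\<bar> \<le> u m x' + real m * \<bar>x - x'\<bar>"
      using ge[of y m x'] by (simp add: distrib_left)
  qed
  show ?thesis
  proof (rule that[of u])
    show "continuous_on UNIV (u m)" for m
    proof (rule lipschitz_on_continuous_on[of "real m"], rule lipschitz_onI)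
      fix x y
      show "dist (u m x) (u m y) \<le> real m * dist x y"
        using step[of m x y] step[of m y x] by (simp add: dist_real_def abs_minus_commute)
    qed simp
    show "H x \<le> u m x" for m x by (rule Hle)
    show "\<bar>u m x\<bar> \<le> C" for m x
      using ule[of m x C, OF le_C] Hle[of x m] bd[of x] by linarith
    fix x assume c: "isCont H x"
    show "(\<lambda>m. u m x) \<longlonglongrightarrow> H x"
    proof (rule LIMSEQ_I)
      fix e :: real assume e: "e > 0"
      then obtain r where r: "r > 0" "\<And>y. \<bar>y - x\<bar> < r \<Longrightarrow> \<bar>H y - H x\<bar> < e / 2"
        using c unfolding continuous_at_eps_delta by (metis half_gt_zero dist_real_def)
      \<comment> \<open>From this slope on, a cone with apex at distance at least \<open>r\<close>
        has dropped by \<open>2 * C\<close> and hence lies below \<open>- C\<close>, so below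
        \<open>H x\<close>.\<close>
      obtain M :: nat where M: "2 * C / r < real M" using reals_Archimedean2 by blast
      have "norm (u m x - H x) < e" if m: "m \<ge> M" for m
      proof -
        have "u m x \<le> H x + e / 2"
        proof (rule ule)
          fix y
          show "H y - real m * \<bar>x - y\<bar> \<le> H x + e / 2"
          proof (cases "\<bar>y - x\<bar> < r")
            case True
            then show ?thesis using r(2)[OF True] mult_nonneg_nonneg[of "real m" "\<bar>x - y\<bar>"] by linarith
          next
            case False
            have "2 * C \<le> real M * r" using M r by (simp add: field_simps)
            also have "\<dots> \<le> real m * \<bar>x - y\<bar>" using m False r by (intro mult_mono) auto
            finally show ?thesis using bd[of y] bd[of x] e by linarith
          qed
        qed
        then show ?thesis using Hle[of x m] e by simp
      qed
      then show "\<exists>no. \<forall>m\<ge>no. norm (u m x - H x) < e" by blast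
    qed
  qed
qed

section \<open>Oscillation of Riemann integrable functions\<close>

lemma uniform_tagged_division:
  fixes c d :: real and t :: "nat \<Rightarrow> real"
  assumes cd: "c < d" and N: "N \<ge> 1"
    and x: "x = (\<lambda>i. c + real i * ((d - c) / real N))"
    and t: "\<And>i. i < N \<Longrightarrow> t i \<in> {x i..x (Suc i)}"
  shows "(\<lambda>i. (t i, {x i..x (Suc i)})) ` {..<N} tagged_division_of {c..d}"
proof -
  have \<eta>: "(d - c) / real N > 0" using cd N by simp
  have mono: "x i \<le> x j" if "i \<le> j" for i j
    unfolding x using that \<eta> by (intro add_left_mono mult_right_mono) auto
  have xN: "x N = d" "x 0 = c" using N by (auto simp: x)
  have un: "(\<Union>i<m. {x i..x (Suc i)}) = {x 0..x m}" if "m \<ge> 1" for m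
    using that
  proof (induction m rule: dec_induct)
    case (step m)
    have "(\<Union>i<Suc m. {x i..x (Suc i)}) = {x 0..x m} \<union> {x m..x (Suc m)}"
      using step by (simp add: lessThan_Suc Un_commute)
    also have "\<dots> = {x 0..x (Suc m)}" using mono[of 0 m] mono[of m "Suc m"] by (intro ivl_disj_un_two_touch(4)) auto
    finally show ?case .
  qed (simp add: lessThan_Suc)
  show ?thesis
  proof (rule tagged_division_ofI)
    fix y J assume "(y, J) \<in> (\<lambda>i. (t i, {x i..x (Suc i)})) ` {..<N}"
    then obtain i where i: "i < N" "y = t i" "J = {x i..x (Suc i)}" by auto
    show "y \<in> J" using t i by auto
    show "J \<subseteq> {c..d}" using mono[of 0 i] mono[of "Suc i" N] i xN by auto
    show "\<exists>a b. J = cbox a b" using i by auto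
    fix y' J' assume "(y', J') \<in> (\<lambda>i. (t i, {x i..x (Suc i)})) ` {..<N}" and ne: "(y, J) \<noteq> (y', J')"
    then obtain i' where i': "i' < N" "y' = t i'" "J' = {x i'..x (Suc i')}" by auto
    have "i \<noteq> i'" using ne i i' by auto
    then have "x (Suc i) \<le> x i' \<or> x (Suc i') \<le> x i" using mono by (metis Suc_leI linorder_neqE_nat)
    then show "interior J \<inter> interior J' = {}" using i i' by auto
  next
    have "\<Union> {J. \<exists>y. (y, J) \<in> (\<lambda>i. (t i, {x i..x (Suc i)})) ` {..<N}} = (\<Union>i<N. {x i..x (Suc i)})" by auto
    then show "\<Union> {J. \<exists>y. (y, J) \<in> (\<lambda>i. (t i, {x i..x (Suc i)})) ` {..<N}} = {c..d}"
      using un[OF N] xN by simp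
  qed simp
qed

text \<open>Both Riemann sums lie within \<open>e / 2\<close> of the integral. Equispaced partitions
  are fine enough because the gauge is constant. Boundedness and the estimate of large oscillations
  are both drawn from this comparison.\<close>

lemma riemann_tag_change:
  fixes H :: "real \<Rightarrow> real"
  assumes cd: "c < d" and ri: "riemann_integrable_on_interval H c d" and e: "e > 0"
  shows "\<exists>N\<ge>1. \<exists>x. x = (\<lambda>i. c + real i * ((d - c) / real N)) \<and>
    (\<forall>s t. (\<forall>i<N. s i \<in> {x i..x (Suc i)}) \<longrightarrow> (\<forall>i<N. t i \<in> {x i..x (Suc i)}) \<longrightarrow>
        (\<Sum>i<N. (d - c) / real N * (H (t i) - H (s i))) < e)"
proof -
  obtain I where I: "\<forall>e > 0. \<exists>\<delta> > 0. \<forall>P. P tagged_division_of {c..d} \<and> (\<lambda>x. ball x \<delta>) fine P \<longrightarrow>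
        \<bar>(\<Sum>(x, J) \<in> P. measure lborel J * H x) - I\<bar> < e"
    using ri unfolding riemann_integrable_on_interval_def by blast
  obtain \<delta> where \<delta>: "\<delta> > 0" "\<And>P. P tagged_division_of {c..d} \<Longrightarrow> (\<lambda>x. ball x \<delta>) fine P \<Longrightarrow>
        \<bar>(\<Sum>(x, J) \<in> P. measure lborel J * H x) - I\<bar> < e / 2"
    using I[rule_format, of "e / 2"] e by auto
  obtain N0 :: nat where N0: "(d - c) / \<delta> < real N0" using reals_Archimedean2 by blast
  define N where "N = max 1 N0"
  have N: "N \<ge> 1" "(d - c) / real N < \<delta>"
  proof -
    have "(d - c) / \<delta> < real N" using N0 by (simp add: N_def)
    then show "(d - c) / real N < \<delta>" using \<delta>(1) by (simp add: N_def field_simps)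
  qed (simp add: N_def)
  define x where "x i = c + real i * ((d - c) / real N)" for i
  define \<eta> where "\<eta> = (d - c) / real N"
  have \<eta>: "\<eta> > 0" "\<eta> < \<delta>" using cd N by (auto simp: \<eta>_def)
  have xs: "x (Suc i) = x i + \<eta>" for i by (simp add: x_def \<eta>_def[symmetric] distrib_right)
  have strict: "strict_mono x" by (rule strict_monoI_Suc) (use xs \<eta> in simp)
  have one: "\<bar>(\<Sum>i<N. \<eta> * H (t i)) - I\<bar> < e / 2" if t: "\<And>i. i < N \<Longrightarrow> t i \<in> {x i..x (Suc i)}" for t
  proof -
    let ?P = "(\<lambda>i. (t i, {x i..x (Suc i)})) ` {..<N}"
    have "?P tagged_division_of {c..d}"
      by (rule uniform_tagged_division[OF cd N(1)]) (use t in \<open>auto simp: x_def\<close>)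
    moreover have "(\<lambda>x. ball x \<delta>) fine ?P"
    proof (rule fineI)
      fix y J assume "(y, J) \<in> ?P"
      then obtain i where i: "i < N" "y = t i" "J = {x i..x (Suc i)}" by auto
      then show "J \<subseteq> ball y \<delta>" using t[OF i(1)] \<eta> xs[of i] by (auto simp: dist_real_def)
    qed
    ultimately have "\<bar>(\<Sum>(x, J) \<in> ?P. measure lborel J * H x) - I\<bar> < e / 2" by (rule \<delta>(2))
    moreover have "inj_on (\<lambda>i. (t i, {x i..x (Suc i)})) {..<N}"
    proof (rule inj_onI)
      fix i j assume "(t i, {x i..x (Suc i)}) = (t j, {x j..x (Suc j)})"
      then have "{x i..x (Suc i)} = {x j..x (Suc j)}" by simp
      then have "x i = x j" using xs[of i] xs[of j] \<eta> by (metis Icc_eq_Icc less_add_same_cancel1 less_eq_real_def)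
      then show "i = j" using strict by (simp add: strict_mono_eq)
    qed
    ultimately show ?thesis using \<eta> by (simp add: sum.reindex xs)
  qed
  show ?thesis
  proof (intro exI[of _ N] exI[of _ x] conjI allI impI N)
    show "x = (\<lambda>i. c + real i * ((d - c) / real N))" by (auto simp: x_def)
    fix s t assume "\<forall>i<N. s i \<in> {x i..x (Suc i)}" "\<forall>i<N. t i \<in> {x i..x (Suc i)}"
    then have "\<bar>(\<Sum>i<N. \<eta> * H (s i)) - I\<bar> < e / 2" "\<bar>(\<Sum>i<N. \<eta> * H (t i)) - I\<bar> < e / 2"
      using one[of s] one[of t] by blast+
    then have "(\<Sum>i<N. \<eta> * H (t i)) - (\<Sum>i<N. \<eta> * H (s i)) < e" by linarith
    then show "(\<Sum>i<N. (d - c) / real N * (H (t i) - H (s i))) < e"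
      by (simp add: \<eta>_def sum_subtractf right_diff_distrib)
  qed
qed

lemma uniform_partition_cover:
  fixes c d y :: real
  assumes cd: "c < d" and N: "N \<ge> 1" and x: "x = (\<lambda>i. c + real i * ((d - c) / real N))" and y: "y \<in> {c..d}"
  obtains i where "i < N" "y \<in> {x i..x (Suc i)}"
proof -
  have ne: "x i \<in> {x i..x (Suc i)}" for i using cd N by (auto simp: x field_simps)
  have "y \<in> \<Union> {J. \<exists>t. (t, J) \<in> (\<lambda>i. (x i, {x i..x (Suc i)})) ` {..<N}}"
    using tagged_division_ofD(6)[OF uniform_tagged_division[OF cd N x, of x]] ne y by blast
  then show thesis using that by auto
qed

text \<open>Moving a single tag inside its cell changes the Riemann sum by less than 1, so values in
  one cell differ by less than the reciprocal of the cell length. Finitely many left endpoints then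
  control all values.\<close>

lemma riemann_integrable_bounded:
  fixes H :: "real \<Rightarrow> real"
  assumes cd: "c < d" and ri: "riemann_integrable_on_interval H c d"
  obtains C where "\<And>y. y \<in> {c..d} \<Longrightarrow> \<bar>H y\<bar> \<le> C"
proof -
  obtain N x where N: "N \<ge> 1" and x: "x = (\<lambda>i. c + real i * ((d - c) / real N))"
    and tag: "\<forall>s t. (\<forall>i<N. s i \<in> {x i..x (Suc i)}) \<longrightarrow> (\<forall>i<N. t i \<in> {x i..x (Suc i)}) \<longrightarrow>
        (\<Sum>i<N. (d - c) / real N * (H (t i) - H (s i))) < 1"
    using riemann_tag_change[OF cd ri zero_less_one] by blast
  define \<eta> where "\<eta> = (d - c) / real N"
  have \<eta>: "\<eta> > 0" using cd N by (simp add: \<eta>_def)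
  have ne: "x i \<in> {x i..x (Suc i)}" for i using cd N by (auto simp: x field_simps)
  have upd: "(\<Sum>i<N. \<eta> * (H (if i = j then p else x i) - H (if i = j then q else x i))) = \<eta> * (H p - H q)"
    if "j < N" for j p q
  proof -
    have "(\<Sum>i<N. \<eta> * (H (if i = j then p else x i) - H (if i = j then q else x i)))
       = (\<Sum>i<N. if i = j then \<eta> * (H p - H q) else 0)" by (intro sum.cong refl) auto
    then show ?thesis using that by simp
  qed
  have diff: "\<eta> * (H p - H q) < 1" if "j < N" "p \<in> {x j..x (Suc j)}" "q \<in> {x j..x (Suc j)}" for j p q
  proof -
    have "(\<Sum>i<N. \<eta> * (H (if i = j then p else x i) - H (if i = j then q else x i))) < 1"
      unfolding \<eta>_def by (rule tag[rule_format]) (use ne that in auto)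
    then show ?thesis unfolding upd[OF that(1)] .
  qed
  define C where "C = (\<Sum>i<N. \<bar>H (x i)\<bar>) + 1 / \<eta>"
  show thesis
  proof (rule that[of C])
    fix y assume "y \<in> {c..d}"
    then obtain j where j: "j < N" "y \<in> {x j..x (Suc j)}" using uniform_partition_cover[OF cd N x] by blast
    have "H y - H (x j) < 1 / \<eta>" "H (x j) - H y < 1 / \<eta>"
      using diff[OF j ne] diff[OF j(1) ne j(2)] \<eta> by (auto simp: field_simps)
    moreover have "\<bar>H (x j)\<bar> \<le> (\<Sum>i<N. \<bar>H (x i)\<bar>)"
      by (rule member_le_sum) (use j in auto)
    ultimately show "\<bar>H y\<bar> \<le> C" unfolding C_def by linarith
  qed
qed

text \<open>Riemann sums whose tags differ only in the subintervals of large oscillation bound the total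
  length of these subintervals.\<close>

lemma riemann_integrable_large_oscillation:
  fixes H :: "real \<Rightarrow> real"
  assumes cd: "c < d" and ri: "riemann_integrable_on_interval H c d" and k: "\<kappa> > 0"
  shows "negligible {y \<in> {c<..<d}. \<forall>r>0. \<exists>p\<in>ball y r. \<exists>q\<in>ball y r. H p - H q > \<kappa>}"
proof (rule negligible_outer_le[THEN iffD2], intro allI impI)
  fix e :: real assume e: "e > 0"
  \<comment> \<open>The tolerance is \<open>e * \<kappa>\<close> because each cell of large
    oscillation contributes more than \<kappa> times its length.\<close>
  obtain N x where N: "N \<ge> 1" and x: "x = (\<lambda>i. c + real i * ((d - c) / real N))"
    and tag: "\<forall>s t. (\<forall>i<N. s i \<in> {x i..x (Suc i)}) \<longrightarrow> (\<forall>i<N. t i \<in> {x i..x (Suc i)}) \<longrightarrow>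
        (\<Sum>i<N. (d - c) / real N * (H (t i) - H (s i))) < e * \<kappa>"
    using riemann_tag_change[OF cd ri mult_pos_pos[OF e k]] by blast
  define \<eta> where "\<eta> = (d - c) / real N"
  have \<eta>: "\<eta> > 0" using cd N by (simp add: \<eta>_def)
  have xs: "x (Suc i) = x i + \<eta>" for i by (simp add: x \<eta>_def[symmetric] distrib_right)
  define bad where "bad = {i. i < N \<and> (\<exists>p\<in>{x i..x (Suc i)}. \<exists>q\<in>{x i..x (Suc i)}. H p - H q > \<kappa>)}"
  have fin: "finite bad" unfolding bad_def by simp
  have "\<forall>i\<in>bad. \<exists>p q. p \<in> {x i..x (Suc i)} \<and> q \<in> {x i..x (Suc i)} \<and> H p - H q > \<kappa>"
    unfolding bad_def by blast
  then obtain p q where pq: "\<And>i. i \<in> bad \<Longrightarrow> p i \<in> {x i..x (Suc i)} \<and> q i \<in> {x i..x (Suc i)} \<and> H (p i) - H (q i) > \<kappa>"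
    by metis
  have "(\<Sum>i<N. \<eta> * (H (if i \<in> bad then p i else x i) - H (if i \<in> bad then q i else x i))) < e * \<kappa>"
    unfolding \<eta>_def by (rule tag[rule_format]) (use pq xs \<eta> in auto)
  moreover have "(\<Sum>i<N. \<eta> * (H (if i \<in> bad then p i else x i) - H (if i \<in> bad then q i else x i)))
     = (\<Sum>i\<in>bad. \<eta> * (H (p i) - H (q i)))"
    by (rule sum.mono_neutral_cong_right) (auto simp: bad_def)
  moreover have "(\<Sum>i\<in>bad. \<eta> * (H (p i) - H (q i))) \<ge> (\<Sum>i\<in>bad. \<eta> * \<kappa>)"
    by (rule sum_mono) (use pq \<eta> in \<open>auto intro!: mult_left_mono less_imp_le\<close>)
  ultimately have "(real (card bad) * \<eta>) * \<kappa> < e * \<kappa>" by simp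
  then have small: "real (card bad) * \<eta> < e" using k by simp
  \<comment> \<open>The partition points are added because the argument for a point \<open>y\<close>
    needs a ball around \<open>y\<close> inside a single cell.\<close>
  define T where "T = x ` {..N} \<union> (\<Union>i\<in>bad. {x i..x (Suc i)})"
  have T: "T \<in> lmeasurable" unfolding T_def using fin
    by (intro fmeasurable.Un fmeasurable.finite_UN) (auto simp: lmeasurable_interval finite_imp_bounded intro: negligible_imp_measurable)
  have "measure lebesgue T \<le> measure lebesgue (x ` {..N}) + measure lebesgue (\<Union>i\<in>bad. {x i..x (Suc i)})"
    unfolding T_def by (rule measure_Un_le) (use fin in \<open>auto intro!: negligible_imp_sets simp: negligible_finite\<close>)
  also have "measure lebesgue (x ` {..N}) = 0" by (rule negligible_imp_measure0) (simp add: negligible_finite)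
  also have "measure lebesgue (\<Union>i\<in>bad. {x i..x (Suc i)}) \<le> (\<Sum>i\<in>bad. measure lebesgue {x i..x (Suc i)})"
    by (rule measure_UNION_le) (use fin in auto)
  also have "(\<Sum>i\<in>bad. measure lebesgue {x i..x (Suc i)}) = real (card bad) * \<eta>" using \<eta> by (simp add: xs)
  finally have mT: "measure lebesgue T \<le> e" using small by simp
  have "y \<in> T" if y: "y \<in> {c<..<d}" and osc: "\<forall>r>0. \<exists>p\<in>ball y r. \<exists>q\<in>ball y r. H p - H q > \<kappa>" for y
  proof -
    have "y \<in> {c..d}" using y by auto
    then obtain i where i: "i < N" "y \<in> {x i..x (Suc i)}" using uniform_partition_cover[OF cd N x] by blast
    show ?thesis
    proof (cases "y = x i \<or> y = x (Suc i)")
      case True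
      then show ?thesis using i by (auto simp: T_def)
    next
      case False
      define r where "r = min (y - x i) (x (Suc i) - y)"
      have "r > 0" using False i by (auto simp: r_def)
      then obtain p q where pq: "p \<in> ball y r" "q \<in> ball y r" "H p - H q > \<kappa>" using osc by blast
      moreover have "ball y r \<subseteq> {x i..x (Suc i)}" by (auto simp: r_def dist_real_def)
      ultimately have "i \<in> bad" using i unfolding bad_def by blast
      then show ?thesis using i by (auto simp: T_def)
    qed
  qed
  then show "\<exists>T. {y \<in> {c<..<d}. \<forall>r>0. \<exists>p\<in>ball y r. \<exists>q\<in>ball y r. H p - H q > \<kappa>} \<subseteq> T \<and> T \<in> lmeasurable \<and> measure lebesgue T \<le> e"
    using T mT by blast
qed

text \<open>One half of Lebesgue's criterion: at a discontinuity the oscillation exceeds 1/(k+1) in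
  every ball for some k, and the union over k is countable.\<close>

lemma riemann_integrable_continuous_ae:
  fixes H :: "real \<Rightarrow> real"
  assumes cd: "c < d" and ri: "riemann_integrable_on_interval H c d"
  shows "negligible {y \<in> {c<..<d}. \<not> isCont H y}"
proof (rule negligible_subset)
  let ?D = "\<lambda>\<kappa>. {y \<in> {c<..<d}. \<forall>r>0. \<exists>p\<in>ball y r. \<exists>q\<in>ball y r. H p - H q > \<kappa>}"
  show "negligible (\<Union>k::nat. ?D (1 / real (Suc k)))"
    by (intro negligible_Union_nat riemann_integrable_large_oscillation[OF cd ri]) simp
  show "{y \<in> {c<..<d}. \<not> isCont H y} \<subseteq> (\<Union>k::nat. ?D (1 / real (Suc k)))"
  proof
    fix y assume y: "y \<in> {y \<in> {c<..<d}. \<not> isCont H y}"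
    then obtain e where e: "e > 0" and ne: "\<And>r. r > 0 \<Longrightarrow> \<exists>p. dist p y < r \<and> \<not> dist (H p) (H y) < e"
      unfolding continuous_at_eps_delta by (auto simp: dist_real_def)
    obtain k :: nat where k: "1 / real (Suc k) < e" using e by (metis nat_approx_posE)
    have "\<exists>p\<in>ball y r. \<exists>q\<in>ball y r. H p - H q > 1 / real (Suc k)" if r: "r > 0" for r
    proof -
      obtain p where p: "dist p y < r" "\<not> dist (H p) (H y) < e" using ne[OF r] by blast
      then have m: "p \<in> ball y r" "y \<in> ball y r" using r by (auto simp: dist_commute)
      have "H p - H y > 1 / real (Suc k) \<or> H y - H p > 1 / real (Suc k)"
        using p(2) k by (auto simp: dist_real_def)
      then show ?thesis using m by blast
    qed
    then show "y \<in> (\<Union>k::nat. ?D (1 / real (Suc k)))" using y by blast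
  qed
qed

text \<open>Continuous functions squeezing the test function, extended by zero, carry weak
  convergence over to it. The minorants are negatives of majorants of the negated function.\<close>

lemma riemann_integrable_on_envelopes:
  fixes h :: "real \<Rightarrow> real"
  assumes "h riemann_integrable_on S"
  obtains l u :: "nat \<Rightarrow> real \<Rightarrow> real" and N C where
    "\<And>m. continuous_on UNIV (l m)" "\<And>m. continuous_on UNIV (u m)"
    "\<And>m x. l m x \<le> indicator S x * h x" "\<And>m x. indicator S x * h x \<le> u m x"
    "\<And>m x. \<bar>l m x\<bar> \<le> C" "\<And>m x. \<bar>u m x\<bar> \<le> C" "negligible N"
    "\<And>x. x \<notin> N \<Longrightarrow> (\<lambda>m. l m x) \<longlonglongrightarrow> indicator S x * h x"
    "\<And>x. x \<notin> N \<Longrightarrow> (\<lambda>m. u m x) \<longlonglongrightarrow> indicator S x * h x"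
proof -
  define H where "H x = indicator S x * h x" for x
  obtain c d where S: "S \<subseteq> {c..d}" and ri: "riemann_integrable_on_interval H c d"
    using assms unfolding riemann_integrable_on_def H_def by blast
  have H0: "H x = 0" if "x \<notin> {c..d}" for x using that S by (auto simp: H_def indicator_def)
  obtain C where C: "\<And>x. \<bar>H x\<bar> \<le> C"
  proof (cases "c < d")
    case True
    obtain C where "\<And>y. y \<in> {c..d} \<Longrightarrow> \<bar>H y\<bar> \<le> C" using riemann_integrable_bounded[OF True ri] by blast
    then have "\<bar>H y\<bar> \<le> max C 0" for y using H0[of y] by (cases "y \<in> {c..d}") (auto simp: le_max_iff_disj)
    then show ?thesis by (rule that)
  next
    case False
    then have "y = c" if "y \<in> {c..d}" for y using that by auto
    then have "\<bar>H y\<bar> \<le> \<bar>H c\<bar>" for y using H0[of y] by (cases "y \<in> {c..d}") auto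
    then show ?thesis by (rule that)
  qed
  define N where "N = {y. \<not> isCont H y}"
  \<comment> \<open>Outside [c, d] the extended function vanishes in a neighbourhood, and the two
    endpoints, where continuity may fail, form a null set.\<close>
  have "N \<subseteq> {c, d} \<union> {y \<in> {c<..<d}. \<not> isCont H y}"
  proof
    fix y assume y: "y \<in> N"
    have "isCont H y" if "y \<notin> {c..d}"
    proof -
      have "open (- {c..d})" by auto
      then have "\<forall>\<^sub>F z in nhds y. z \<in> - {c..d}" using that by (intro eventually_nhds_in_open) auto
      then have "\<forall>\<^sub>F z in nhds y. H z = 0" by eventually_elim (use H0 in auto)
      then show ?thesis by (subst isCont_cong) auto
    qed
    then show "y \<in> {c, d} \<union> {y \<in> {c<..<d}. \<not> isCont H y}" using y by (force simp: N_def)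
  qed
  moreover have "negligible ({c, d} \<union> {y \<in> {c<..<d}. \<not> isCont H y})"
  proof (cases "c < d")
    case True
    then show ?thesis by (intro negligible_Un riemann_integrable_continuous_ae[OF _ ri]) (auto simp: negligible_finite)
  next
    case False
    then have e: "{y \<in> {c<..<d}. \<not> isCont H y} = {}" by auto
    show ?thesis unfolding e by (simp add: negligible_finite)
  qed
  ultimately have N: "negligible N" by (rule negligible_subset[rotated])
  obtain u where u: "\<And>m. continuous_on UNIV (u m)" "\<And>m x. H x \<le> u m x" "\<And>m x. \<bar>u m x\<bar> \<le> C"
    "\<And>x. isCont H x \<Longrightarrow> (\<lambda>m. u m x) \<longlonglongrightarrow> H x"
    using lipschitz_majorants[of H C, OF C] by metis
  have C': "\<bar>- H x\<bar> \<le> C" for x using C by simp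
  obtain l where l: "\<And>m. continuous_on UNIV (l m)" "\<And>m x. - H x \<le> l m x" "\<And>m x. \<bar>l m x\<bar> \<le> C"
    "\<And>x. isCont (\<lambda>x. - H x) x \<Longrightarrow> (\<lambda>m. l m x) \<longlonglongrightarrow> - H x"
    using lipschitz_majorants[of "\<lambda>x. - H x" C, OF C'] by metis
  show thesis
  proof (rule that[of "\<lambda>m x. - l m x" u C N])
    show "continuous_on UNIV (\<lambda>x. - l m x)" for m using l(1) by (intro continuous_intros)
    show "- l m x \<le> indicator S x * h x" for m x using l(2)[of x m] by (simp add: H_def)
    show "\<bar>- l m x\<bar> \<le> C" for m x using l(3) by simp
    show "(\<lambda>m. - l m x) \<longlonglongrightarrow> indicator S x * h x" if "x \<notin> N" for x
    proof -
      have "isCont (\<lambda>x. - H x) x" using that unfolding N_def by (intro continuous_intros) auto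
      from tendsto_minus[OF l(4)[OF this]] show ?thesis by (simp add: H_def)
    qed
    show "(\<lambda>m. u m x) \<longlonglongrightarrow> indicator S x * h x" if "x \<notin> N" for x
      using u(4)[of x] that by (simp add: N_def H_def)
  qed (use u N in \<open>auto simp: H_def\<close>)
qed

section \<open>Almost sure convergence of moments\<close>

text \<open>The series of the \<open>Z n\<close>, from some index on, has finite expectation, so it
  converges almost surely and its terms tend to 0. Joint laws of different \<open>Z n\<close> do not
  enter.\<close>

lemma AE_tendsto_0_of_summable_integrals:
  fixes Z :: "nat \<Rightarrow> 'w \<Rightarrow> real"
  assumes meas: "\<And>n. n \<ge> 1 \<Longrightarrow> Z n \<in> borel_measurable M" and nn: "\<And>n \<omega>. Z n \<omega> \<ge> 0"
    and le: "\<forall>\<^sub>F n in sequentially. (\<integral>\<^sup>+ \<omega>. ennreal (Z n \<omega>) \<partial>M) \<le> ennreal (e n)"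
    and e: "summable e" "\<And>n. e n \<ge> 0"
  shows "AE \<omega> in M. (\<lambda>n. Z n \<omega>) \<longlonglongrightarrow> 0"
proof -
  from le eventually_ge_at_top[of 1]
  have "\<forall>\<^sub>F n in sequentially. n \<ge> 1 \<and> (\<integral>\<^sup>+ \<omega>. ennreal (Z n \<omega>) \<partial>M) \<le> ennreal (e n)"
    by eventually_elim auto
  then obtain N where N: "\<And>n. n \<ge> N \<Longrightarrow> n \<ge> 1 \<and> (\<integral>\<^sup>+ \<omega>. ennreal (Z n \<omega>) \<partial>M) \<le> ennreal (e n)"
    unfolding eventually_sequentially by auto
  have m: "(\<lambda>\<omega>. ennreal (Z (n + N) \<omega>)) \<in> borel_measurable M" for n
    using meas[of "n + N"] N[of "n + N"] by simp
  have se: "summable (\<lambda>n. e (n + N))" using e(1) by (simp add: summable_iff_shift)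
  have "(\<integral>\<^sup>+ \<omega>. (\<Sum>n. ennreal (Z (n + N) \<omega>)) \<partial>M) = (\<Sum>n. \<integral>\<^sup>+ \<omega>. ennreal (Z (n + N) \<omega>) \<partial>M)"
    by (rule nn_integral_suminf[OF m])
  also have "\<dots> \<le> (\<Sum>n. ennreal (e (n + N)))"
    by (rule suminf_le) (use N in auto)
  also have "\<dots> < \<infinity>" using e se by (simp add: suminf_ennreal2)
  finally have fin: "(\<integral>\<^sup>+ \<omega>. (\<Sum>n. ennreal (Z (n + N) \<omega>)) \<partial>M) \<noteq> \<infinity>" by simp
  have "AE \<omega> in M. (\<Sum>n. ennreal (Z (n + N) \<omega>)) \<noteq> \<infinity>"
    by (rule nn_integral_PInf_AE[OF _ fin]) (use m in measurable)
  then show ?thesis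
  proof eventually_elim
    case (elim \<omega>)
    then have "summable (\<lambda>n. Z (n + N) \<omega>)" using nn by (intro summable_suminf_not_top) auto
    then have "(\<lambda>n. Z (n + N) \<omega>) \<longlonglongrightarrow> 0" by (rule summable_LIMSEQ_zero)
    then show ?case by (rule LIMSEQ_offset)
  qed
qed

text \<open>The points take values in a countable set, on which every \<open>g\<close> is
  measurable.\<close>

lemma linear_statistic_measurable:
  assumes n: "n \<ge> 1" and pmf: "has_joint_pmf_proportional_to M n X D"
  shows "linear_statistic n X g \<in> borel_measurable M"
proof -
  have "(\<lambda>\<omega>. g (X j \<omega>)) \<in> borel_measurable M" if "j \<in> {1..n}" for j
  proof -
    have "X j \<in> measurable M (count_space (lattice n))"
      using pmf that by (intro measurable_lattice_valued) (auto simp: has_joint_pmf_proportional_to_def)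
    moreover have "g \<in> measurable (count_space (lattice n)) borel" by simp
    ultimately show ?thesis by (rule measurable_compose)
  qed
  then show ?thesis unfolding linear_statistic_def by (intro borel_measurable_sum)
qed

text \<open>The decay \<open>n powr (- \<epsilon>)\<close> alone need not be summable; division by
  \<open>n\<close> makes the exponent smaller than -1 and the expectations summable.\<close>

lemma AE_tail_tendsto_0:
  fixes g :: "nat \<Rightarrow> real \<Rightarrow> real"
  assumes pmf: "\<And>n. n \<ge> 1 \<Longrightarrow> has_joint_pmf_proportional_to M n (X n) (D n)"
    and g: "\<And>n x. g n x \<ge> 0" and \<epsilon>: "\<epsilon> > 0"
    and le: "\<forall>\<^sub>F n in sequentially. (\<integral>\<^sup>+ \<omega>. ennreal (linear_statistic n (X n) (g n) \<omega>) \<partial>M) \<le> ennreal (C * real n powr (- \<epsilon>))"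
  shows "AE \<omega> in M. (\<lambda>n. linear_statistic n (X n) (g n) \<omega> / real n) \<longlonglongrightarrow> 0"
proof (rule AE_tendsto_0_of_summable_integrals[where e = "\<lambda>n. \<bar>C\<bar> * real n powr (- 1 - \<epsilon>)"])
  show "\<forall>\<^sub>F n in sequentially. (\<integral>\<^sup>+ \<omega>. ennreal (linear_statistic n (X n) (g n) \<omega> / real n) \<partial>M)
      \<le> ennreal (\<bar>C\<bar> * real n powr (- 1 - \<epsilon>))"
    using le eventually_ge_at_top[of 1]
  proof eventually_elim
    case (elim n)
    have [measurable]: "linear_statistic n (X n) (g n) \<in> borel_measurable M"
      by (rule linear_statistic_measurable[OF elim(2) pmf[OF elim(2)]])
    have "(\<integral>\<^sup>+ \<omega>. ennreal (linear_statistic n (X n) (g n) \<omega> / real n) \<partial>M)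
       = (\<integral>\<^sup>+ \<omega>. ennreal (1 / real n) * ennreal (linear_statistic n (X n) (g n) \<omega>) \<partial>M)"
      by (intro nn_integral_cong) (simp add: ennreal_mult'[symmetric])
    also have "\<dots> = ennreal (1 / real n) * (\<integral>\<^sup>+ \<omega>. ennreal (linear_statistic n (X n) (g n) \<omega>) \<partial>M)"
      by (rule nn_integral_cmult) measurable
    also have "\<dots> \<le> ennreal (1 / real n) * ennreal (C * real n powr (- \<epsilon>))"
      by (rule mult_left_mono[OF elim(1)]) simp
    also have "\<dots> \<le> ennreal (1 / real n) * ennreal (\<bar>C\<bar> * real n powr (- \<epsilon>))"
      by (intro mult_left_mono ennreal_leI mult_right_mono) auto
    also have "\<dots> = ennreal (\<bar>C\<bar> * real n powr (- 1 - \<epsilon>))"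
    proof -
      have "real n powr (- 1 - \<epsilon>) = 1 / real n * real n powr (- \<epsilon>)"
        using elim(2) by (simp add: powr_diff powr_minus field_simps)
      then show ?thesis by (simp add: ennreal_mult'[symmetric] mult_ac)
    qed
    finally show ?case .
  qed
  show "summable (\<lambda>n. \<bar>C\<bar> * real n powr (- 1 - \<epsilon>))"
    by (intro summable_mult) (use \<epsilon> in \<open>simp add: summable_real_powr_iff\<close>)
  show "(\<lambda>\<omega>. linear_statistic n (X n) (g n) \<omega> / real n) \<in> borel_measurable M" if "n \<ge> 1" for n
    using linear_statistic_measurable[OF that pmf[OF that]] by measurable
  show "linear_statistic n (X n) (g n) \<omega> / real n \<ge> 0" for n \<omega>
    unfolding linear_statistic_def by (intro divide_nonneg_nonneg sum_nonneg g) simp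
qed simp

text \<open>A bounded variance of the sums turns into the summable bound C/n^2 for the averages. It
  is the squares of the centred averages that are shown to tend to 0.\<close>

lemma AE_average_tendsto:
  fixes g :: "nat \<Rightarrow> real \<Rightarrow> real"
  assumes pmf: "\<And>n. n \<ge> 1 \<Longrightarrow> has_joint_pmf_proportional_to M n (X n) (D n)"
    and le: "\<forall>\<^sub>F n in sequentially. (\<integral>\<^sup>+ \<omega>. ennreal ((linear_statistic n (X n) (g n) \<omega> - m n)\<^sup>2) \<partial>M) \<le> ennreal C"
    and m: "(\<lambda>n. m n / real n) \<longlonglongrightarrow> l"
  shows "AE \<omega> in M. (\<lambda>n. linear_statistic n (X n) (g n) \<omega> / real n) \<longlonglongrightarrow> l"
proof -
  let ?Z = "\<lambda>n \<omega>. ((linear_statistic n (X n) (g n) \<omega> - m n) / real n)\<^sup>2"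
  have "AE \<omega> in M. (\<lambda>n. ?Z n \<omega>) \<longlonglongrightarrow> 0"
  proof (rule AE_tendsto_0_of_summable_integrals[where e = "\<lambda>n. \<bar>C\<bar> * (1 / real n ^ 2)"])
    show meas: "?Z n \<in> borel_measurable M" if "n \<ge> 1" for n
      using linear_statistic_measurable[OF that pmf[OF that]] by measurable
    show "\<forall>\<^sub>F n in sequentially. (\<integral>\<^sup>+ \<omega>. ennreal (?Z n \<omega>) \<partial>M) \<le> ennreal (\<bar>C\<bar> * (1 / real n ^ 2))"
      using le eventually_ge_at_top[of 1]
    proof eventually_elim
      case (elim n)
      have [measurable]: "linear_statistic n (X n) (g n) \<in> borel_measurable M"
        by (rule linear_statistic_measurable[OF elim(2) pmf[OF elim(2)]])
      have "(\<integral>\<^sup>+ \<omega>. ennreal (?Z n \<omega>) \<partial>M)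
         = (\<integral>\<^sup>+ \<omega>. ennreal (1 / real n ^ 2) * ennreal ((linear_statistic n (X n) (g n) \<omega> - m n)\<^sup>2) \<partial>M)"
        by (intro nn_integral_cong) (simp add: ennreal_mult'[symmetric] power_divide)
      also have "\<dots> = ennreal (1 / real n ^ 2) * (\<integral>\<^sup>+ \<omega>. ennreal ((linear_statistic n (X n) (g n) \<omega> - m n)\<^sup>2) \<partial>M)"
        by (rule nn_integral_cmult) measurable
      also have "\<dots> \<le> ennreal (1 / real n ^ 2) * ennreal C"
        by (rule mult_left_mono[OF elim(1)]) simp
      also have "\<dots> \<le> ennreal (1 / real n ^ 2) * ennreal \<bar>C\<bar>"
        by (intro mult_left_mono ennreal_leI) auto
      also have "\<dots> = ennreal (\<bar>C\<bar> * (1 / real n ^ 2))"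
        by (simp add: ennreal_mult'[symmetric] mult_ac)
      finally show ?case .
    qed
    show "summable (\<lambda>n. \<bar>C\<bar> * (1 / real n ^ 2))"
      by (intro summable_mult) (use inverse_power_summable[of 2, where ?'a = real] in \<open>simp add: inverse_eq_divide\<close>)
  qed auto
  then show ?thesis
  proof eventually_elim
    case (elim \<omega>)
    then have "(\<lambda>n. (linear_statistic n (X n) (g n) \<omega> - m n) / real n) \<longlonglongrightarrow> 0"
      using tendsto_real_sqrt[OF elim] by (simp add: tendsto_rabs_zero_iff)
    from tendsto_add[OF this m] show ?case by (simp add: diff_divide_distrib)
  qed
qed

lemma
  fixes \<nu> w :: "nat \<Rightarrow> int \<Rightarrow> real"
  assumes w: "\<And>n y. n \<ge> 1 \<Longrightarrow> w n y \<ge> 0"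
    and mom: "\<And>n k. n \<ge> 1 \<Longrightarrow> (\<lambda>y. \<bar>\<nu> n y\<bar> ^ k * w n y) summable_on UNIV"
    and supp: "\<And>n. n \<ge> 1 \<Longrightarrow> infinite (weight_support (w n)) \<or> n \<le> card (weight_support (w n))"
    and on: "\<And>n. n \<ge> 1 \<Longrightarrow> orthonormal_polynomials (\<nu> n) (w n) (p n)"
    and rc: "\<And>n. n \<ge> 1 \<Longrightarrow> recurrence_coefficients (\<nu> n) (w n) (p n) (A n) (B n)"
    and A: "\<And>\<xi>. \<xi> \<in> {0..1} \<Longrightarrow> ((\<lambda>(n, j). A n j) \<longlongrightarrow> a \<xi>) (ratio_filter (\<lambda>n. a_indices (w n)) \<xi>)"
    and B: "\<And>\<xi>. \<xi> \<in> {0..1} \<Longrightarrow> ((\<lambda>(n, j). B n j) \<longlongrightarrow> b \<xi>) (ratio_filter (\<lambda>n. ortho_orders (w n)) \<xi>)"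
  shows jacobi_mean_limit: "(\<lambda>n. (\<Sum>j<n. jacobi_power (\<nu> n) (w n) (p n) k j j) / real n)
      \<longlonglongrightarrow> integral {0..1} (\<lambda>\<xi>. arcsine_mean (\<lambda>u. u ^ k) (a \<xi>) (b \<xi>))"
    and jacobi_variance_bound: "\<exists>C. \<forall>\<^sub>F n in sequentially.
      (\<Sum>j<n. jacobi_power (\<nu> n) (w n) (p n) (2 * k) j j - (\<Sum>i<n. (jacobi_power (\<nu> n) (w n) (p n) k i j)\<^sup>2)) \<le> C"
proof -
  let ?c = "\<lambda>n. jacobi_power (\<nu> n) (w n) (p n)"
  let ?al = "\<lambda>n. trunc_a (w n) (A n)" and ?be = "\<lambda>n. trunc_b (w n) (B n)"
  have ord: "j \<in> ortho_orders (w n)" if "n \<ge> 1" "j < n" for n j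
    using supp[OF that(1)] that(2) by (auto simp: ortho_orders_def)
  have c0: "?c n 0 i j = (if i = j \<and> j \<in> ortho_orders (w n) then 1 else 0)" if "n \<ge> 1" for n i j
    by (rule jacobi_power_0[OF mom[OF that] w[OF that] on[OF that]])
  have c1: "?c n (Suc k) i j = ?al n j * ?c n k i (Suc j) + ?be n j * ?c n k i j
     + (if j = 0 then 0 else ?al n (j - 1) * ?c n k i (j - 1))" if "n \<ge> 1" for n k i j
    by (rule jacobi_power_Suc[OF mom[OF that] w[OF that] rc[OF that]])
  obtain C1 C2 where C1: "\<forall>\<^sub>F n in sequentially. \<forall>j\<in>a_indices (w n). j \<le> n + 2 * k \<longrightarrow> \<bar>A n j\<bar> \<le> C1"
    and C2: "\<forall>\<^sub>F n in sequentially. \<forall>j\<in>ortho_orders (w n). j \<le> n + 2 * k \<longrightarrow> \<bar>B n j\<bar> \<le> C2"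
    using ratio_filter_uniform_bound[OF A, of "2 * k"] ratio_filter_uniform_bound[OF B, of "2 * k"] by auto
  \<comment> \<open>The maximum with 0 covers the indices at which the truncated coefficients are
    0.\<close>
  define C where "C = max 0 (max C1 C2)"
  have bd: "\<forall>\<^sub>F n in sequentially. n \<ge> 1 \<and> (\<forall>j\<le>n + 2 * k. \<bar>?al n j\<bar> \<le> C \<and> \<bar>?be n j\<bar> \<le> C)"
    using C1 C2 eventually_ge_at_top[of 1]
  proof eventually_elim
    case (elim n)
    have "\<bar>?al n j\<bar> \<le> C \<and> \<bar>?be n j\<bar> \<le> C" if "j \<le> n + 2 * k" for j
      using elim(1,2) that by (auto simp: trunc_a_def trunc_b_def C_def le_max_iff_disj)
    then show ?case using elim by auto
  qed
  have "\<forall>\<^sub>F n in sequentially. (\<Sum>j<n. ?c n (2 * k) j j - (\<Sum>i<n. (?c n k i j)\<^sup>2)) \<le> real k * (3 * C) ^ (2 * k)"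
    using bd
  proof eventually_elim
    case (elim n)
    show ?case
      by (rule tridiagonal_variance_bound[where c = "?c n" and al = "?al n" and be = "?be n"])
        (use elim c0 c1 ord in \<open>auto intro: jacobi_power_sym\<close>)
  qed
  then show "\<exists>C. \<forall>\<^sub>F n in sequentially. (\<Sum>j<n. ?c n (2 * k) j j - (\<Sum>i<n. (?c n k i j)\<^sup>2)) \<le> C" by blast
  have cb: "\<forall>\<^sub>F n in sequentially. \<forall>j<n. \<bar>?c n k j j\<bar> \<le> (3 * C) ^ k"
    using bd
  proof eventually_elim
    case (elim n)
    show ?case
    proof (intro allI impI)
      fix j assume "j < n"
      then show "\<bar>?c n k j j\<bar> \<le> (3 * C) ^ k"
        by (intro tridiagonal_power_bound[where c = "?c n" and al = "?al n" and be = "?be n" and N = "n + 2 * k"])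
          (use elim c0 c1 in auto)
    qed
  qed
  \<comment> \<open>Since \<xi> < 1, eventually \<open>Suc (j n) < n\<close>; at such indices the
    coefficients exist and truncation changes nothing.\<close>
  have al: "(\<lambda>n. ?al n (j n)) \<longlonglongrightarrow> a \<xi>" and be: "(\<lambda>n. ?be n (j n)) \<longlonglongrightarrow> b \<xi>"
    if \<xi>: "0 < \<xi>" "\<xi> < 1" and j: "(\<lambda>n. real (j n) / real n) \<longlonglongrightarrow> \<xi>" for \<xi> j
  proof -
    have "(\<lambda>n. real (j n) / real n + 1 / real n) \<longlonglongrightarrow> \<xi> + 0" by (intro tendsto_add j lim_const_over_n)
    then have "\<forall>\<^sub>F n in sequentially. real (j n) / real n + 1 / real n < 1"
      using \<xi> by (intro order_tendstoD(2)) auto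
    then have lt: "\<forall>\<^sub>F n in sequentially. n \<ge> 1 \<and> Suc (j n) < n"
      using eventually_ge_at_top[of 1] by eventually_elim (simp add: field_simps)
    have ai: "\<forall>\<^sub>F n in sequentially. j n \<in> a_indices (w n)"
      using lt by eventually_elim (auto simp: a_indices_def intro: ord)
    have bi: "\<forall>\<^sub>F n in sequentially. j n \<in> ortho_orders (w n)"
      using lt by eventually_elim (auto intro: ord)
    have "(\<lambda>n. A n (j n)) \<longlonglongrightarrow> a \<xi>" by (rule ratio_filter_tendsto_sequence[OF A j ai]) (use \<xi> in auto)
    then show "(\<lambda>n. ?al n (j n)) \<longlonglongrightarrow> a \<xi>"
      by (rule Lim_transform_eventually) (use ai in eventually_elim, simp add: trunc_a_def)
    have "(\<lambda>n. B n (j n)) \<longlonglongrightarrow> b \<xi>" by (rule ratio_filter_tendsto_sequence[OF B j bi]) (use \<xi> in auto)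
    then show "(\<lambda>n. ?be n (j n)) \<longlonglongrightarrow> b \<xi>"
      by (rule Lim_transform_eventually) (use bi in eventually_elim, simp add: trunc_b_def)
  qed
  show "(\<lambda>n. (\<Sum>j<n. ?c n k j j) / real n) \<longlonglongrightarrow> integral {0..1} (\<lambda>\<xi>. arcsine_mean (\<lambda>u. u ^ k) (a \<xi>) (b \<xi>))"
  proof (rule step_sum_limit[OF _ cb])
    fix \<xi> :: real assume \<xi>: "0 < \<xi>" "\<xi> < 1"
    have r: "(\<lambda>n. real (nat \<lfloor>real n * \<xi>\<rfloor>) / real n) \<longlonglongrightarrow> \<xi>" using \<xi> by (intro floor_ratio_tendsto) simp
    \<comment> \<open>The offset 0 selects the diagonal entry, whose limit is the k-th moment of the
      arcsine law.\<close>
    have "(\<lambda>n. ?c n k (nat \<lfloor>real n * \<xi>\<rfloor>) (nat (int (nat \<lfloor>real n * \<xi>\<rfloor>) + 0))) \<longlonglongrightarrow> arcsine_fourier k (a \<xi>) (b \<xi>) 0"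
      by (rule tridiagonal_power_limit[where al = ?al and be = ?be and \<xi> = \<xi>])
        (use \<xi> c0 c1 ord al be r in auto)
    then show "(\<lambda>n. ?c n k (nat \<lfloor>real n * \<xi>\<rfloor>) (nat \<lfloor>real n * \<xi>\<rfloor>)) \<longlonglongrightarrow> arcsine_mean (\<lambda>u. u ^ k) (a \<xi>) (b \<xi>)"
      by (simp only: add_0_right nat_int arcsine_mean_power)
  qed
qed

text \<open>The support has at least \<open>n\<close> points, so below \<open>n\<close> the
  truncated polynomials are the orthonormal ones. Squaring \<open>v y ^ k\<close> brings in the
  2k-th power of the Jacobi matrix.\<close>

lemma variance_power_statistic:
  fixes v w :: "int \<Rightarrow> real"
  assumes M: "prob_space M" and n: "n \<ge> 1"
    and pmf: "has_joint_pmf_proportional_to M n X (ensemble_density n v w)"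
    and w: "\<And>y. w y \<ge> 0" and mom: "\<And>k. (\<lambda>y. \<bar>v y\<bar> ^ k * w y) summable_on UNIV"
    and supp: "infinite (weight_support w) \<or> n \<le> card (weight_support w)"
    and on: "orthonormal_polynomials v w p"
  shows "(\<integral>\<^sup>+ \<omega>. ennreal ((linear_statistic n X (\<lambda>x. rescale n v x ^ k) \<omega> - (\<Sum>j<n. jacobi_power v w p k j j))\<^sup>2) \<partial>M)
     = ennreal (\<Sum>j<n. jacobi_power v w p (2 * k) j j - (\<Sum>i<n. (jacobi_power v w p k i j)\<^sup>2))"
proof -
  have ord: "j \<in> ortho_orders w" if "j < n" for j
    using supp that by (auto simp: ortho_orders_def)
  let ?G = "\<lambda>e i j. infsetsum (\<lambda>y. (v y ^ k) ^ e * poly (p i) (v y) * poly (p j) (v y) * w y) UNIV"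
  have G: "?G e i j = jacobi_power v w p (k * e) i j" if "i < n" "j < n" for e i j
    using that ord by (simp add: jacobi_power_def trunc_poly_def power_mult)
  have "(\<integral>\<^sup>+ \<omega>. ennreal ((linear_statistic n X (rescale n (\<lambda>y. v y ^ k)) \<omega> - (\<Sum>j<n. ?G 1 j j))\<^sup>2) \<partial>M)
     = ennreal (\<Sum>j<n. ?G 2 j j - (\<Sum>i<n. (?G 1 i j)\<^sup>2))"
  proof (rule variance_linear_statistic[OF M n pmf w])
    show "degree (p j) = j" "lead_coeff (p j) > 0" if "j < n" for j
      using on ord[OF that] unfolding orthonormal_polynomials_def by auto
    show "(\<lambda>y. (v y ^ k) ^ e * poly (p i) (v y) * poly (p j) (v y) * w y) abs_summable_on UNIV" for e i j
      using jacobi_summable[OF mom w, of "k * e" "p i" "p j"] by (simp add: power_mult)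
    show "?G 0 i j = (if i = j then 1 else 0)" if "i < n" "j < n" for i j
      unfolding G[OF that] using jacobi_power_0[OF mom w on] ord that by simp
  qed
  moreover have "rescale n (\<lambda>y. v y ^ k) = (\<lambda>x. rescale n v x ^ k)" by (simp add: rescale_def fun_eq_iff)
  moreover have "(\<Sum>j<n. ?G 1 j j) = (\<Sum>j<n. jacobi_power v w p k j j)"
    by (rule sum.cong[OF refl]) (simp only: lessThan_iff G mult_1_right)
  moreover have "(\<Sum>j<n. ?G 2 j j - (\<Sum>i<n. (?G 1 i j)\<^sup>2))
      = (\<Sum>j<n. jacobi_power v w p (2 * k) j j - (\<Sum>i<n. (jacobi_power v w p k i j)\<^sup>2))"
  proof (rule sum.cong[OF refl])
    fix j assume "j \<in> {..<n}"
    then have j: "j < n" by simp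
    have "(\<Sum>i<n. (?G 1 i j)\<^sup>2) = (\<Sum>i<n. (jacobi_power v w p k i j)\<^sup>2)"
      by (rule sum.cong[OF refl]) (simp only: lessThan_iff G j mult_1_right)
    moreover have "?G 2 j j = jacobi_power v w p (2 * k) j j"
      unfolding G[OF j j] by (simp only: mult.commute)
    ultimately show "?G 2 j j - (\<Sum>i<n. (?G 1 i j)\<^sup>2)
        = jacobi_power v w p (2 * k) j j - (\<Sum>i<n. (jacobi_power v w p k i j)\<^sup>2)" by (simp only:)
  qed
  ultimately show ?thesis by simp
qed

section \<open>From moments to test functions\<close>

lemma continuous_on_arcsine_integrand:
  fixes a b :: "real \<Rightarrow> real" and T :: "real set"
  assumes a: "continuous_on S a" and b: "continuous_on S b" and g: "continuous_on UNIV (g :: real \<Rightarrow> real)"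
  shows "continuous_on (S \<times> T) (\<lambda>(\<xi>, \<theta>). g (b \<xi> + 2 * a \<xi> * cos \<theta>))"
proof -
  have "continuous_on (S \<times> T) (\<lambda>p. a (fst p))" "continuous_on (S \<times> T) (\<lambda>p. b (fst p))"
    by (rule continuous_on_compose2[OF a] continuous_on_compose2[OF b]; auto intro: continuous_intros)+
  then have "continuous_on (S \<times> T) (\<lambda>p. b (fst p) + 2 * a (fst p) * cos (snd p))"
    by (intro continuous_intros)
  then have "continuous_on (S \<times> T) (\<lambda>p. g (b (fst p) + 2 * a (fst p) * cos (snd p)))"
    by (rule continuous_on_compose2[OF g]) auto
  then show ?thesis by (simp add: case_prod_unfold)
qed

lemma continuous_on_arcsine_mean:
  fixes a b :: "real \<Rightarrow> real"
  assumes a: "continuous_on S a" and b: "continuous_on S b" and g: "continuous_on UNIV g"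
  shows "continuous_on S (\<lambda>\<xi>. arcsine_mean g (a \<xi>) (b \<xi>))"
proof -
  have "continuous_on S (\<lambda>\<xi>. integral (cbox (- pi) 0) (\<lambda>\<theta>. g (b \<xi> + 2 * a \<xi> * cos \<theta>)))"
    by (rule integral_continuous_on_param) (use continuous_on_arcsine_integrand[OF a b g] in simp)
  then show ?thesis unfolding arcsine_mean_def by (intro continuous_intros) simp
qed

lemma arcsine_argument_continuous:
  fixes T :: "real set"
  assumes "continuous_on UNIV (g :: real \<Rightarrow> real)"
  shows "continuous_on T (\<lambda>\<theta>. g (b + 2 * a * cos \<theta>))"
  by (rule continuous_on_compose2[OF assms]) (auto intro!: continuous_intros)

lemma arcsine_argument_bound:
  fixes a b \<theta> :: real
  assumes "a \<ge> 0" shows "\<bar>b + 2 * a * cos \<theta>\<bar> \<le> \<bar>b\<bar> + 2 * a"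
proof -
  have "\<bar>2 * a * cos \<theta>\<bar> \<le> 2 * a" using assms abs_cos_le_one[of \<theta>] by (simp add: abs_mult mult_left_le)
  then show ?thesis by linarith
qed

lemma arcsine_mean_diff_bound:
  assumes g: "continuous_on UNIV g" and q: "continuous_on UNIV q" and a: "a \<ge> 0"
    and R: "\<bar>b\<bar> + 2 * a \<le> R" and e: "\<And>u. \<bar>u\<bar> \<le> R \<Longrightarrow> \<bar>g u - q u\<bar> \<le> e"
  shows "\<bar>arcsine_mean g a b - arcsine_mean q a b\<bar> \<le> e"
proof -
  let ?G = "\<lambda>\<theta>. g (b + 2 * a * cos \<theta>)" and ?Q = "\<lambda>\<theta>. q (b + 2 * a * cos \<theta>)"
  have i: "?G integrable_on {- pi..0}" "?Q integrable_on {- pi..0}"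
    by (intro integrable_continuous_real arcsine_argument_continuous g q)+
  have e0: "e \<ge> 0" using order.trans[OF abs_ge_zero e[of 0]] R a by simp
  have "norm (integral {- pi..0} (\<lambda>\<theta>. ?G \<theta> - ?Q \<theta>)) \<le> e * (0 - (- pi))"
  proof (rule integral_bound)
    show "continuous_on {- pi..0} (\<lambda>\<theta>. ?G \<theta> - ?Q \<theta>)"
      by (intro continuous_on_diff arcsine_argument_continuous g q)
    show "norm (?G \<theta> - ?Q \<theta>) \<le> e" for \<theta>
      using e[OF order.trans[OF arcsine_argument_bound[OF a] R]] by simp
  qed simp
  then have "\<bar>integral {- pi..0} ?G - integral {- pi..0} ?Q\<bar> \<le> e * pi"
    using i by (simp add: Henstock_Kurzweil_Integration.integral_diff)
  then have "\<bar>integral {- pi..0} ?G - integral {- pi..0} ?Q\<bar> / pi \<le> e" by (simp add: divide_le_eq)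
  moreover have "arcsine_mean g a b - arcsine_mean q a b = (integral {- pi..0} ?G - integral {- pi..0} ?Q) / pi"
    by (simp add: arcsine_mean_def diff_divide_distrib)
  ultimately show ?thesis by (simp add: abs_divide)
qed

lemma arcsine_mean_polynomial:
  "arcsine_mean (\<lambda>u. \<Sum>i\<le>d. c i * u ^ i) a b = (\<Sum>i\<le>d. c i * arcsine_mean (\<lambda>u. u ^ i) a b)"
proof -
  have "(\<lambda>\<theta>. c i * (b + 2 * a * cos \<theta>) ^ i) integrable_on {- pi..0}" for i
    by (intro integrable_continuous_real continuous_intros)
  then have "integral {- pi..0} (\<lambda>\<theta>. \<Sum>i\<le>d. c i * (b + 2 * a * cos \<theta>) ^ i)
      = (\<Sum>i\<le>d. c i * integral {- pi..0} (\<lambda>\<theta>. (b + 2 * a * cos \<theta>) ^ i))"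
    by (simp add: Henstock_Kurzweil_Integration.integral_sum)
  then show ?thesis by (simp add: arcsine_mean_def sum_divide_distrib)
qed

text \<open>Weierstrass approximation by polynomials. The index set has at most \<open>n\<close>
  elements, so division by \<open>n\<close> gives a measure of mass at most 1 and a uniform error is
  not amplified.\<close>

lemma empirical_moments_continuous:
  fixes a b :: "real \<Rightarrow> real" and z :: "nat \<Rightarrow> nat \<Rightarrow> real"
  assumes a: "continuous_on {0..1} a" and b: "continuous_on {0..1} b" and a0: "\<And>\<xi>. \<xi> \<in> {0..1} \<Longrightarrow> a \<xi> \<ge> 0"
    and J: "\<And>n. J n \<subseteq> {1..n}" and z: "\<And>n j. j \<in> J n \<Longrightarrow> \<bar>z n j\<bar> \<le> R"
    and mom: "\<And>k. (\<lambda>n. (\<Sum>j\<in>J n. z n j ^ k) / real n) \<longlonglongrightarrow> integral {0..1} (\<lambda>\<xi>. arcsine_mean (\<lambda>u. u ^ k) (a \<xi>) (b \<xi>))"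
    and g: "continuous_on UNIV g"
  shows "(\<lambda>n. (\<Sum>j\<in>J n. g (z n j)) / real n) \<longlonglongrightarrow> integral {0..1} (\<lambda>\<xi>. arcsine_mean g (a \<xi>) (b \<xi>))"
proof -
  define L where "L g = integral {0..1} (\<lambda>\<xi>. arcsine_mean g (a \<xi>) (b \<xi>))" for g
  have "continuous_on {0..1} (\<lambda>\<xi>. \<bar>b \<xi>\<bar> + 2 * a \<xi>)" by (intro continuous_intros a b)
  from compact_imp_bounded[OF compact_continuous_image[OF this compact_Icc]]
  obtain R1 where R1: "\<And>\<xi>. \<xi> \<in> {0..1} \<Longrightarrow> norm (\<bar>b \<xi>\<bar> + 2 * a \<xi>) \<le> R1"
    unfolding bounded_iff by blast
  \<comment> \<open>One interval has to contain both the sample points and the supports of all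
    arcsine laws, so that the approximation serves both sides.\<close>
  define R2 where "R2 = max R R1"
  have R2: "\<bar>b \<xi>\<bar> + 2 * a \<xi> \<le> R2" if "\<xi> \<in> {0..1}" for \<xi> using R1[OF that] by (simp add: R2_def)
  have ii: "(\<lambda>\<xi>. arcsine_mean q (a \<xi>) (b \<xi>)) integrable_on {0..1}" if "continuous_on UNIV q" for q
    by (intro integrable_continuous_real continuous_on_arcsine_mean a b that)
  show ?thesis unfolding L_def[symmetric]
  proof (rule LIMSEQ_I)
    fix e :: real assume e: "e > 0"
    have "0 < e / 3" "continuous_on (cbox (- R2) R2) g" using e g by (auto intro: continuous_on_subset)
    then obtain q where "real_polynomial_function q" and q: "\<And>u. u \<in> cbox (- R2) R2 \<Longrightarrow> \<bar>g u - q u\<bar> < e / 3"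
      using Stone_Weierstrass_real_polynomial_function[OF compact_cbox] by metis
    then obtain c d where q_eq: "q = (\<lambda>u. \<Sum>i\<le>d. c i * u ^ i)"
      unfolding real_polynomial_function_iff_sum by blast
    have qc: "continuous_on UNIV q" unfolding q_eq by (intro continuous_intros)
    have q': "\<bar>g u - q u\<bar> \<le> e / 3" if "\<bar>u\<bar> \<le> R2" for u
      by (rule less_imp_le, rule q) (use that in \<open>simp add: abs_le_iff\<close>)
    have Lq: "L q = (\<Sum>i\<le>d. c i * L (\<lambda>u. u ^ i))"
    proof -
      have "(\<lambda>\<xi>. c i * arcsine_mean (\<lambda>u. u ^ i) (a \<xi>) (b \<xi>)) integrable_on {0..1}" for i
        by (intro integrable_on_mult_right ii continuous_intros)
      then show ?thesis
        unfolding L_def q_eq arcsine_mean_polynomial by (simp add: Henstock_Kurzweil_Integration.integral_sum)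
    qed
    have "(\<lambda>n. \<Sum>i\<le>d. c i * ((\<Sum>j\<in>J n. z n j ^ i) / real n)) \<longlonglongrightarrow> L q"
      unfolding Lq unfolding L_def by (intro tendsto_sum tendsto_mult tendsto_const mom)
    moreover have "(\<Sum>i\<le>d. c i * ((\<Sum>j\<in>J n. z n j ^ i) / real n)) = (\<Sum>j\<in>J n. q (z n j)) / real n" for n
      unfolding q_eq by (subst sum.swap) (simp add: sum_distrib_left sum_divide_distrib)
    ultimately have "(\<lambda>n. (\<Sum>j\<in>J n. q (z n j)) / real n) \<longlonglongrightarrow> L q" by simp
    from LIMSEQ_D[OF this, of "e / 3"] e obtain N where N: "\<And>n. n \<ge> N \<Longrightarrow> \<bar>(\<Sum>j\<in>J n. q (z n j)) / real n - L q\<bar> < e / 3"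
      by auto
    have "\<bar>L g - L q\<bar> \<le> e / 3"
    proof -
      have "norm (integral {0..1} (\<lambda>\<xi>. arcsine_mean g (a \<xi>) (b \<xi>) - arcsine_mean q (a \<xi>) (b \<xi>))) \<le> e / 3 * (1 - 0)"
      proof (rule integral_bound)
        show "continuous_on {0..1} (\<lambda>\<xi>. arcsine_mean g (a \<xi>) (b \<xi>) - arcsine_mean q (a \<xi>) (b \<xi>))"
          by (intro continuous_on_diff continuous_on_arcsine_mean a b g qc)
        fix \<xi> :: real assume "\<xi> \<in> {0..1}"
        from arcsine_mean_diff_bound[OF g qc a0[OF this] R2[OF this] q']
        show "norm (arcsine_mean g (a \<xi>) (b \<xi>) - arcsine_mean q (a \<xi>) (b \<xi>)) \<le> e / 3" by simp
      qed simp
      then show ?thesis unfolding L_def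
        using ii[OF g] ii[OF qc] by (simp add: Henstock_Kurzweil_Integration.integral_diff)
    qed
    moreover have "\<bar>(\<Sum>j\<in>J n. g (z n j)) / real n - (\<Sum>j\<in>J n. q (z n j)) / real n\<bar> \<le> e / 3" for n
    proof -
      have fin: "finite (J n)" using J[of n] by (rule finite_subset) simp
      have "\<bar>\<Sum>j\<in>J n. g (z n j) - q (z n j)\<bar> \<le> (\<Sum>j\<in>J n. e / 3)"
        by (rule order.trans[OF sum_abs], rule sum_mono, rule q') (use z in \<open>auto simp: R2_def le_max_iff_disj\<close>)
      also have "\<dots> \<le> real n * (e / 3)"
        using card_mono[OF _ J[of n]] e by (simp add: mult_right_mono)
      finally have "\<bar>\<Sum>j\<in>J n. g (z n j) - q (z n j)\<bar> / real n \<le> e / 3"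
        using e by (cases "n = 0") (auto simp: divide_le_eq mult.commute)
      then show ?thesis by (simp add: sum_subtractf diff_divide_distrib[symmetric] abs_divide)
    qed
    ultimately have bounds: "\<bar>L g - L q\<bar> \<le> e / 3"
      "\<bar>(\<Sum>j\<in>J n. g (z n j)) / real n - (\<Sum>j\<in>J n. q (z n j)) / real n\<bar> \<le> e / 3" for n by blast+
    have "norm ((\<Sum>j\<in>J n. g (z n j)) / real n - L g) < e" if "n \<ge> N" for n
      using N[OF that] bounds(1) bounds(2)[of n] unfolding real_norm_def by linarith
    then show "\<exists>no. \<forall>n\<ge>no. norm ((\<Sum>j\<in>J n. g (z n j)) / real n - L g) < e" by blast
  qed
qed

text \<open>The distance to \<open>T\<close> is continuous and nonnegative, so a vanishing integral
  makes it vanish for every \<xi> and \<theta>, not just almost everywhere. As \<theta> varies, b +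
  2a cos \<theta> covers the whole interval, and \<open>T\<close> is closed.\<close>

lemma arcsine_support:
  fixes a b :: "real \<Rightarrow> real"
  assumes a: "continuous_on {0..1} a" and b: "continuous_on {0..1} b" and a0: "\<And>\<xi>. \<xi> \<in> {0..1} \<Longrightarrow> a \<xi> \<ge> 0"
    and T: "closed T" "T \<noteq> {}"
    and z: "integral {0..1} (\<lambda>\<xi>. arcsine_mean (\<lambda>u. infdist u T) (a \<xi>) (b \<xi>)) = 0"
    and \<xi>: "\<xi> \<in> {0..1}" and u: "u \<in> {b \<xi> - 2 * a \<xi>..b \<xi> + 2 * a \<xi>}"
  shows "u \<in> T"
proof -
  let ?g = "\<lambda>u. infdist u T"
  have g: "continuous_on UNIV ?g" by (intro continuous_intros)
  have nn: "arcsine_mean ?g (a \<xi>) (b \<xi>) \<ge> 0" for \<xi>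
    unfolding arcsine_mean_def
    by (intro mult_nonneg_nonneg Henstock_Kurzweil_Integration.integral_nonneg integrable_continuous_real
        arcsine_argument_continuous g) (auto simp: infdist_nonneg)
  have "arcsine_mean ?g (a \<xi>) (b \<xi>) = 0"
    using integral_eq_0_iff[OF continuous_on_arcsine_mean[OF a b g]] nn z \<xi> by auto
  then have i0: "integral {- pi..0} (\<lambda>\<theta>. ?g (b \<xi> + 2 * a \<xi> * cos \<theta>)) = 0"
    by (simp add: arcsine_mean_def)
  have all: "?g (b \<xi> + 2 * a \<xi> * cos \<theta>) = 0" if "\<theta> \<in> {- pi..0}" for \<theta>
    using integral_eq_0_iff[OF arcsine_argument_continuous[OF g], of "- pi" 0 "b \<xi>" "a \<xi>"] i0 that
    by (auto simp: infdist_nonneg)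
  obtain \<theta> where \<theta>: "\<theta> \<in> {- pi..0}" "b \<xi> + 2 * a \<xi> * cos \<theta> = u"
  proof (cases "a \<xi> = 0")
    case True
    then show ?thesis using that[of 0] u by auto
  next
    case False
    then have a1: "a \<xi> > 0" using a0[OF \<xi>] by simp
    define s where "s = (u - b \<xi>) / (2 * a \<xi>)"
    have s: "- 1 \<le> s" "s \<le> 1" using u a1 by (auto simp: s_def field_simps)
    show ?thesis
    proof (rule that[of "- arccos s"])
      show "- arccos s \<in> {- pi..0}" using arccos_bounded[OF s] by auto
      show "b \<xi> + 2 * a \<xi> * cos (- arccos s) = u" using a1 s by (simp add: cos_arccos s_def)
    qed
  qed
  then show ?thesis using all[OF \<theta>(1)] in_closed_iff_infdist_zero[OF T, of u] by simp
qed

text \<open>Dominated convergence in \<open>u\<close> and then in \<xi>. Where \<open>a\<close>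
  vanishes the law is a point mass, which may charge \<open>N\<close>; such \<xi> must therefore
  form a null set.\<close>

lemma arcsine_functional_limit:
  fixes a b :: "real \<Rightarrow> real" and g :: "nat \<Rightarrow> real \<Rightarrow> real"
  assumes a: "continuous_on {0..1} a" and b: "continuous_on {0..1} b" and a0: "\<And>\<xi>. \<xi> \<in> {0..1} \<Longrightarrow> a \<xi> \<ge> 0"
    and Z: "negligible {\<xi> \<in> {0..1}. a \<xi> = 0}"
    and g: "\<And>m. continuous_on UNIV (g m)" and bd: "\<And>m u. \<bar>g m u\<bar> \<le> C"
    and N: "negligible N" and lim: "\<And>u. u \<notin> N \<Longrightarrow> (\<lambda>m. g m u) \<longlonglongrightarrow> h u"
  shows "(\<lambda>m. integral {0..1} (\<lambda>\<xi>. arcsine_mean (g m) (a \<xi>) (b \<xi>))) \<longlonglongrightarrow>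
     integral {0..1} (\<lambda>\<xi>. 1 / pi * integral {b \<xi> - 2 * a \<xi>..b \<xi> + 2 * a \<xi>} (\<lambda>u. h u / sqrt (4 * (a \<xi>)\<^sup>2 - (u - b \<xi>)\<^sup>2)))"
proof (rule dominated_convergence_negligible(2)[OF Z, where h = "\<lambda>_. C"])
  show "(\<lambda>\<xi>. arcsine_mean (g m) (a \<xi>) (b \<xi>)) integrable_on {0..1}" for m
    by (intro integrable_continuous_real continuous_on_arcsine_mean a b g)
  show "(\<lambda>_::real. C) integrable_on {0..1}" by (intro integrable_continuous_real continuous_on_const)
  fix m \<xi> assume \<xi>: "\<xi> \<in> {0..1} - {\<xi> \<in> {0..1}. a \<xi> = 0}"
  then have a1: "a \<xi> > 0" using a0[of \<xi>] by force
  have "\<bar>arcsine_mean (g m) (a \<xi>) (b \<xi>) - arcsine_mean (\<lambda>_. 0) (a \<xi>) (b \<xi>)\<bar> \<le> C"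
    by (rule arcsine_mean_diff_bound[OF g _ _ order_refl]) (use a1 bd in auto)
  then show "\<bar>arcsine_mean (g m) (a \<xi>) (b \<xi>)\<bar> \<le> C" by (simp add: arcsine_mean_def)
  show "(\<lambda>m. arcsine_mean (g m) (a \<xi>) (b \<xi>)) \<longlonglongrightarrow>
     1 / pi * integral {b \<xi> - 2 * a \<xi>..b \<xi> + 2 * a \<xi>} (\<lambda>u. h u / sqrt (4 * (a \<xi>)\<^sup>2 - (u - b \<xi>)\<^sup>2))"
    by (rule arcsine_mean_limit[OF a1 g bd N lim])
qed

text \<open>The deterministic core, to be applied to one fixed outcome: convergence of all moments
  and of all tails outside \<open>K\<close> determines the limit of the averages of
  \<open>f\<close>.\<close>

lemma empirical_limit:
  fixes x :: "nat \<Rightarrow> nat \<Rightarrow> real" and \<mu>n :: "nat \<Rightarrow> real \<Rightarrow> real" and \<mu> f a b :: "real \<Rightarrow> real"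
  assumes a: "continuous_on {0..1} a" and b: "continuous_on {0..1} b" and a0: "\<And>\<xi>. \<xi> \<in> {0..1} \<Longrightarrow> a \<xi> \<ge> 0"
    and Z: "negligible {\<xi> \<in> {0..1}. a \<xi> = 0}"
    and lat: "\<And>n j. j \<in> {1..n} \<Longrightarrow> x n j \<in> lattice n"
    and K: "compact (\<mu> ` K)" and inj: "inj_on \<mu> K"
    and unif: "(\<lambda>n. SUP x \<in> lattice n \<inter> K. ennreal \<bar>\<mu>n n x - \<mu> x\<bar>) \<longlonglongrightarrow> 0"
    and mom: "\<And>k. (\<lambda>n. (\<Sum>j=1..n. \<mu>n n (x n j) ^ k) / real n) \<longlonglongrightarrow> integral {0..1} (\<lambda>\<xi>. arcsine_mean (\<lambda>u. u ^ k) (a \<xi>) (b \<xi>))"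
    and tail: "\<And>k. (\<lambda>n. (\<Sum>j=1..n. \<bar>\<mu>n n (x n j)\<bar> ^ k * indicator (- K) (x n j)) / real n) \<longlonglongrightarrow> 0"
    and ri: "(f \<circ> inv_into K \<mu>) riemann_integrable_on (\<mu> ` K)"
    and growth: "polynomial_growth_off K \<mu>n f"
  shows "(\<lambda>n. (\<Sum>j=1..n. f (x n j)) / real n) \<longlonglongrightarrow>
     1 / pi * integral {0..1} (\<lambda>\<xi>. integral {b \<xi> - 2 * a \<xi>..b \<xi> + 2 * a \<xi>}
        (\<lambda>u. f (inv_into K \<mu> u) / sqrt (4 * (a \<xi>)\<^sup>2 - (u - b \<xi>)\<^sup>2)))"
proof -
  define L where "L g = integral {0..1} (\<lambda>\<xi>. arcsine_mean g (a \<xi>) (b \<xi>))" for g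
  define J where "J n = {j \<in> {1..n}. x n j \<in> K}" for n
  have J: "J n \<subseteq> {1..n}" for n by (auto simp: J_def)
  have finJ: "finite (J n)" for n by (simp add: J_def)
  have split: "(\<Sum>j=1..n. F (x n j)) = (\<Sum>j\<in>J n. F (x n j)) + (\<Sum>j=1..n. F (x n j) * indicator (- K) (x n j))"
    for F :: "real \<Rightarrow> real" and n
  proof -
    have "(\<Sum>j\<in>J n. F (x n j)) = (\<Sum>j=1..n. if x n j \<in> K then F (x n j) else 0)"
      unfolding J_def by (rule sum.inter_filter) simp
    moreover have "(\<Sum>j=1..n. F (x n j))
        = (\<Sum>j=1..n. (if x n j \<in> K then F (x n j) else 0) + F (x n j) * indicator (- K) (x n j))"
      by (rule sum.cong[OF refl]) (simp add: indicator_def)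
    ultimately show ?thesis by (simp only: sum.distrib)
  qed
  obtain R where R: "\<And>y. y \<in> K \<Longrightarrow> \<bar>\<mu> y\<bar> \<le> R"
    using compact_imp_bounded[OF K] unfolding bounded_iff by auto
  have near: "\<forall>\<^sub>F n in sequentially. \<forall>y\<in>lattice n \<inter> K. \<bar>\<mu>n n y - \<mu> y\<bar> < e" if "e > 0" for e
  proof -
    have "\<forall>\<^sub>F n in sequentially. (SUP x \<in> lattice n \<inter> K. ennreal \<bar>\<mu>n n x - \<mu> x\<bar>) < ennreal e"
      using order_tendstoD(2)[OF unif, of "ennreal e"] that by simp
    then show ?thesis
    proof eventually_elim
      case (elim n)
      show ?case
      proof
        fix y assume "y \<in> lattice n \<inter> K"
        then have "ennreal \<bar>\<mu>n n y - \<mu> y\<bar> \<le> (SUP x \<in> lattice n \<inter> K. ennreal \<bar>\<mu>n n x - \<mu> x\<bar>)"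
          by (rule SUP_upper)
        then have "ennreal \<bar>\<mu>n n y - \<mu> y\<bar> < ennreal e" using elim by (rule le_less_trans)
        then show "\<bar>\<mu>n n y - \<mu> y\<bar> < e" by (simp add: ennreal_less_iff)
      qed
    qed
  qed
  have momK: "(\<lambda>n. (\<Sum>j\<in>J n. \<mu> (x n j) ^ k) / real n) \<longlonglongrightarrow> L (\<lambda>u. u ^ k)" for k
  proof -
    have "(\<lambda>n. (\<Sum>j\<in>J n. \<mu> (x n j) ^ k) / real n - (\<Sum>j=1..n. \<mu>n n (x n j) ^ k) / real n) \<longlonglongrightarrow> 0"
    proof (rule LIMSEQ_I)
      fix e :: real assume e: "e > 0"
      \<comment> \<open>On \<open>K\<close> the values of \<mu> are bounded by \<open>R\<close>, and
        those of \<open>\<mu>n n\<close> are eventually within 1 of them; hence the margin 1 here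
        and \<open>min d 1\<close> below.\<close>
      have "uniformly_continuous_on {- (R + 1)..R + 1} (\<lambda>u::real. u ^ k)"
        by (intro compact_uniformly_continuous continuous_intros) auto
      from this[unfolded uniformly_continuous_on_def dist_real_def, rule_format, of "e / 2"]
      obtain d where d: "d > 0" "\<And>s t. s \<in> {- (R + 1)..R + 1} \<Longrightarrow> t \<in> {- (R + 1)..R + 1} \<Longrightarrow> \<bar>t - s\<bar> < d \<Longrightarrow> \<bar>t ^ k - s ^ k\<bar> < e / 2"
        using e by auto
      have "\<forall>\<^sub>F n in sequentially. \<bar>(\<Sum>j=1..n. \<bar>\<mu>n n (x n j)\<bar> ^ k * indicator (- K) (x n j)) / real n\<bar> < e / 2"
        using tendstoD[OF tail[of k], of "e / 2"] e by (simp add: dist_real_def)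
      moreover have "\<forall>\<^sub>F n in sequentially. \<forall>y\<in>lattice n \<inter> K. \<bar>\<mu>n n y - \<mu> y\<bar> < min d 1"
        using d by (intro near) simp
      ultimately have "\<forall>\<^sub>F n in sequentially. norm ((\<Sum>j\<in>J n. \<mu> (x n j) ^ k) / real n - (\<Sum>j=1..n. \<mu>n n (x n j) ^ k) / real n - 0) < e"
      proof eventually_elim
        case (elim n)
        have pt: "\<bar>\<mu> (x n j) ^ k - \<mu>n n (x n j) ^ k\<bar> \<le> e / 2" if j: "j \<in> J n" for j
        proof -
          have "x n j \<in> lattice n \<inter> K" using j lat by (auto simp: J_def)
          then have "\<bar>\<mu>n n (x n j) - \<mu> (x n j)\<bar> < min d 1" "\<bar>\<mu> (x n j)\<bar> \<le> R" using elim(2) R by auto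
          then show ?thesis by (intro less_imp_le d(2)) auto
        qed
        have "\<bar>\<Sum>j\<in>J n. \<mu> (x n j) ^ k - \<mu>n n (x n j) ^ k\<bar> \<le> (\<Sum>j\<in>J n. e / 2)"
          by (rule order.trans[OF sum_abs], rule sum_mono, rule pt)
        also have "\<dots> \<le> real n * (e / 2)"
          using card_mono[OF _ J[of n]] e by (simp add: mult_right_mono)
        finally have 1: "\<bar>\<Sum>j\<in>J n. \<mu> (x n j) ^ k - \<mu>n n (x n j) ^ k\<bar> / real n \<le> e / 2"
          using e by (cases "n = 0") (auto simp: divide_le_eq mult.commute)
        have "\<bar>\<Sum>j=1..n. \<mu>n n (x n j) ^ k * indicator (- K) (x n j)\<bar> \<le> (\<Sum>j=1..n. \<bar>\<mu>n n (x n j)\<bar> ^ k * indicator (- K) (x n j))"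
          by (rule order.trans[OF sum_abs]) (simp add: abs_mult power_abs)
        then have 2: "\<bar>\<Sum>j=1..n. \<mu>n n (x n j) ^ k * indicator (- K) (x n j)\<bar> / real n < e / 2"
          using elim(1) by (smt (verit, best) divide_right_mono of_nat_0_le_iff)
        have "(\<Sum>j\<in>J n. \<mu> (x n j) ^ k) / real n - (\<Sum>j=1..n. \<mu>n n (x n j) ^ k) / real n
           = (\<Sum>j\<in>J n. \<mu> (x n j) ^ k - \<mu>n n (x n j) ^ k) / real n - (\<Sum>j=1..n. \<mu>n n (x n j) ^ k * indicator (- K) (x n j)) / real n"
          unfolding split[of "\<lambda>y. \<mu>n n y ^ k" n] by (simp add: sum_subtractf diff_divide_distrib add_divide_distrib)
        moreover have "\<bar>(\<Sum>j\<in>J n. \<mu> (x n j) ^ k - \<mu>n n (x n j) ^ k) / real n\<bar> \<le> e / 2"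
          "\<bar>(\<Sum>j=1..n. \<mu>n n (x n j) ^ k * indicator (- K) (x n j)) / real n\<bar> < e / 2"
          using 1 2 by (simp_all only: abs_divide abs_of_nat)
        ultimately show ?case unfolding real_norm_def by linarith
      qed
      then show "\<exists>no. \<forall>n\<ge>no. norm ((\<Sum>j\<in>J n. \<mu> (x n j) ^ k) / real n - (\<Sum>j=1..n. \<mu>n n (x n j) ^ k) / real n - 0) < e"
        unfolding eventually_sequentially .
    qed
    from tendsto_add[OF this mom[of k]] show ?thesis by (simp add: L_def)
  qed
  have weak: "(\<lambda>n. (\<Sum>j\<in>J n. g (\<mu> (x n j))) / real n) \<longlonglongrightarrow> L g" if "continuous_on UNIV g" for g
    unfolding L_def
  proof (rule empirical_moments_continuous[OF a b a0 J _ _ that])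
    show "\<bar>\<mu> (x n j)\<bar> \<le> R" if "j \<in> J n" for n j using R that by (auto simp: J_def)
    show "(\<lambda>n. (\<Sum>j\<in>J n. \<mu> (x n j) ^ k) / real n) \<longlonglongrightarrow> integral {0..1} (\<lambda>\<xi>. arcsine_mean (\<lambda>u. u ^ k) (a \<xi>) (b \<xi>))" for k
      using momK[of k] by (simp add: L_def)
  qed
  \<comment> \<open>Otherwise the zeroth moment of the points in \<open>K\<close> would tend to 0,
    whereas its limit is 1.\<close>
  have "K \<noteq> {}"
  proof
    assume "K = {}"
    then have "(\<lambda>n. 0::real) \<longlonglongrightarrow> L (\<lambda>u. u ^ 0)" using momK[of 0] by (simp add: J_def)
    then show False unfolding L_def arcsine_mean_power arcsine_fourier_0 by (simp add: LIMSEQ_const_iff)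
  qed
  \<comment> \<open>Every retained point has \<mu>-value in the image of \<open>K\<close>, so the
    distance to it averages to 0 and the limit is supported there.\<close>
  have "(\<lambda>n. (\<Sum>j\<in>J n. infdist (\<mu> (x n j)) (\<mu> ` K)) / real n) \<longlonglongrightarrow> L (\<lambda>u. infdist u (\<mu> ` K))"
    by (rule weak) (intro continuous_intros)
  moreover have "(\<Sum>j\<in>J n. infdist (\<mu> (x n j)) (\<mu> ` K)) = 0" for n
    by (rule sum.neutral) (auto simp: J_def)
  ultimately have "L (\<lambda>u. infdist u (\<mu> ` K)) = 0" by (simp add: LIMSEQ_const_iff)
  then have supp: "u \<in> \<mu> ` K" if "\<xi> \<in> {0..1}" "u \<in> {b \<xi> - 2 * a \<xi>..b \<xi> + 2 * a \<xi>}" for \<xi> u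
    using arcsine_support[OF a b a0 compact_imp_closed[OF K] _ _ that] \<open>K \<noteq> {}\<close> by (simp add: L_def)
  define H where "H u = indicator (\<mu> ` K) u * (f \<circ> inv_into K \<mu>) u" for u
  define I where "I = integral {0..1} (\<lambda>\<xi>. 1 / pi * integral {b \<xi> - 2 * a \<xi>..b \<xi> + 2 * a \<xi>} (\<lambda>u. H u / sqrt (4 * (a \<xi>)\<^sup>2 - (u - b \<xi>)\<^sup>2)))"
  have I_eq: "I = 1 / pi * integral {0..1} (\<lambda>\<xi>. integral {b \<xi> - 2 * a \<xi>..b \<xi> + 2 * a \<xi>}
        (\<lambda>u. f (inv_into K \<mu> u) / sqrt (4 * (a \<xi>)\<^sup>2 - (u - b \<xi>)\<^sup>2)))"
    unfolding I_def integral_mult_right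
    by (intro arg_cong2[of _ _ _ _ "(*)"] refl Henstock_Kurzweil_Integration.integral_cong) (use supp in \<open>auto simp: H_def\<close>)
  obtain l u :: "nat \<Rightarrow> real \<Rightarrow> real" and N C where
    l: "\<And>m. continuous_on UNIV (l m)" and u: "\<And>m. continuous_on UNIV (u m)"
    and lH: "\<And>m x. l m x \<le> H x" and Hu: "\<And>m x. H x \<le> u m x"
    and lC: "\<And>m x. \<bar>l m x\<bar> \<le> C" and uC: "\<And>m x. \<bar>u m x\<bar> \<le> C" and N: "negligible N"
    and llim: "\<And>x. x \<notin> N \<Longrightarrow> (\<lambda>m. l m x) \<longlonglongrightarrow> H x" and ulim: "\<And>x. x \<notin> N \<Longrightarrow> (\<lambda>m. u m x) \<longlonglongrightarrow> H x"
    using riemann_integrable_on_envelopes[OF ri] unfolding H_def by metis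
  have Ll: "(\<lambda>m. L (l m)) \<longlonglongrightarrow> I" unfolding L_def I_def
    by (rule arcsine_functional_limit[OF a b a0 Z l lC N llim])
  have Lu: "(\<lambda>m. L (u m)) \<longlonglongrightarrow> I" unfolding L_def I_def
    by (rule arcsine_functional_limit[OF a b a0 Z u uC N ulim])
  \<comment> \<open>First one envelope index \<open>m\<close> is fixed for which both limits are
    within \<open>e / 2\<close> of \<open>I\<close>; only then does \<open>n\<close> tend to
    infinity.\<close>
  have inside: "(\<lambda>n. (\<Sum>j\<in>J n. H (\<mu> (x n j))) / real n) \<longlonglongrightarrow> I"
  proof (rule LIMSEQ_I)
    fix e :: real assume e: "e > 0"
    have "\<forall>\<^sub>F m in sequentially. I - e / 2 < L (l m)" "\<forall>\<^sub>F m in sequentially. L (u m) < I + e / 2"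
      using e by (auto intro: order_tendstoD[OF Ll] order_tendstoD[OF Lu])
    then have "\<forall>\<^sub>F m in sequentially. I - e / 2 < L (l m) \<and> L (u m) < I + e / 2" by eventually_elim auto
    then obtain m where m: "I - e / 2 < L (l m)" "L (u m) < I + e / 2"
      unfolding eventually_sequentially by auto
    have "\<forall>\<^sub>F n in sequentially. I - e / 2 < (\<Sum>j\<in>J n. l m (\<mu> (x n j))) / real n"
      by (rule order_tendstoD(1)[OF weak[OF l] m(1)])
    moreover have "\<forall>\<^sub>F n in sequentially. (\<Sum>j\<in>J n. u m (\<mu> (x n j))) / real n < I + e / 2"
      by (rule order_tendstoD(2)[OF weak[OF u] m(2)])
    ultimately have "\<forall>\<^sub>F n in sequentially. norm ((\<Sum>j\<in>J n. H (\<mu> (x n j))) / real n - I) < e"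
    proof eventually_elim
      case (elim n)
      have "(\<Sum>j\<in>J n. l m (\<mu> (x n j))) / real n \<le> (\<Sum>j\<in>J n. H (\<mu> (x n j))) / real n"
        "(\<Sum>j\<in>J n. H (\<mu> (x n j))) / real n \<le> (\<Sum>j\<in>J n. u m (\<mu> (x n j))) / real n"
        by (intro divide_right_mono sum_mono lH Hu; simp)+
      then show ?case using elim e unfolding real_norm_def by linarith
    qed
    then show "\<exists>no. \<forall>n\<ge>no. norm ((\<Sum>j\<in>J n. H (\<mu> (x n j))) / real n - I) < e"
      unfolding eventually_sequentially .
  qed
  have HJ: "H (\<mu> (x n j)) = f (x n j)" if "j \<in> J n" for n j
    using that inj by (simp add: J_def H_def)
  obtain C' k where C': "\<forall>\<^sub>F n in sequentially. \<forall>y \<in> lattice n - K. \<bar>f y\<bar> \<le> C' * (1 + \<bar>\<mu>n n y\<bar> ^ k)"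
    using growth unfolding polynomial_growth_off_def by blast
  have outside: "(\<lambda>n. (\<Sum>j=1..n. f (x n j) * indicator (- K) (x n j)) / real n) \<longlonglongrightarrow> 0"
  proof (rule Lim_null_comparison)
    let ?t = "\<lambda>k n. (\<Sum>j=1..n. \<bar>\<mu>n n (x n j)\<bar> ^ k * indicator (- K) (x n j)) / real n"
    \<comment> \<open>The two summands of the growth bound are controlled by the tails with
      exponents 0 and \<open>k\<close>.\<close>
    show "(\<lambda>n. C' * (?t 0 n + ?t k n)) \<longlonglongrightarrow> 0"
      using tendsto_mult[OF tendsto_const[of C'] tendsto_add[OF tail[of 0] tail[of k]]] by simp
    show "\<forall>\<^sub>F n in sequentially. norm ((\<Sum>j=1..n. f (x n j) * indicator (- K) (x n j)) / real n) \<le> C' * (?t 0 n + ?t k n)"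
      using C'
    proof eventually_elim
      case (elim n)
      have "\<bar>\<Sum>j=1..n. f (x n j) * indicator (- K) (x n j)\<bar>
         \<le> (\<Sum>j=1..n. C' * (1 + \<bar>\<mu>n n (x n j)\<bar> ^ k) * indicator (- K) (x n j))"
      proof (rule order.trans[OF sum_abs], rule sum_mono)
        fix j assume "j \<in> {1..n}"
        then have "x n j \<in> lattice n" by (rule lat)
        then show "\<bar>f (x n j) * indicator (- K) (x n j)\<bar> \<le> C' * (1 + \<bar>\<mu>n n (x n j)\<bar> ^ k) * indicator (- K) (x n j)"
          using elim by (auto simp: indicator_def)
      qed
      also have "\<dots> = C' * ((\<Sum>j=1..n. \<bar>\<mu>n n (x n j)\<bar> ^ 0 * indicator (- K) (x n j)) + (\<Sum>j=1..n. \<bar>\<mu>n n (x n j)\<bar> ^ k * indicator (- K) (x n j)))"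
        unfolding sum.distrib[symmetric] sum_distrib_left by (rule sum.cong[OF refl]) (simp add: algebra_simps)
      finally have "\<bar>\<Sum>j=1..n. f (x n j) * indicator (- K) (x n j)\<bar> / real n \<le> \<dots> / real n"
        by (rule divide_right_mono) simp
      then show ?case
        unfolding real_norm_def abs_divide abs_of_nat add_divide_distrib[symmetric] times_divide_eq_right .
    qed
  qed
  have "(\<lambda>n. (\<Sum>j\<in>J n. f (x n j)) / real n) \<longlonglongrightarrow> I"
    using inside by (simp add: HJ cong: sum.cong_simp)
  from tendsto_add[OF this outside] have "(\<lambda>n. (\<Sum>j=1..n. f (x n j)) / real n) \<longlonglongrightarrow> I"
    unfolding split[of f] by (simp add: add_divide_distrib)
  then show ?thesis unfolding I_eq .
qed

text \<open>In \<open>ennreal\<close> the inverse of 0 is \<infinity>, so the integrand is infinite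
  on the zero set of \<open>a\<close>; a finite integral leaves it no positive measure. Continuity
  makes the set closed and thus measurable.\<close>

lemma negligible_zero_set:
  fixes a :: "real \<Rightarrow> real"
  assumes a: "continuous_on {0..1} a" and s: "s > 0"
    and fin: "(\<integral>\<^sup>+ \<xi>. indicator {0..1} \<xi> * inverse (ennreal (\<bar>a \<xi>\<bar> powr s)) \<partial>lborel) < \<infinity>"
  shows "negligible {\<xi> \<in> {0..1}. a \<xi> = 0}"
proof -
  let ?Z = "{\<xi> \<in> {0..1}. a \<xi> = 0}"
  have "closed ?Z" by (rule continuous_closed_preimage_constant[OF a]) simp
  then have Z: "?Z \<in> sets lborel" by simp
  have "(\<integral>\<^sup>+ \<xi>. \<infinity> * indicator ?Z \<xi> \<partial>lborel) \<le> (\<integral>\<^sup>+ \<xi>. indicator {0..1} \<xi> * inverse (ennreal (\<bar>a \<xi>\<bar> powr s)) \<partial>lborel)"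
    by (rule nn_integral_mono) (auto simp: indicator_def)
  then have "\<infinity> * emeasure lborel ?Z < \<infinity>"
    using fin Z by (simp add: nn_integral_cmult_indicator le_less_trans)
  then have "emeasure lborel ?Z = 0" by (simp add: ennreal_mult_less_top)
  then have "?Z \<in> null_sets lborel" using Z by (simp add: null_sets_def)
  then show ?thesis unfolding negligible_iff_null_sets by (rule null_sets_completionI)
qed

theorem theorem2p3:
  fixes M :: "'w measure"
    and X :: "nat \<Rightarrow> nat \<Rightarrow> 'w \<Rightarrow> real"
    and \<nu> w :: "nat \<Rightarrow> int \<Rightarrow> real"
    and p :: "nat \<Rightarrow> nat \<Rightarrow> real poly"
    and A B :: "nat \<Rightarrow> nat \<Rightarrow> real"
    and a b \<mu> f :: "real \<Rightarrow> real"
    and K :: "real set"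
    and \<epsilon> \<gamma> :: real
  assumes "prob_space M"
    and "\<And>n. n \<ge> 1 \<Longrightarrow> strict_mono (\<nu> n) \<or> strict_antimono_on UNIV (\<nu> n)"
    and "\<And>n y. n \<ge> 1 \<Longrightarrow> w n y \<ge> 0"
    and "\<And>n k. n \<ge> 1 \<Longrightarrow> (\<lambda>y. \<bar>\<nu> n y\<bar> ^ k * w n y) summable_on UNIV"
    and "\<And>n. n \<ge> 1 \<Longrightarrow> infinite (weight_support (w n)) \<or> n \<le> card (weight_support (w n))"
    and "\<And>n. n \<ge> 1 \<Longrightarrow>
           has_joint_pmf_proportional_to M n (X n) (ensemble_density n (\<nu> n) (w n))"
    and "\<And>n. n \<ge> 1 \<Longrightarrow> orthonormal_polynomials (\<nu> n) (w n) (p n)"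
    and "\<And>n. n \<ge> 1 \<Longrightarrow> recurrence_coefficients (\<nu> n) (w n) (p n) (A n) (B n)"
    and "continuous_on {0..1} a" and "continuous_on {0..1} b"
    and "\<forall>\<xi> \<in> {0..1}. a \<xi> \<ge> 0" and "\<exists>\<xi> \<in> {0..1}. a \<xi> \<noteq> 0"
    and "\<And>\<xi>. \<xi> \<in> {0..1} \<Longrightarrow>
           ((\<lambda>(n, j). A n j) \<longlongrightarrow> a \<xi>) (ratio_filter (\<lambda>n. a_indices (w n)) \<xi>)"
    and "\<And>\<xi>. \<xi> \<in> {0..1} \<Longrightarrow>
           ((\<lambda>(n, j). B n j) \<longlongrightarrow> b \<xi>) (ratio_filter (\<lambda>n. ortho_orders (w n)) \<xi>)"
    and "bounded K" and "compact (\<mu> ` K)" and "\<epsilon> > 0"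
    and "\<And>k. \<exists>C. \<forall>\<^sub>F n in sequentially.
           (\<integral>\<^sup>+ \<omega>. ennreal (linear_statistic n (X n)
               (\<lambda>x. \<bar>rescale n (\<nu> n) x\<bar> ^ k * indicator (- K) x) \<omega>) \<partial>M)
           \<le> ennreal (C * real n powr (- \<epsilon>))"
    and "(\<lambda>n. SUP x \<in> lattice n \<inter> K. ennreal \<bar>rescale n (\<nu> n) x - \<mu> x\<bar>) \<longlonglongrightarrow> 0"
    and "strict_mono_on K \<mu> \<or> strict_antimono_on K \<mu>"
    and "\<gamma> > 2"
    and "(\<integral>\<^sup>+ \<xi>. indicator {0..1} \<xi> * inverse (ennreal (\<bar>a \<xi>\<bar> powr (1 / \<gamma>))) \<partial>lborel) < \<infinity>"
    and "f riemann_integrable_on K"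
    and "(f \<circ> inv_into K \<mu>) riemann_integrable_on (\<mu> ` K)"
    and "polynomial_growth_off K (\<lambda>n. rescale n (\<nu> n)) f"
  shows "AE \<omega> in M.
    (\<lambda>n. linear_statistic n (X n) f \<omega> / real n) \<longlonglongrightarrow>
      1 / pi * integral {0..1} (\<lambda>\<xi>. integral {b \<xi> - 2 * a \<xi>..b \<xi> + 2 * a \<xi>}
        (\<lambda>u. f (inv_into K \<mu> u) / sqrt (4 * (a \<xi>)\<^sup>2 - (u - b \<xi>)\<^sup>2)))"
proof -
  have M: "prob_space M" by fact
  have pmf: "\<And>n. n \<ge> 1 \<Longrightarrow> has_joint_pmf_proportional_to M n (X n) (ensemble_density n (\<nu> n) (w n))" by fact
  let ?m = "\<lambda>k n. \<Sum>j<n. jacobi_power (\<nu> n) (w n) (p n) k j j"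
  have moments: "AE \<omega> in M. (\<lambda>n. linear_statistic n (X n) (\<lambda>x. rescale n (\<nu> n) x ^ k) \<omega> / real n)
      \<longlonglongrightarrow> integral {0..1} (\<lambda>\<xi>. arcsine_mean (\<lambda>u. u ^ k) (a \<xi>) (b \<xi>))" for k
  proof -
    obtain C where C: "\<forall>\<^sub>F n in sequentially. (\<Sum>j<n. jacobi_power (\<nu> n) (w n) (p n) (2 * k) j j
        - (\<Sum>i<n. (jacobi_power (\<nu> n) (w n) (p n) k i j)\<^sup>2)) \<le> C"
      using jacobi_variance_bound[OF assms(3,4,5,7,8,13,14)] by blast
    have var: "\<forall>\<^sub>F n in sequentially. (\<integral>\<^sup>+ \<omega>. ennreal ((linear_statistic n (X n) (\<lambda>x. rescale n (\<nu> n) x ^ k) \<omega> - ?m k n)\<^sup>2) \<partial>M) \<le> ennreal C"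
      using C eventually_ge_at_top[of 1]
    proof eventually_elim
      case (elim n)
      show ?case
        unfolding variance_power_statistic[OF M elim(2) pmf[OF elim(2)] assms(3)[OF elim(2)] assms(4)[OF elim(2)] assms(5)[OF elim(2)] assms(7)[OF elim(2)]]
        by (rule ennreal_leI[OF elim(1)])
    qed
    have mean: "(\<lambda>n. ?m k n / real n) \<longlonglongrightarrow> integral {0..1} (\<lambda>\<xi>. arcsine_mean (\<lambda>u. u ^ k) (a \<xi>) (b \<xi>))"
      by (rule jacobi_mean_limit[OF assms(3,4,5,7,8,13,14)])
    show ?thesis
      by (rule AE_average_tendsto[OF pmf var mean])
  qed
  have tails: "AE \<omega> in M. (\<lambda>n. linear_statistic n (X n) (\<lambda>x. \<bar>rescale n (\<nu> n) x\<bar> ^ k * indicator (- K) x) \<omega> / real n) \<longlonglongrightarrow> 0" for k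
  proof -
    obtain C where tl: "\<forall>\<^sub>F n in sequentially. (\<integral>\<^sup>+ \<omega>. ennreal (linear_statistic n (X n)
               (\<lambda>x. \<bar>rescale n (\<nu> n) x\<bar> ^ k * indicator (- K) x) \<omega>) \<partial>M) \<le> ennreal (C * real n powr (- \<epsilon>))"
      using assms(18)[of k] by blast
    show ?thesis
      by (rule AE_tail_tendsto_0[OF pmf _ \<open>\<epsilon> > 0\<close> tl]) simp_all
  qed
  have "\<mu> x \<noteq> \<mu> y" if "x \<in> K" "y \<in> K" "x < y" for x y
    using assms(20) that unfolding monotone_on_def by (metis order_less_irrefl)
  then have inj: "inj_on \<mu> K"
    unfolding inj_on_def by (metis linorder_neqE)
  have Z: "negligible {\<xi> \<in> {0..1}. a \<xi> = 0}"
    by (rule negligible_zero_set[OF assms(9) _ assms(22)]) (use \<open>\<gamma> > 2\<close> in simp)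
  have lat: "X n j \<omega> \<in> lattice n" if "\<omega> \<in> space M" "j \<in> {1..n}" for n j \<omega>
    using pmf[of n] that by (auto simp: has_joint_pmf_proportional_to_def)
  have "AE \<omega> in M. \<omega> \<in> space M" by simp
  \<comment> \<open>The exceptional null set depends on the exponent; there are countably many
    exponents, so one outcome can be fixed for all of them.\<close>
  moreover have "AE \<omega> in M. \<forall>k. (\<lambda>n. linear_statistic n (X n) (\<lambda>x. rescale n (\<nu> n) x ^ k) \<omega> / real n)
      \<longlonglongrightarrow> integral {0..1} (\<lambda>\<xi>. arcsine_mean (\<lambda>u. u ^ k) (a \<xi>) (b \<xi>))"
    using moments by (simp add: AE_all_countable)
  moreover have "AE \<omega> in M. \<forall>k. (\<lambda>n. linear_statistic n (X n) (\<lambda>x. \<bar>rescale n (\<nu> n) x\<bar> ^ k * indicator (- K) x) \<omega> / real n) \<longlonglongrightarrow> 0"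
    using tails by (simp add: AE_all_countable)
  ultimately show ?thesis
  proof eventually_elim
    case (elim \<omega>)
    have mom: "(\<lambda>n. (\<Sum>j=1..n. rescale n (\<nu> n) (X n j \<omega>) ^ k) / real n)
        \<longlonglongrightarrow> integral {0..1} (\<lambda>\<xi>. arcsine_mean (\<lambda>u. u ^ k) (a \<xi>) (b \<xi>))" for k
      using elim(2) unfolding linear_statistic_def by blast
    have tail: "(\<lambda>n. (\<Sum>j=1..n. \<bar>rescale n (\<nu> n) (X n j \<omega>)\<bar> ^ k * indicator (- K) (X n j \<omega>)) / real n) \<longlonglongrightarrow> 0" for k
      using elim(3) unfolding linear_statistic_def by blast
    have a0: "\<And>\<xi>. \<xi> \<in> {0..1} \<Longrightarrow> a \<xi> \<ge> 0" using assms(11) by blast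
    show ?case unfolding linear_statistic_def
      by (rule empirical_limit[where x = "\<lambda>n j. X n j \<omega>" and \<mu>n = "\<lambda>n. rescale n (\<nu> n)",
            OF assms(9,10) a0 Z lat[OF elim(1)] assms(16) inj assms(19) mom tail assms(24,25)])
  qed
qed

end
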